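(* Let $N\ge1$, let $\mu_1,\dots,\mu_N$ be non-zero real numbers, $\alpha>0$, $\nu_0>0$. For every $\nu\in\{\nu_0+k: k\in\mathbb{N}\}$ (with $\mathbb{N}=\{0,1,2,\dots\}$) let $\delta^{(\nu)}_1,\dots,\delta^{(\nu)}_N>0$ be given and assume there are real coefficients $c^{(\nu)},d^{(\nu)}$ with $$\delta^{(\nu+1)}_k=(d^{(\nu)}k+c^{(\nu)})\,\delta^{(\nu)}_k,\quad 1\le k\le N,\qquad \frac{\mu_{k+1}^2}{\mu_k^2}=d^{(\nu)}k(N-k)\frac{\delta^{(\nu)}_{k+1}}{\delta^{(\nu+1)}_k},\quad 1\le k\le N-1.$$ Let $\nu\in\{\nu_0+k:k\in\mathbb{N}\}$. Then the second-order differential operator $\mathcal{D}^{(\alpha,\nu)}=S^{(\alpha,\nu)}\circ\frac{d}{dx}$, i.e. $$(Q\mathcal{D}^{(\alpha,\nu)})(x)=\frac{d^2Q}{dx^2}(x)\,\Phi^{(\alpha,\nu)}(x)^\ast+\frac{dQ}{dx}(x)\,\Psi^{(\alpha,\nu)}(x)^\ast,$$ is symmetric with respect to the weight $W^{(\alpha,\nu)}_\mu$. Moreover, for all $n\in\mathbb{N}$, $$P_n^{(\alpha,\nu)}\mathcal{D}^{(\alpha,\nu)}=\Lambda_n^{(\alpha,\nu)}P_n^{(\alpha,\nu)},\qquad \Lambda_n^{(\alpha,\nu)}=nK_n^{(\alpha,\nu)}.$$ Moreover, the operators $\mathcal{D}^{(\alpha,\nu)}$ and $D^{(\alpha,\nu)}$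 commute.
   Context: The Laguerre polynomials $L_n^{(a)}(x)$ are defined by $(1-t)^{-1-a}\exp\left(\frac{xt}{t-1}\right)=\sum_{n\ge0}L_n^{(a)}(x)t^n$. $L^{(\alpha)}_\mu(x)$ is the $N\times N$ unipotent lower triangular matrix polynomial with $L^{(\alpha)}_\mu(x)_{m,n}=\frac{\mu_m}{\mu_n}L^{(\alpha+n)}_{m-n}(x)$ for $m\ge n$ and $0$ for $m<n$. $A_\mu$ is the $N\times N$ matrix whose only non-zero entries are $(A_\mu)_{k,k-1}=-\mu_k/\mu_{k-1}$, $2\le k\le N$; $J=\mathrm{diag}(1,2,\dots,N)$. Scalars in matrix expressions denote multiples of the identity matrix. The weight is $W^{(\alpha,\nu)}_\mu(x)=L^{(\alpha)}_\mu(x)T^{(\nu)}(x)L^{(\alpha)}_\mu(x)^\ast$, $x>0$, where $T^{(\nu)}(x)$ is the diagonal matrix with $T^{(\nu)}(x)_{k,k}=e^{-x}x^{\nu+k}\delta^{(\nu)}_k$. $P_n^{(\alpha,\nu)}\in M_N(\mathbb{C})[x]$ ($n\ge0$) are the monic (leading coefficient the identity) polynomials of degree $n$ with $\int_0^\infty P_n^{(\alpha,\nu)}W^{(\alpha,\nu)}_\mu (P_m^{(\alpha,\nu)})^\ast dx=0$ for $n\ne m$. $\Phi^{(\alpha,\nu)}(x)=(W^{(\alpha,\nu)}_\mu(x))^{-1}W^{(\alpha,\nu+1)}_\mu(x)$ and $\Psi^{(\alpha,\nu)}(x)=(W^{(\alpha,\nu)}_\mu(x))^{-1}\frac{dW^{(\alpha,\nu+1)}_\mu}{dx}(x)$;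 under the stated conditions these are matrix valued polynomials. All differential operators act from the right; $(QS^{(\alpha,\nu)})(x)=\frac{dQ}{dx}(x)(\Phi^{(\alpha,\nu)}(x))^\ast+Q(x)(\Psi^{(\alpha,\nu)}(x))^\ast$, and $\mathcal{D}^{(\alpha,\nu)}$ means: first differentiate, then apply $S^{(\alpha,\nu)}$. $K_n^{(\alpha,\nu)}=L^{(\alpha)}_\mu(0)\bigl[d^{(\nu)}(J-(J+\nu+n)A_\mu-N-1)-c^{(\nu)}\bigr]L^{(\alpha)}_\mu(0)^{-1}$. $D^{(\alpha,\nu)}$ is the operator $QD^{(\alpha,\nu)}=\frac{d^2Q}{dx^2}\,x+\frac{dQ}{dx}\bigl(-x(A_\mu+1)^{-1}+\nu+J+1+(\alpha+J)A_\mu\bigr)+Q\bigl((\alpha-\nu)(A_\mu+1)^{-1}-J\bigr)$. A differential operator $D$ acting from the right is symmetric with respect to a weight $W$ on $(0,\infty)$ if $\int_0^\infty (GD)(x)W(x)H(x)^\ast dx=\int_0^\infty G(x)W(x)\bigl((HD)(x)\bigr)^\ast dx$ for all $G,H\in M_N(\mathbb{C})[x]$. The operators commute as operators acting on matrix valued polynomials. *)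

theory Defs
  imports
    "HOL-Analysis.Analysis"
    "HOL-Computational_Algebra.Computational_Algebra"
    "Jordan_Normal_Form.Schur_Decomposition"
begin

(* N x N matrices have type "complex mat" and carrier "carrier_mat N N".  Their entries are
   addressed from 0, so the mathematical entry (m,n) with 1 <= m,n <= N is entry (m-1,n-1) here;
   the families mu, delta are functions of the mathematical index 1..N. *)

section \<open>Laguerre polynomials\<close>

(* Coefficient of t^n in (1-t)^(-1-a) * exp (x t / (t-1)), with t = fps_X. *)
definition laguerre :: "nat \<Rightarrow> real \<Rightarrow> real \<Rightarrow> real" where
  "laguerre n a x =
     fps_nth ((fps_binomial (- 1 - a) oo (- fps_X)) *
              (fps_exp 1 oo (fps_const x * fps_X / (fps_X - 1)))) n"

section \<open>Matrix valued functions and matrix polynomials\<close>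

abbreviation scalar_mat :: "nat \<Rightarrow> real \<Rightarrow> complex mat" where
  "scalar_mat N r \<equiv> of_real r \<cdot>\<^sub>m 1\<^sub>m N"

(* Unspecified on singular matrices. *)
abbreviation minv :: "complex mat \<Rightarrow> complex mat" where
  "minv A \<equiv> the (mat_inverse A)"

definition mat_deriv :: "(real \<Rightarrow> complex mat) \<Rightarrow> real \<Rightarrow> complex mat" where
  "mat_deriv F x = Matrix.mat (dim_row (F x)) (dim_col (F x))
     (\<lambda>(i,j). vector_derivative (\<lambda>t. F t $$ (i,j)) (at x))"

definition mat_integrable :: "nat \<Rightarrow> (real \<Rightarrow> complex mat) \<Rightarrow> bool" where
  "mat_integrable N F \<longleftrightarrow>
     (\<forall>i<N. \<forall>j<N. set_integrable lborel {0<..} (\<lambda>x. F x $$ (i,j)))"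

definition mat_integral :: "nat \<Rightarrow> (real \<Rightarrow> complex mat) \<Rightarrow> complex mat" where
  "mat_integral N F = Matrix.mat N N
     (\<lambda>(i,j). set_lebesgue_integral lborel {0<..} (\<lambda>x. F x $$ (i,j)))"

(* M_N(C)[x] is represented by "carrier_mat N N :: complex poly mat set". *)
definition eval_pm :: "complex poly mat \<Rightarrow> real \<Rightarrow> complex mat" where
  "eval_pm Q x = map_mat (\<lambda>p. poly p (of_real x)) Q"

definition monic_pm :: "nat \<Rightarrow> nat \<Rightarrow> complex poly mat \<Rightarrow> bool" where
  "monic_pm N n Q \<longleftrightarrow> Q \<in> carrier_mat N N \<and>
     (\<forall>i<N. \<forall>j<N. degree (Q $$ (i,j)) \<le> n) \<and>
     map_mat (\<lambda>p. coeff p n) Q = 1\<^sub>m N"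

definition monic_orthogonal ::
    "nat \<Rightarrow> (real \<Rightarrow> complex mat) \<Rightarrow> (nat \<Rightarrow> complex poly mat) \<Rightarrow> bool" where
  "monic_orthogonal N W P \<longleftrightarrow>
     (\<forall>n. monic_pm N n (P n)) \<and>
     (\<forall>m n. m \<noteq> n \<longrightarrow>
        mat_integral N (\<lambda>x. eval_pm (P n) x * W x * mat_adjoint (eval_pm (P m) x)) = 0\<^sub>m N N)"

section \<open>Differential operators\<close>

(* An operator sends matrix valued functions to matrix valued functions; only values on
   (0,\<infinity>) are meaningful, since the coefficients below come from weights on (0,\<infinity>).
   The operators act from the right: QD is written D Q. *)
type_synonym mat_op = "(real \<Rightarrow> complex mat) \<Rightarrow> real \<Rightarrow> complex mat"

(* Existence of the two integrals is part of the notion, as the integral of a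
   non-integrable function is 0 in the library. *)
definition symmetric_op :: "nat \<Rightarrow> (real \<Rightarrow> complex mat) \<Rightarrow> mat_op \<Rightarrow> bool" where
  "symmetric_op N W D \<longleftrightarrow>
     (\<forall>G\<in>carrier_mat N N. \<forall>H\<in>carrier_mat N N.
        mat_integrable N (\<lambda>x. D (eval_pm G) x * W x * mat_adjoint (eval_pm H x)) \<and>
        mat_integrable N (\<lambda>x. eval_pm G x * W x * mat_adjoint (D (eval_pm H) x)) \<and>
        mat_integral N (\<lambda>x. D (eval_pm G) x * W x * mat_adjoint (eval_pm H x)) =
        mat_integral N (\<lambda>x. eval_pm G x * W x * mat_adjoint (D (eval_pm H) x)))"

definition acts_on_polys :: "nat \<Rightarrow> mat_op \<Rightarrow> bool" where
  "acts_on_polys N D \<longleftrightarrow>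
     (\<forall>Q\<in>carrier_mat N N. \<exists>R\<in>carrier_mat N N. \<forall>x>0. D (eval_pm Q) x = eval_pm R x)"

definition commute_on_polys :: "nat \<Rightarrow> mat_op \<Rightarrow> mat_op \<Rightarrow> bool" where
  "commute_on_polys N D E \<longleftrightarrow> acts_on_polys N D \<and> acts_on_polys N E \<and>
     (\<forall>Q\<in>carrier_mat N N. \<forall>x>0. E (D (eval_pm Q)) x = D (E (eval_pm Q)) x)"

section \<open>The Laguerre-type weight and its operators\<close>

definition L_mat :: "nat \<Rightarrow> (nat \<Rightarrow> real) \<Rightarrow> real \<Rightarrow> real \<Rightarrow> complex mat" where
  "L_mat N \<mu> \<alpha> x = Matrix.mat N N (\<lambda>(i,j).
     if j \<le> i then of_real (\<mu> (i+1) / \<mu> (j+1) * laguerre (i - j) (\<alpha> + real (j+1)) x) else 0)"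

definition A_mat :: "nat \<Rightarrow> (nat \<Rightarrow> real) \<Rightarrow> complex mat" where
  "A_mat N \<mu> = Matrix.mat N N (\<lambda>(i,j).
     if i = j + 1 then of_real (- \<mu> (i+1) / \<mu> (j+1)) else 0)"

definition J_mat :: "nat \<Rightarrow> complex mat" where
  "J_mat N = mat_diag N (\<lambda>i. of_nat (i+1))"

definition T_mat :: "nat \<Rightarrow> (real \<Rightarrow> nat \<Rightarrow> real) \<Rightarrow> real \<Rightarrow> real \<Rightarrow> complex mat" where
  "T_mat N \<delta> \<nu> x =
     mat_diag N (\<lambda>i. of_real (exp (- x) * x powr (\<nu> + real (i+1)) * \<delta> \<nu> (i+1)))"

definition W_mat ::
    "nat \<Rightarrow> (nat \<Rightarrow> real) \<Rightarrow> (real \<Rightarrow> nat \<Rightarrow> real) \<Rightarrow> real \<Rightarrow> real \<Rightarrow> real \<Rightarrow> complex mat" where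
  "W_mat N \<mu> \<delta> \<alpha> \<nu> x = L_mat N \<mu> \<alpha> x * T_mat N \<delta> \<nu> x * mat_adjoint (L_mat N \<mu> \<alpha> x)"

definition Phi_mat ::
    "nat \<Rightarrow> (nat \<Rightarrow> real) \<Rightarrow> (real \<Rightarrow> nat \<Rightarrow> real) \<Rightarrow> real \<Rightarrow> real \<Rightarrow> real \<Rightarrow> complex mat" where
  "Phi_mat N \<mu> \<delta> \<alpha> \<nu> x = minv (W_mat N \<mu> \<delta> \<alpha> \<nu> x) * W_mat N \<mu> \<delta> \<alpha> (\<nu> + 1) x"

definition Psi_mat ::
    "nat \<Rightarrow> (nat \<Rightarrow> real) \<Rightarrow> (real \<Rightarrow> nat \<Rightarrow> real) \<Rightarrow> real \<Rightarrow> real \<Rightarrow> real \<Rightarrow> complex mat" where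
  "Psi_mat N \<mu> \<delta> \<alpha> \<nu> x =
     minv (W_mat N \<mu> \<delta> \<alpha> \<nu> x) * mat_deriv (W_mat N \<mu> \<delta> \<alpha> (\<nu> + 1)) x"

definition S_op ::
    "nat \<Rightarrow> (nat \<Rightarrow> real) \<Rightarrow> (real \<Rightarrow> nat \<Rightarrow> real) \<Rightarrow> real \<Rightarrow> real \<Rightarrow> mat_op" where
  "S_op N \<mu> \<delta> \<alpha> \<nu> Q x =
     mat_deriv Q x * mat_adjoint (Phi_mat N \<mu> \<delta> \<alpha> \<nu> x) +
     Q x * mat_adjoint (Psi_mat N \<mu> \<delta> \<alpha> \<nu> x)"

(* The operator written with a calligraphic D. *)
definition cal_D_op ::
    "nat \<Rightarrow> (nat \<Rightarrow> real) \<Rightarrow> (real \<Rightarrow> nat \<Rightarrow> real) \<Rightarrow> real \<Rightarrow> real \<Rightarrow> mat_op" where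
  "cal_D_op N \<mu> \<delta> \<alpha> \<nu> Q = S_op N \<mu> \<delta> \<alpha> \<nu> (mat_deriv Q)"

definition D_op :: "nat \<Rightarrow> (nat \<Rightarrow> real) \<Rightarrow> real \<Rightarrow> real \<Rightarrow> mat_op" where
  "D_op N \<mu> \<alpha> \<nu> Q x =
     mat_deriv (mat_deriv Q) x * scalar_mat N x +
     mat_deriv Q x *
       (- (of_real x \<cdot>\<^sub>m minv (A_mat N \<mu> + 1\<^sub>m N)) + scalar_mat N \<nu> + J_mat N + 1\<^sub>m N
        + (scalar_mat N \<alpha> + J_mat N) * A_mat N \<mu>) +
     Q x * (of_real (\<alpha> - \<nu>) \<cdot>\<^sub>m minv (A_mat N \<mu> + 1\<^sub>m N) - J_mat N)"

definition K_mat ::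
    "nat \<Rightarrow> (nat \<Rightarrow> real) \<Rightarrow> (real \<Rightarrow> real) \<Rightarrow> (real \<Rightarrow> real) \<Rightarrow> real \<Rightarrow> real \<Rightarrow> nat \<Rightarrow> complex mat"
  where
  "K_mat N \<mu> c d \<alpha> \<nu> n =
     L_mat N \<mu> \<alpha> 0 *
     (of_real (d \<nu>) \<cdot>\<^sub>m
        (J_mat N - (J_mat N + scalar_mat N \<nu> + scalar_mat N (real n)) * A_mat N \<mu>
         - scalar_mat N (real N) - 1\<^sub>m N)
      - scalar_mat N (c \<nu>)) *
     minv (L_mat N \<mu> \<alpha> 0)"

definition Lambda_mat ::
    "nat \<Rightarrow> (nat \<Rightarrow> real) \<Rightarrow> (real \<Rightarrow> real) \<Rightarrow> (real \<Rightarrow> real) \<Rightarrow> real \<Rightarrow> real \<Rightarrow> nat \<Rightarrow> complex mat"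
  where
  "Lambda_mat N \<mu> c d \<alpha> \<nu> n = of_nat n \<cdot>\<^sub>m K_mat N \<mu> c d \<alpha> \<nu> n"

end

theory Submission
  imports Defs "HOL-Real_Asymp.Real_Asymp"
begin

text \<open>
  Since \<open>L' = L A\<close>, one has \<open>L(x) = L(0) exp(x A)\<close>, and conjugation by \<open>exp(x A)\<close> acts polynomially on the
  \<open>sl\<^sub>2\<close> triple formed by \<open>A\<close>, \<open>J\<close> and a raising matrix coming from the condition on \<open>\<mu>\<close>. Hence, after
  conjugation by \<open>L(0) diag(\<mu>)\<close>, the coefficients of both operators are explicit tridiagonal polynomial matrices
  of degree at most two, and commutation is a direct computation on rows of polynomials.

  Symmetry is an integration by parts: \<open>\<Phi>\<^sup>* W\<close> is the weight \<open>W\<^sub>1\<close> with parameter \<open>\<nu> + 1\<close> and \<open>\<Psi>\<^sup>* W\<close> is its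
  derivative, so that applying the operator to \<open>G\<close> and multiplying by \<open>W\<close> gives the derivative of \<open>G' W\<^sub>1\<close>.

  The operator does not raise degrees and multiplies the leading coefficient of \<open>P\<^sub>n\<close> by \<open>\<Lambda>\<^sub>n\<close>. The difference
  \<open>R\<close> between the image of \<open>P\<^sub>n\<close> and \<open>\<Lambda>\<^sub>n P\<^sub>n\<close> thus has degree less than \<open>n\<close>; by symmetry it is
  orthogonal to itself, and it vanishes because the weight is positive definite.
\<close>

section \<open>Laguerre polynomials\<close>

text \<open>The factor k (N - k) in the condition on mu is the raising coefficient of the
  N-dimensional irreducible sl2 representation. With S the lower shift, the commutator of the
  raising matrix with S is affine in J, so conjugation by exp(-x S) stops at second order in x. The
  same factor vanishes at both ends of the index range, so the tridiagonal operators preserve the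
  sequences supported on the first N places and can be compared on infinite sequences.

  In L(0) diag(mu) the upper index of the binomials depends on the row only. Pascal's rule,
  absorption and the ratio of neighbouring binomials thereby become the conjugation rules for the
  coefficients of D.

  An obstacle is that \<open>Phi_mat\<close> and \<open>Psi_mat\<close> contain an inverse of the
  weight and are controlled only for x > 0. They are never computed by inversion: a candidate is
  confirmed by cancelling an invertible right factor, and equalities on the open half-line are
  carried through derivatives. In the integrals, \<open>\<nu>\<close> > 0 acts twice: boundary terms
  vanish, and the derivative, which loses one power of x, stays integrable.\<close>

lemma laguerre_explicit:
  "laguerre n a x = (\<Sum>i\<le>n. (- 1) ^ i / fact i * ((a + real n) gchoose (n - i)) * x ^ i)"
proof -
  define B where "B b = fps_binomial b oo (- fps_X :: real fps)" for b
  define U where "U = fps_X / (fps_X - 1 :: real fps)"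
  have Bmult: "B b * B c = B (b + c)" for b c
    unfolding B_def by (simp add: fps_binomial_add_mult fps_compose_mult_distrib)
  have "B (-1) * (1 - fps_X) = (fps_binomial (-1) * fps_binomial 1) oo (- fps_X)"
    unfolding B_def by (subst fps_compose_mult_distrib) (auto simp: fps_binomial_1 fps_compose_add_distrib)
  also have "\<dots> = 1"
    by (simp flip: fps_binomial_add_mult)
  finally have "B (-1) * (1 - fps_X) = 1" .
  then have Binv: "(- fps_X * B (-1)) * (fps_X - 1) = fps_X"
    by (metis (no_types, lifting) minus_diff_eq minus_mult_commute mult.assoc mult.right_neutral)
  moreover have nz: "fps_X - 1 \<noteq> (0 :: real fps)"
    by (metis fps_X_neq_one right_minus_eq)
  ultimately have U: "U = - fps_X * B (-1)"
    unfolding U_def using nonzero_mult_div_cancel_right by metis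
  have U_mult: "fps_X = U * (fps_X - 1)"
    unfolding U using Binv by simp
  have Bpow: "B (-1) ^ i = B (- real i)" for i
    by (induction i) (simp_all add: Bmult B_def[of 0])
  \<comment> \<open>As U = -t (1-t)^(-1), a power of U only shifts the exponent of 1-t, so the
    series in x can be read off term by term.\<close>
  have BU: "B (- 1 - a) * U ^ i = fps_const ((- 1) ^ i) * fps_X ^ i * B (- 1 - a - real i)" for i
  proof -
    have "U ^ i = fps_const ((- 1) ^ i) * fps_X ^ i * B (- real i)"
    proof -
      have "U = fps_const (- 1) * fps_X * B (- 1)"
        unfolding U by (simp flip: fps_const_neg)
      then show ?thesis
        by (simp add: power_mult_distrib Bpow del: fps_const_neg flip: fps_const_power)
    qed
    then show ?thesis
      using Bmult[of "- 1 - a" "- real i"] by (simp add: algebra_simps)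
  qed
  have coeff: "fps_nth (B (- 1 - a) * U ^ i) n = (- 1) ^ i * ((a + real n) gchoose (n - i))" if "i \<le> n" for i
  proof -
    have Bnth: "fps_nth (B b) k = (- 1) ^ k * (b gchoose k)" for b k
      unfolding B_def by (simp add: fps_compose_uminus')
    \<comment> \<open>Negating the upper index of the binomial cancels i and leaves a + n.\<close>
    have eq: "- 1 - a - real i = - (1 + a + real i)" by simp
    have "fps_nth (B (- 1 - a - real i)) (n - i) = ((a + real n) gchoose (n - i))"
      unfolding Bnth eq gbinomial_minus using that
      by (simp add: of_nat_diff flip: power_mult_distrib mult.assoc)
    then show ?thesis
      unfolding BU mult.assoc by (simp add: fps_X_power_mult_nth that not_less)
  qed
  \<comment> \<open>U has no constant term, so the inner sums can all be extended to i up to n and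
    the two summations swapped.\<close>
  have Usub: "fps_nth (U ^ i) k = 0" if "k < i" for i k
  proof -
    have "fps_nth U 0 = 0" unfolding U by simp
    then show ?thesis using that by (simp add: startsby_zero_power_prefix)
  qed
  have xU: "fps_const x * fps_X / (fps_X - 1) = fps_const x * U"
  proof -
    have "fps_const x * fps_X = fps_const x * U * (fps_X - 1)"
      by (subst U_mult) (simp add: mult.assoc)
    then show ?thesis using nz by (metis nonzero_mult_div_cancel_right)
  qed
  have "laguerre n a x = (\<Sum>j\<le>n. fps_nth (B (- 1 - a)) j * (\<Sum>i\<le>n - j. 1 / fact i * (x ^ i * fps_nth (U ^ i) (n - j))))"
    unfolding laguerre_def xU B_def[symmetric] fps_mult_nth
    by (simp add: fps_compose_nth power_mult_distrib atLeast0AtMost fps_const_power)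
  also have "\<dots> = (\<Sum>j\<le>n. fps_nth (B (- 1 - a)) j * (\<Sum>i\<le>n. 1 / fact i * (x ^ i * fps_nth (U ^ i) (n - j))))"
    by (intro sum.cong refl arg_cong2[where f="(*)"] sum.mono_neutral_left) (auto simp: Usub)
  also have "\<dots> = (\<Sum>i\<le>n. \<Sum>j\<le>n. 1 / fact i * x ^ i * (fps_nth (B (- 1 - a)) j * fps_nth (U ^ i) (n - j)))"
    unfolding sum_distrib_left by (subst sum.swap) (simp add: algebra_simps)
  also have "\<dots> = (\<Sum>i\<le>n. 1 / fact i * x ^ i * fps_nth (B (- 1 - a) * U ^ i) n)"
    unfolding fps_mult_nth sum_distrib_left atLeast0AtMost ..
  also have "\<dots> = (\<Sum>i\<le>n. (- 1) ^ i / fact i * ((a + real n) gchoose (n - i)) * x ^ i)"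
    by (intro sum.cong refl) (simp add: coeff)
  finally show ?thesis .
qed

section \<open>Matrices and matrix valued functions\<close>

lemma index_mult_mat_sum:
  assumes "A \<in> carrier_mat n m" "B \<in> carrier_mat m k" "i < n" "j < k"
  shows "(A * B) $$ (i,j) = (\<Sum>l<m. A $$ (i,l) * B $$ (l,j))"
  using assms by (simp add: scalar_prod_def lessThan_atLeast0)

lemma mat_adjoint_carrier [simp]: "A \<in> carrier_mat n n \<Longrightarrow> mat_adjoint A \<in> carrier_mat n n"
  by (auto simp: mat_adjoint_def)

lemma mat_adjoint_dim [simp]: "dim_row (mat_adjoint A) = dim_col A" "dim_col (mat_adjoint A) = dim_row A"
  by (simp_all add: mat_adjoint_def)

lemma mat_adjoint_index_dim [simp]:
  "i < dim_col A \<Longrightarrow> j < dim_row A \<Longrightarrow> mat_adjoint A $$ (i,j) = conjugate (A $$ (j,i))"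
  by (simp add: mat_adjoint_def mat_of_rows_def)

lemma mat_adjoint_index:
  assumes "A \<in> carrier_mat n n" "i < n" "j < n"
  shows "mat_adjoint A $$ (i,j) = conjugate (A $$ (j,i))"
  using assms by (simp add: mat_adjoint_def mat_of_rows_def)

lemma mat_adjoint_mult:
  fixes A B :: "complex mat"
  assumes "A \<in> carrier_mat n n" "B \<in> carrier_mat n n"
  shows "mat_adjoint (A * B) = mat_adjoint B * mat_adjoint A"
proof (rule eq_matI)
  fix i j assume "i < dim_row (mat_adjoint B * mat_adjoint A)" "j < dim_col (mat_adjoint B * mat_adjoint A)"
  then have ij: "i < n" "j < n"
    using carrier_matD[OF mat_adjoint_carrier[OF assms(1)]] carrier_matD[OF mat_adjoint_carrier[OF assms(2)]] by auto
  show "mat_adjoint (A * B) $$ (i,j) = (mat_adjoint B * mat_adjoint A) $$ (i,j)"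
    unfolding index_mult_mat_sum[OF mat_adjoint_carrier[OF assms(2)] mat_adjoint_carrier[OF assms(1)] ij]
      mat_adjoint_index[OF mult_carrier_mat[OF assms] ij] index_mult_mat_sum[OF assms ij(2,1)]
    using assms ij by (simp add: mult.commute)
qed (use assms in \<open>auto simp: mat_adjoint_def\<close>)

lemma mat_adjoint_adjoint [simp]:
  fixes A :: "complex mat"
  shows "A \<in> carrier_mat n n \<Longrightarrow> mat_adjoint (mat_adjoint A) = A"
  by (rule eq_matI) (auto simp: mat_adjoint_def mat_of_rows_def)

section \<open>Inverses, determinants and cancellation\<close>

lemma minv_nonsingular:
  assumes A: "A \<in> carrier_mat n n" and det: "det A \<noteq> 0"
  shows "minv A \<in> carrier_mat n n" "A * minv A = 1\<^sub>m n" "minv A * A = 1\<^sub>m n"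
proof -
  have "mat_inverse A \<noteq> None"
    using mat_inverse(1)[OF A, of "()"] det_non_zero_imp_unit[OF A det, of "()"] by blast
  then obtain B where "mat_inverse A = Some B" by blast
  with mat_inverse(2)[OF A this] show "minv A \<in> carrier_mat n n" "A * minv A = 1\<^sub>m n" "minv A * A = 1\<^sub>m n"
    by auto
qed

lemma mult_minv_cancel:
  assumes "A \<in> carrier_mat n n" "det A \<noteq> 0" "B \<in> carrier_mat n n"
  shows "A * (minv A * B) = B"
proof -
  have "A * (minv A * B) = A * minv A * B"
    using assms minv_nonsingular(1)[OF assms(1,2)] by (intro assoc_mult_mat[symmetric])
  then show ?thesis
    using assms minv_nonsingular(2)[OF assms(1,2)] by simp
qed

lemma det_lower_triangular_prod:
  assumes "A \<in> carrier_mat n n" "\<And>i j. i < j \<Longrightarrow> j < n \<Longrightarrow> A $$ (i,j) = 0"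
  shows "det A = (\<Prod>i<n. A $$ (i,i))"
  using det_lower_triangular[OF assms(2,1)] assms(1)
  by (simp add: prod_list_diag_prod lessThan_atLeast0)

lemma mult_right_cancel_mat:
  fixes X Y W :: "complex mat"
  assumes "X \<in> carrier_mat n n" "Y \<in> carrier_mat n n" "W \<in> carrier_mat n n" "det W \<noteq> 0"
    and "X * W = Y * W"
  shows "X = Y"
proof -
  have "Z = Z * W * minv W" if "Z \<in> carrier_mat n n" for Z
    using that assms(3) minv_nonsingular[OF assms(3,4)] by (simp add: assoc_mult_mat[of _ n n _ n _ n])
  then show ?thesis using assms by metis
qed

text \<open>All three bands are indexed by the column. Right multiplication therefore uses the bands
  at \<open>j\<close> itself, whereas left multiplication reads them at \<open>l (i-1)\<close>,
  \<open>a i\<close>, \<open>u (i+1)\<close>.\<close>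

definition tridiag :: "nat \<Rightarrow> (nat \<Rightarrow> 'a::semiring_1) \<Rightarrow> (nat \<Rightarrow> 'a) \<Rightarrow> (nat \<Rightarrow> 'a) \<Rightarrow> 'a mat" where
  "tridiag n l a u = Matrix.mat n n
     (\<lambda>(i,j). if i = j then a j else if i = j + 1 then l j else if j = i + 1 then u j else 0)"

lemma tridiag_carrier [simp]: "tridiag n l a u \<in> carrier_mat n n"
  by (simp add: tridiag_def)

lemma tridiag_dim [simp]: "dim_row (tridiag n l a u) = n" "dim_col (tridiag n l a u) = n"
  by (simp_all add: tridiag_def)

lemma tridiag_index [simp]:
  "i < n \<Longrightarrow> j < n \<Longrightarrow> tridiag n l a u $$ (i,j) =
     (if i = j then a j else if i = j + 1 then l j else if j = i + 1 then u j else 0)"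
  by (simp add: tridiag_def)

lemma mult_tridiag_index:
  fixes X :: "'a::semiring_1 mat"
  assumes "X \<in> carrier_mat n n" "i < n" "j < n"
  shows "(X * tridiag n l a u) $$ (i,j) =
    X $$ (i,j) * a j + (if j + 1 < n then X $$ (i,j+1) * l j else 0) + (if 0 < j then X $$ (i,j-1) * u j else 0)"
proof -
  have "(X * tridiag n l a u) $$ (i,j) = (\<Sum>k<n. X $$ (i,k) * tridiag n l a u $$ (k,j))"
    by (rule index_mult_mat_sum[OF assms(1) _ assms(2,3)]) simp
  also have "\<dots> = (\<Sum>k<n. (if k = j then X $$ (i,j) * a j else 0) + (if k = j + 1 then X $$ (i,j+1) * l j else 0)
      + (if k = j - 1 then if 0 < j then X $$ (i,j-1) * u j else 0 else 0))"
    using assms by (intro sum.cong) auto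
  also have "\<dots> = X $$ (i,j) * a j + (if j + 1 < n then X $$ (i,j+1) * l j else 0) + (if 0 < j then X $$ (i,j-1) * u j else 0)"
    using assms by (auto simp: sum.distrib)
  finally show ?thesis .
qed

lemma tridiag_mult_index:
  fixes X :: "'a::semiring_1 mat"
  assumes "X \<in> carrier_mat n n" "i < n" "j < n"
  shows "(tridiag n l a u * X) $$ (i,j) =
    a i * X $$ (i,j) + (if 0 < i then l (i-1) * X $$ (i-1,j) else 0) + (if i + 1 < n then u (i+1) * X $$ (i+1,j) else 0)"
proof -
  have "(tridiag n l a u * X) $$ (i,j) = (\<Sum>k<n. tridiag n l a u $$ (i,k) * X $$ (k,j))"
    by (rule index_mult_mat_sum[OF _ assms]) simp
  also have "\<dots> = (\<Sum>k<n. (if k = i then a i * X $$ (i,j) else 0) + (if k = i - 1 then if 0 < i then l (i-1) * X $$ (i-1,j) else 0 else 0)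
      + (if k = i + 1 then u (i+1) * X $$ (i+1,j) else 0))"
    using assms by (intro sum.cong) auto
  also have "\<dots> = a i * X $$ (i,j) + (if 0 < i then l (i-1) * X $$ (i-1,j) else 0) + (if i + 1 < n then u (i+1) * X $$ (i+1,j) else 0)"
    using assms by (auto simp: sum.distrib)
  finally show ?thesis .
qed

text \<open>\<open>mat_deriv\<close> returns the value of \<open>vector_derivative\<close>, which is
  meaningless where no derivative exists; this predicate carries existence and fixed dimensions, as
  the product rule requires.\<close>

definition has_mat_deriv :: "nat \<Rightarrow> (real \<Rightarrow> complex mat) \<Rightarrow> complex mat \<Rightarrow> real \<Rightarrow> bool" where
  "has_mat_deriv n F F' x \<longleftrightarrow> (\<forall>t. F t \<in> carrier_mat n n) \<and> F' \<in> carrier_mat n n \<and>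
     (\<forall>i<n. \<forall>j<n. ((\<lambda>t. F t $$ (i,j)) has_vector_derivative F' $$ (i,j)) (at x))"

lemma has_mat_deriv_imp_mat_deriv:
  assumes "has_mat_deriv n F F' x"
  shows "mat_deriv F x = F'"
proof (rule eq_matI)
  fix i j assume "i < dim_row F'" "j < dim_col F'"
  moreover have "dim_row (F x) = n" "dim_col (F x) = n"
    using assms by (auto simp: has_mat_deriv_def)
  ultimately show "mat_deriv F x $$ (i,j) = F' $$ (i,j)"
    using assms unfolding has_mat_deriv_def mat_deriv_def by (auto simp: vector_derivative_at)
qed (use assms in \<open>auto simp: has_mat_deriv_def mat_deriv_def\<close>)

lemma has_mat_deriv_mult:
  assumes "has_mat_deriv n F F' x" "has_mat_deriv n G G' x"
  shows "has_mat_deriv n (\<lambda>t. F t * G t) (F' * G x + F x * G') x"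
  unfolding has_mat_deriv_def
proof (intro conjI allI impI)
  note FG = assms[unfolded has_mat_deriv_def]
  show "F t * G t \<in> carrier_mat n n" for t using FG by (metis mult_carrier_mat)
  show "F' * G x + F x * G' \<in> carrier_mat n n"
    using FG by (metis mult_carrier_mat add_carrier_mat)
  fix i j assume ij: "i < n" "j < n"
  have "(\<lambda>t. (F t * G t) $$ (i,j)) = (\<lambda>t. \<Sum>k<n. F t $$ (i,k) * G t $$ (k,j))"
    using FG ij by (intro ext index_mult_mat_sum) auto
  moreover have "(F' * G x + F x * G') $$ (i,j) =
      (\<Sum>k<n. F x $$ (i,k) * G' $$ (k,j) + F' $$ (i,k) * G x $$ (k,j))"
  proof -
    have "(F' * G x + F x * G') $$ (i,j) = (F' * G x) $$ (i,j) + (F x * G') $$ (i,j)"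
      using FG ij by (metis mult_carrier_mat carrier_matD index_add_mat(1))
    moreover have "(F' * G x) $$ (i,j) = (\<Sum>k<n. F' $$ (i,k) * G x $$ (k,j))"
      using FG ij by (intro index_mult_mat_sum) auto
    moreover have "(F x * G') $$ (i,j) = (\<Sum>k<n. F x $$ (i,k) * G' $$ (k,j))"
      using FG ij by (intro index_mult_mat_sum) auto
    ultimately show ?thesis by (simp add: sum.distrib)
  qed
  moreover have "((\<lambda>t. \<Sum>k<n. F t $$ (i,k) * G t $$ (k,j)) has_vector_derivative
      (\<Sum>k<n. F x $$ (i,k) * G' $$ (k,j) + F' $$ (i,k) * G x $$ (k,j))) (at x)"
    using FG ij by (intro has_vector_derivative_sum has_vector_derivative_mult) auto
  ultimately show "((\<lambda>t. (F t * G t) $$ (i,j)) has_vector_derivative (F' * G x + F x * G') $$ (i,j)) (at x)"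
    by simp
qed

lemma has_mat_deriv_adjoint:
  assumes "has_mat_deriv n F F' x"
  shows "has_mat_deriv n (\<lambda>t. mat_adjoint (F t)) (mat_adjoint F') x"
  unfolding has_mat_deriv_def
proof (intro conjI allI impI)
  note F = assms[unfolded has_mat_deriv_def]
  show "mat_adjoint (F t) \<in> carrier_mat n n" for t using F by simp
  show "mat_adjoint F' \<in> carrier_mat n n" using F by simp
  fix i j assume ij: "i < n" "j < n"
  have "(\<lambda>t. mat_adjoint (F t) $$ (i,j)) = (\<lambda>t. cnj (F t $$ (j,i)))"
    using F ij by (intro ext) (simp add: mat_adjoint_index[where n=n])
  moreover have "mat_adjoint F' $$ (i,j) = cnj (F' $$ (j,i))"
    using F ij by (simp add: mat_adjoint_index[where n=n])
  ultimately show "((\<lambda>t. mat_adjoint (F t) $$ (i,j)) has_vector_derivative mat_adjoint F' $$ (i,j)) (at x)"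
    using F ij by (simp add: has_vector_derivative_cnj)
qed

text \<open>The half-line is open, so agreement on it passes to derivatives. This is what allows one
  operator to be applied to the output of another that is a polynomial only for positive
  \<open>x\<close>.\<close>

lemma mat_deriv_cong:
  assumes "\<And>y. y > 0 \<Longrightarrow> F y = G y" "(x::real) > 0"
  shows "mat_deriv F x = mat_deriv G x"
proof -
  have "\<forall>\<^sub>F y in nhds x. F y = G y"
    using eventually_nhds_in_open[of "{0<..}" x] assms by (auto elim!: eventually_mono)
  then have "vector_derivative (\<lambda>t. F t $$ ij) (at x) = vector_derivative (\<lambda>t. G t $$ ij) (at x)" for ij
    by (intro vector_derivative_cong_eq) (auto elim!: eventually_mono)
  then show ?thesis
    unfolding mat_deriv_def using assms by simp
qed

section \<open>Matrix polynomials as functions\<close>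

lemma eval_pm_carrier [simp]: "Q \<in> carrier_mat n m \<Longrightarrow> eval_pm Q x \<in> carrier_mat n m"
  by (simp add: eval_pm_def)

lemma eval_pm_index [simp]:
  "i < dim_row Q \<Longrightarrow> j < dim_col Q \<Longrightarrow> eval_pm Q x $$ (i,j) = poly (Q $$ (i,j)) (of_real x)"
  by (simp add: eval_pm_def)

lemma eval_pm_mult:
  assumes "A \<in> carrier_mat n n" "B \<in> carrier_mat n n"
  shows "eval_pm (A * B) x = eval_pm A x * eval_pm B x"
proof (rule eq_matI)
  fix i j assume "i < dim_row (eval_pm A x * eval_pm B x)" "j < dim_col (eval_pm A x * eval_pm B x)"
  then have ij: "i < n" "j < n" using assms by (auto simp: eval_pm_def)
  have "eval_pm (A * B) x $$ (i,j) = poly ((A * B) $$ (i,j)) (of_real x)"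
    using assms ij by (auto intro!: eval_pm_index)
  also have "\<dots> = (\<Sum>l<n. poly (A $$ (i,l)) (of_real x) * poly (B $$ (l,j)) (of_real x))"
    unfolding index_mult_mat_sum[OF assms ij] by (simp add: poly_sum)
  also have "\<dots> = (eval_pm A x * eval_pm B x) $$ (i,j)"
    using assms ij by (subst index_mult_mat_sum[of _ n n _ n]) auto
  finally show "eval_pm (A * B) x $$ (i,j) = (eval_pm A x * eval_pm B x) $$ (i,j)" .
qed (use assms in \<open>auto simp: eval_pm_def\<close>)

lemma has_mat_deriv_eval_pm:
  assumes "Q \<in> carrier_mat n n"
  shows "has_mat_deriv n (eval_pm Q) (eval_pm (map_mat pderiv Q) x) x"
  using assms unfolding has_mat_deriv_def
  by (auto intro!: has_vector_derivative_real_field poly_DERIV)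

lemma mat_deriv_eval_pm:
  "Q \<in> carrier_mat n n \<Longrightarrow> mat_deriv (eval_pm Q) = eval_pm (map_mat pderiv Q)"
  using has_mat_deriv_imp_mat_deriv[OF has_mat_deriv_eval_pm] by blast

section \<open>Integration against Gamma densities\<close>

text \<open>Only positive \<open>x\<close> is constrained and the polynomial is existential: integer
  powers of x beyond the common x^a are absorbed into it, so sums of entries with different powers
  stay in one class.\<close>

definition gamma_weighted :: "real \<Rightarrow> (real \<Rightarrow> complex) \<Rightarrow> bool" where
  "gamma_weighted a f \<longleftrightarrow>
     (\<exists>p. \<forall>x>0. f x = of_real (exp (- x) * x powr a) * poly p (of_real x))"

lemma gamma_weightedI:
  "(\<And>x. x > 0 \<Longrightarrow> f x = of_real (exp (- x) * x powr a) * poly p (of_real x)) \<Longrightarrow> gamma_weighted a f"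
  unfolding gamma_weighted_def by blast

lemma gamma_weighted_cong:
  "gamma_weighted a f \<Longrightarrow> (\<And>x. x > 0 \<Longrightarrow> f x = g x) \<Longrightarrow> gamma_weighted a g"
  unfolding gamma_weighted_def by metis

lemma gamma_weighted_zero: "gamma_weighted a (\<lambda>x. 0)"
  by (rule gamma_weightedI[where p=0]) simp

lemma gamma_weighted_add:
  assumes "gamma_weighted a f" "gamma_weighted a g"
  shows "gamma_weighted a (\<lambda>x. f x + g x)"
proof -
  from assms obtain p q where "\<And>x. x > 0 \<Longrightarrow> f x = of_real (exp (- x) * x powr a) * poly p (of_real x)"
    "\<And>x. x > 0 \<Longrightarrow> g x = of_real (exp (- x) * x powr a) * poly q (of_real x)"
    unfolding gamma_weighted_def by blast
  then show ?thesis by (intro gamma_weightedI[where p="p + q"]) (simp add: algebra_simps)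
qed

lemma gamma_weighted_mult_poly:
  assumes "gamma_weighted a f"
  shows "gamma_weighted a (\<lambda>x. poly q (of_real x) * f x)"
proof -
  from assms obtain p where "\<And>x. x > 0 \<Longrightarrow> f x = of_real (exp (- x) * x powr a) * poly p (of_real x)"
    unfolding gamma_weighted_def by blast
  then show ?thesis by (intro gamma_weightedI[where p="q * p"]) (simp add: algebra_simps)
qed

lemma gamma_weighted_sum:
  "(\<And>i. i \<in> I \<Longrightarrow> gamma_weighted a (f i)) \<Longrightarrow> gamma_weighted a (\<lambda>x. \<Sum>i\<in>I. f i x)"
  by (induction I rule: infinite_finite_induct) (auto simp: gamma_weighted_zero gamma_weighted_add)

lemma set_integrable_exp_powr:
  assumes "a > - 1"
  shows "set_integrable lborel {0<..} (\<lambda>x::real. exp (- x) * x powr a)"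
proof -
  have "((\<lambda>t. t powr a / exp t) has_integral Gamma (a + 1)) {0..}"
    using Gamma_integral_real[of "a + 1"] assms by simp
  then have "(\<lambda>t. t powr a / exp t) integrable_on {0..}" by blast
  then have "(\<lambda>t. t powr a / exp t) integrable_on {0<..}"
    by (rule integrable_spike_set) (auto intro: negligible_subset[of "{0}"])
  \<comment> \<open>Gauge integrability of a nonnegative function is absolute, which turns the Gamma
    integral into a Lebesgue one.\<close>
  then have "set_integrable lebesgue {0<..} (\<lambda>t. t powr a / exp t)"
    by (intro nonnegative_absolutely_integrable_1) auto
  then show ?thesis
    unfolding set_integrable_def by (subst (asm) integrable_completion) (auto simp: exp_minus field_simps)
qed

lemma gamma_weighted_integrable:
  assumes "a > - 1" "gamma_weighted a f"
  shows "set_integrable lborel {0<..} f"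
proof -
  obtain p where p: "\<And>x. x > 0 \<Longrightarrow> f x = of_real (exp (- x) * x powr a) * poly p (of_real x)"
    using assms(2) unfolding gamma_weighted_def by blast
  have "set_integrable lborel {0<..} (\<lambda>x. complex_of_real (exp (- x) * x powr (a + real i)))" for i
    using set_integrable_exp_powr[of "a + real i", unfolded set_integrable_def, THEN integrable_of_real[where 'a=complex]] assms(1)
    unfolding set_integrable_def by (simp add: scaleR_conv_of_real)
  then have "set_integrable lborel {0<..} (\<lambda>x. \<Sum>i\<le>degree p. coeff p i * of_real (exp (- x) * x powr (a + real i)))"
    unfolding set_integrable_def scaleR_sum_right
    by (intro Bochner_Integration.integrable_sum set_integrable_mult_right[unfolded set_integrable_def])
  then show ?thesis
    by (rule set_integrable_cong[THEN iffD1, rotated -1])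
      (auto simp: p poly_altdef sum_distrib_left powr_add powr_realpow algebra_simps)
qed

lemma has_real_derivative_exp_powr:
  "x > 0 \<Longrightarrow> ((\<lambda>x. exp (- x) * x powr a) has_real_derivative
     exp (- x) * (a * x powr (a - 1)) - exp (- x) * x powr a) (at x)"
  by (auto intro!: derivative_eq_intros simp: algebra_simps powr_diff)

text \<open>Writing x^a = x x^(a-1) lets every term of the product rule share the factor exp(-x)
  x^(a-1), so differentiation costs exactly one power of x.\<close>

lemma gamma_weighted_deriv:
  fixes f :: "real \<Rightarrow> complex"
  assumes f: "\<And>x. x > 0 \<Longrightarrow> f x = of_real (exp (- x) * x powr a) * poly p (of_real x)" and x: "x > 0"
  shows "(f has_vector_derivative of_real (exp (- x) * x powr (a - 1)) *
     poly ([:of_real a:] * p + [:0, 1:] * (pderiv p - p)) (of_real x)) (at x)"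
proof -
  have 2: "((\<lambda>x. poly p (of_real x)) has_vector_derivative poly (pderiv p) (of_real x)) (at x)"
    by (intro has_vector_derivative_real_field poly_DERIV)
  have 3: "x powr a = x * x powr (a - 1)"
    using x by (simp add: powr_diff)
  have "((\<lambda>x. of_real (exp (- x) * x powr a) * poly p (of_real x)) has_vector_derivative
      of_real (exp (- x) * x powr (a - 1)) *
     poly ([:of_real a:] * p + [:0, 1:] * (pderiv p - p)) (of_real x)) (at x)"
    by (rule has_vector_derivative_eq_rhs
          [OF has_vector_derivative_mult[OF has_vector_derivative_of_real[OF has_real_derivative_exp_powr[OF x]] 2]])
      (simp add: 3 algebra_simps)
  then show ?thesis
    by (rule has_vector_derivative_transform_within_open[of _ _ _ "{0<..}"]) (use f x in auto)
qed

lemma gamma_weighted_tendsto: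
  assumes "gamma_weighted a f" "a > 0"
  shows "(f \<longlongrightarrow> 0) (at_right 0)" "(f \<longlongrightarrow> 0) at_top"
proof -
  obtain p where p: "\<And>x. x > 0 \<Longrightarrow> f x = of_real (exp (- x) * x powr a) * poly p (of_real x)"
    using assms(1) unfolding gamma_weighted_def by blast
  have eq: "f x = (\<Sum>i\<le>degree p. coeff p i * of_real (exp (- x) * x powr a * x ^ i))" if "x > 0" for x
    using that by (simp add: p poly_altdef sum_distrib_left algebra_simps)
  have "((\<lambda>x. \<Sum>i\<le>degree p. coeff p i * of_real (exp (- x) * x powr a * x ^ i)) \<longlongrightarrow>
      (\<Sum>i\<le>degree p. coeff p i * of_real 0)) (at_right 0)"
  proof (intro tendsto_intros)
    fix i :: nat
    have "((\<lambda>x::real. exp (- x) * x powr a * x ^ i) \<longlongrightarrow> exp (- 0) * 0 * 0 ^ i) (at_right 0)"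
      using \<open>a > 0\<close> by (intro tendsto_intros) (real_asymp | simp)+
    then show "((\<lambda>x::real. exp (- x) * x powr a * x ^ i) \<longlongrightarrow> 0) (at_right 0)" by simp
  qed
  then show "(f \<longlongrightarrow> 0) (at_right 0)"
    by (subst tendsto_cong) (auto simp: eventually_at_right_less eq intro: eventually_mono[OF eventually_at_right_less[of 0]])
  have "((\<lambda>x. \<Sum>i\<le>degree p. coeff p i * of_real (exp (- x) * x powr a * x ^ i)) \<longlongrightarrow>
      (\<Sum>i\<le>degree p. coeff p i * of_real 0)) at_top"
  proof (intro tendsto_intros)
    fix i :: nat
    have "((\<lambda>x::real. exp (- x) * x powr (a + real i)) \<longlongrightarrow> 0) at_top"
      by real_asymp
    then show "((\<lambda>x::real. exp (- x) * x powr a * x ^ i) \<longlongrightarrow> 0) at_top"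
      by (rule Lim_transform_eventually)
        (auto simp: powr_add powr_realpow intro: eventually_mono[OF eventually_gt_at_top[of 0]])
  qed
  then show "(f \<longlongrightarrow> 0) at_top"
    by (subst tendsto_cong) (auto simp: eq intro: eventually_mono[OF eventually_gt_at_top[of 0]])
qed

text \<open>For a > 0 the function tends to 0 at both ends, and the exponent a - 1 > -1 of its
  derivative is still integrable, so the fundamental theorem applies on the whole half-line.\<close>

lemma gamma_weighted_integral_deriv:
  assumes f: "gamma_weighted a f" and a: "a > 0"
    and f': "\<And>x. x > 0 \<Longrightarrow> (f has_vector_derivative f' x) (at x)"
  shows "set_integrable lborel {0<..} f'" "set_lebesgue_integral lborel {0<..} f' = 0"
proof -
  obtain p where p: "\<And>x. x > 0 \<Longrightarrow> f x = of_real (exp (- x) * x powr a) * poly p (of_real x)"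
    using f unfolding gamma_weighted_def by blast
  \<comment> \<open>Uniqueness of derivatives identifies the given \<open>f'\<close> with the
    explicit formula, from which integrability and continuity follow.\<close>
  have f'_eq: "f' x = of_real (exp (- x) * x powr (a - 1)) *
     poly ([:of_real a:] * p + [:0, 1:] * (pderiv p - p)) (of_real x)" if "x > 0" for x
    using gamma_weighted_deriv[OF p that] f'[OF that] vector_derivative_unique_at by blast
  then have f'_weighted: "gamma_weighted (a - 1) f'"
    by (rule gamma_weightedI)
  show int: "set_integrable lborel {0<..} f'"
    using gamma_weighted_integrable[OF _ f'_weighted] a by simp
  have cont: "isCont f' x" if "x > 0" for x
  proof -
    have "isCont (\<lambda>x. of_real (exp (- x) * x powr (a - 1)) *
        poly ([:of_real a:] * p + [:0, 1:] * (pderiv p - p)) (of_real x)) x"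
      using that by (intro continuous_intros) auto
    moreover have "\<forall>\<^sub>F y in nhds x. of_real (exp (- y) * y powr (a - 1)) *
        poly ([:of_real a:] * p + [:0, 1:] * (pderiv p - p)) (of_real y) = f' y"
      using eventually_nhds_in_open[of "{0<..}" x] that by (auto elim!: eventually_mono simp: f'_eq)
    ultimately show ?thesis using isCont_cong by fast
  qed
  have einterval_0_infty: "einterval (ereal 0) \<infinity> = {0<..}"
    by (auto simp: einterval_def)
  have "(LBINT x=ereal 0..\<infinity>. f' x) = 0 - 0"
    using gamma_weighted_tendsto[OF f a] int
    by (intro interval_integral_FTC_integrable[where F=f] f' cont)
      (auto simp: ereal_tendsto_simps1 einterval_0_infty)
  then show "set_lebesgue_integral lborel {0<..} f' = 0"
    by (simp add: interval_lebesgue_integral_0_infty zero_ereal_def[symmetric])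
qed

section \<open>The conjugated operators on rows\<close>

text \<open>These are \<open>D\<close> and the calligraphic \<open>D\<close> after conjugation by \<open>L(0) diag(\<mu>)\<close>, acting on a row with entries
  \<open>q 0, q 1, \<dots>\<close>. They commute on arbitrary sequences: the factor \<open>j\<close> makes the junk index \<open>0 - 1\<close> harmless.\<close>

definition row_D :: "'a::idom poly \<Rightarrow> 'a poly \<Rightarrow> (nat \<Rightarrow> 'a poly) \<Rightarrow> nat \<Rightarrow> 'a poly" where
  "row_D a v q j =
     [:0,1:] * pderiv (pderiv (q j)) + (of_nat j + 2 + v - [:0,1:]) * pderiv (q j) - [:0,1:] * pderiv (q (Suc j))
     + (a - v - of_nat j - 1) * q j - (of_nat j + 2 + v) * q (Suc j)"

definition row_calD :: "nat \<Rightarrow> 'a::idom poly \<Rightarrow> 'a poly \<Rightarrow> 'a poly \<Rightarrow> (nat \<Rightarrow> 'a poly) \<Rightarrow> nat \<Rightarrow> 'a poly" where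
  "row_calD n v c d q j =
     [:0,1:] * (d * (of_nat j + 1) + c) * pderiv (pderiv (q j))
     + d * [:0,1:] * [:0,1:] * pderiv (pderiv (q (Suc j)))
     + ([:0,1:] * (d * (of_nat j - of_nat n) - c) + (d * (of_nat j + 1) + c) * (of_nat j + 2 + v)) * pderiv (q j)
     + [:0,1:] * d * (of_nat j + 3 + v) * pderiv (q (Suc j))
     - d * of_nat j * (of_nat n - of_nat j) * pderiv (q (j - 1))"

lemma row_D_calD_commute:
  assumes [simp]: "pderiv a = 0" "pderiv v = 0" "pderiv c = 0" "pderiv d = 0"
  shows "row_D a v (row_calD n v c d q) = row_calD n v c d (row_D a v q)"
proof
  fix j
  \<comment> \<open>The variable is made an opaque atom with derivative 1, so that both sides can be
    normalised as expressions in \<open>X\<close> and the derivatives of the entries.\<close>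
  define X where "X = ([:0,1:] :: 'a poly)"
  have [simp]: "pderiv X = 1" by (simp add: X_def pderiv_pCons)
  have [simp]: "pderiv (of_nat m) = (0 :: 'a poly)" for m
    by (induction m) (auto simp: pderiv_add)
  have [simp]: "pderiv (numeral m) = (0 :: 'a poly)" for m
    by (metis \<open>\<And>m. pderiv (of_nat m) = 0\<close> of_nat_numeral)
  note pd = pderiv_add pderiv_diff pderiv_mult pderiv_minus
  show "row_D a v (row_calD n v c d q) j = row_calD n v c d (row_D a v q) j"
  proof (cases j)
    case 0
    show ?thesis unfolding 0
      unfolding row_D_def row_calD_def X_def[symmetric]
      by (simp add: pd algebra_simps)
  next
    case (Suc i)
    show ?thesis unfolding Suc
      unfolding row_D_def row_calD_def X_def[symmetric]
      by (simp add: pd algebra_simps)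
  qed
qed

section \<open>The exponential of the shift\<close>

definition laguerre_poly :: "nat \<Rightarrow> real \<Rightarrow> complex poly" where
  "laguerre_poly n a = (\<Sum>i\<le>n. monom (of_real ((- 1) ^ i / fact i * ((a + real n) gchoose (n - i)))) i)"

lemma poly_laguerre_poly: "poly (laguerre_poly n a) (of_real x) = of_real (laguerre n a x)"
  by (simp add: laguerre_poly_def laguerre_explicit poly_sum poly_monom)

text \<open>Entries of exp(-x S) for the lower shift S, that is, of exp(x A) after conjugation by
  diag(mu).\<close>

definition exp_coeff :: "real \<Rightarrow> nat \<Rightarrow> nat \<Rightarrow> real" where
  "exp_coeff x i j = (if j \<le> i then (- x) ^ (i - j) / fact (i - j) else 0)"

lemma Suc_times_exp_coeff: "real (Suc m) * ((- x) ^ Suc m / fact (Suc m)) = - x * ((- x) ^ m / fact m)"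
  by (simp del: of_nat_Suc)

lemma exp_coeff_diff_row: "(real i - real j) * exp_coeff x i j = - x * (if 0 < i then exp_coeff x (i-1) j else 0)"
proof (cases "j < i")
  case True
  then obtain m where "i = Suc (j + m)" by (metis less_imp_Suc_add)
  then show ?thesis
    using Suc_times_exp_coeff[of m x] by (simp add: exp_coeff_def Suc_diff_le)
qed (auto simp: exp_coeff_def)

text \<open>The same commutator as -x E S, since S commutes with E.\<close>

lemma exp_coeff_diff_col: "(real i - real j) * exp_coeff x i j = - x * exp_coeff x i (Suc j)"
proof (cases "j < i")
  case True
  then obtain m where "i = Suc (j + m)" by (metis less_imp_Suc_add)
  then show ?thesis
    using Suc_times_exp_coeff[of m x] by (simp add: exp_coeff_def Suc_diff_le)
qed (auto simp: exp_coeff_def)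

lemma exp_coeff_deriv:
  "((\<lambda>x. exp_coeff x i j) has_real_derivative - exp_coeff x i (Suc j)) (at x)"
proof (cases "j < i")
  case True
  then obtain m where m: "i = Suc (j + m)" by (metis less_imp_Suc_add)
  have "((\<lambda>x::real. (- x) ^ Suc m / fact (Suc m)) has_real_derivative
      real (Suc m) * (- x) ^ m * - 1 / fact (Suc m)) (at x)"
    by (rule derivative_eq_intros | simp)+
  moreover have "real (Suc m) * (- x) ^ m * - 1 / fact (Suc m) = - ((- x) ^ m / fact m)"
    by (simp del: of_nat_Suc)
  ultimately show ?thesis by (simp add: exp_coeff_def m Suc_diff_le del: power_Suc fact_Suc of_nat_Suc)
next
  case False
  then have "(\<lambda>x. exp_coeff x i j) = (\<lambda>x. if j = i then 1 else 0)"
    by (auto simp: exp_coeff_def)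
  with False show ?thesis by (auto simp: exp_coeff_def)
qed

text \<open>Conjugating \<open>J\<close>, the shift and the raising matrix (an \<open>sl\<^sub>2\<close> triple) by the exponential with entries
  \<open>exp_coeff x\<close> gives polynomials in \<open>x\<close>; this is the combination occurring in \<open>\<Psi>\<close>, in which
  the quadratic terms cancel.\<close>

lemma exp_coeff_sl2:
  fixes x v c d :: real and n :: nat
  shows "(x * (d * (real i - real n) - c) + (d * (real i + 1) + c) * (real i + 2 + v)) * exp_coeff x i j
    + (if 0 < i then x * d * (real i + 2 + v) * exp_coeff x (i-1) j else 0)
    - d * (real i + 1) * (real n - real i - 1) * exp_coeff x (Suc i) j
    = exp_coeff x i j * ((real j + 2 + v - x) * (d * (real j + 1) + c))
    - exp_coeff x i (Suc j) * (x * (d * (real j + 1) + c))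
    - (if 0 < j then exp_coeff x i (j-1) * (d * real j * (real n - real j)) else 0)"
proof -
  let ?e = "exp_coeff x i j" and ?I = "real i" and ?J = "real j"
  have 1: "(if 0 < i then x * d * (?I + 2 + v) * exp_coeff x (i-1) j else 0) = - d * (?I + 2 + v) * ((?I - ?J) * ?e)"
    unfolding exp_coeff_diff_row by simp
  have 2: "exp_coeff x i (Suc j) * (x * (d * (?J + 1) + c)) = - (?I - ?J) * ?e * (d * (?J + 1) + c)"
  proof -
    have "x * exp_coeff x i (Suc j) = - ((?I - ?J) * ?e)"
      using exp_coeff_diff_col[of i j x] by simp
    then have "x * exp_coeff x i (Suc j) * (d * (?J + 1) + c) = - ((?I - ?J) * ?e) * (d * (?J + 1) + c)"
      by simp
    then show ?thesis by (simp add: algebra_simps)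
  qed
  show ?thesis
  proof (cases "0 < j")
    case False
    then have j: "j = 0" by simp
    have 3: "(?I + 1) * exp_coeff x (Suc i) j = - x * ?e"
      using exp_coeff_diff_row[of "Suc i" 0 x] by (simp add: j add.commute)
    have "d * (?I + 1) * (real n - ?I - 1) * exp_coeff x (Suc i) j = d * (real n - ?I - 1) * (- x * ?e)"
      unfolding 3[symmetric] by simp
    then show ?thesis
      unfolding 1 2 by (simp add: j algebra_simps)
  next
    case True
    then obtain k where k: "j = Suc k" using gr0_conv_Suc by blast
    \<comment> \<open>E is constant along diagonals, so the two raising terms involve the same
      entry.\<close>
    have 3: "exp_coeff x (Suc i) j = exp_coeff x i k"
      by (simp add: exp_coeff_def k)
    have 4: "(?I - real k) * exp_coeff x i k = - x * ?e"
      using exp_coeff_diff_col[of i k x] by (simp add: k)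
    \<comment> \<open>With f(t) = t (n - t), the difference f(i+1) - f(k+1) factors as (i - k)(n - 2
      - i - k). The factor i - k is what \<open>exp_coeff_diff_col\<close> absorbs, leaving a
      multiple of x times the entry at (i,j).\<close>
    have 5: "d * (?I + 1) * (real n - ?I - 1) * exp_coeff x (Suc i) j
        - exp_coeff x i (j - 1) * (d * ?J * (real n - ?J))
      = d * (real n - 2 - ?I - real k) * ((?I - real k) * exp_coeff x i k)"
      by (simp add: 3) (simp add: k algebra_simps)
    show ?thesis
      using 5 True unfolding 1 2 4 by (simp add: k algebra_simps)
  qed
qed

section \<open>The weight and its Pearson equation\<close>

lemma mat_diag_eq_tridiag: "mat_diag n f = tridiag n (\<lambda>_. 0) f (\<lambda>_. 0)"
  by (rule eq_matI) (auto simp: mat_diag_def)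

lemma eq_matI_carrier:
  assumes "A \<in> carrier_mat n m" "B \<in> carrier_mat n m"
    and "\<And>i j. i < n \<Longrightarrow> j < m \<Longrightarrow> A $$ (i,j) = B $$ (i,j)"
  shows "A = B"
  using assms by (intro eq_matI) auto

text \<open>Here \<open>c\<close> and \<open>d\<close> are the values at \<open>\<nu>\<close> of the coefficient functions, and \<open>delta_ratio\<close> is the
  condition on \<open>\<mu>\<close> in the form in which it makes the conjugated coefficients independent of \<open>\<mu>\<close>.\<close>

locale laguerre_weight =
  fixes N :: nat and \<mu> :: "nat \<Rightarrow> real" and \<alpha> \<nu> :: real
    and \<delta> :: "real \<Rightarrow> nat \<Rightarrow> real" and c d :: real
  assumes mu_nonzero: "\<And>k. k \<in> {1..N} \<Longrightarrow> \<mu> k \<noteq> 0"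
    and nu_pos: "0 < \<nu>"
    and delta_pos: "\<And>k. k \<in> {1..N} \<Longrightarrow> 0 < \<delta> \<nu> k"
    and delta_next: "\<And>k. k \<in> {1..N} \<Longrightarrow> \<delta> (\<nu> + 1) k = (d * real k + c) * \<delta> \<nu> k"
    and delta_ratio: "\<And>k. k \<in> {1..N-1} \<Longrightarrow>
      \<delta> (\<nu> + 1) k / (\<mu> k)\<^sup>2 = d * real k * (real N - real k) * (\<delta> \<nu> (k+1) / (\<mu> (k+1))\<^sup>2)"
begin

lemma mu_Suc_nonzero [simp]: "i < N \<Longrightarrow> \<mu> (Suc i) \<noteq> 0"
  using mu_nonzero by auto

definition mu_mat :: "complex mat" where
  "mu_mat = tridiag N (\<lambda>_. 0) (\<lambda>i. of_real (\<mu> (i+1))) (\<lambda>_. 0)"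

text \<open>\<open>basis_mat\<close> is \<open>L(0) diag(\<mu>)\<close> and \<open>V_mat x\<close> is \<open>L(x) diag(\<mu>)\<close>: the factor \<open>diag(\<mu>)\<close> turns \<open>A\<close> into minus
  the shift.\<close>

definition basis_mat :: "complex mat" where
  "basis_mat = Matrix.mat N N (\<lambda>(i,j).
     if j \<le> i then of_real (\<mu> (i+1) * ((\<alpha> + real (i+1)) gchoose (i - j))) else 0)"

definition exp_mat :: "real \<Rightarrow> complex mat" where
  "exp_mat x = Matrix.mat N N (\<lambda>(i,j). of_real (exp_coeff x i j))"

definition V_mat :: "real \<Rightarrow> complex mat" where
  "V_mat x = basis_mat * exp_mat x"

text \<open>A diagonal entry of diag(mu)^(-1) T diag(mu)^(-1); the division by mu^2 compensates for
  replacing L by L diag(mu) on both sides of the weight.\<close>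

definition diag_weight :: "real \<Rightarrow> nat \<Rightarrow> real \<Rightarrow> real" where
  "diag_weight \<nu>' i x = exp (- x) * x powr (\<nu>' + real (i+1)) * \<delta> \<nu>' (i+1) / (\<mu> (i+1))\<^sup>2"

definition weight_mat :: "real \<Rightarrow> real \<Rightarrow> complex mat" where
  "weight_mat \<nu>' x = tridiag N (\<lambda>_. 0) (\<lambda>i. of_real (diag_weight \<nu>' i x)) (\<lambda>_. 0)"

lemma carriers [simp]:
  "mu_mat \<in> carrier_mat N N" "basis_mat \<in> carrier_mat N N" "exp_mat x \<in> carrier_mat N N"
  "V_mat x \<in> carrier_mat N N" "weight_mat \<nu>' x \<in> carrier_mat N N" "L_mat N \<mu> \<alpha> x \<in> carrier_mat N N"
  by (auto simp: mu_mat_def basis_mat_def exp_mat_def V_mat_def weight_mat_def L_mat_def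
      intro!: mult_carrier_mat[of _ N N])

text \<open>In \<open>laguerre_explicit\<close> with a = \<open>\<alpha>\<close> + j + 1 and n = i -
  j, the upper index a + n is \<open>\<alpha>\<close> + i + 1 and depends on the row only. The
  Laguerre sum is then a row of binomials times the exponential series: the factorisation through
  L(0) is a comparison of coefficients.\<close>

lemma V_mat_index:
  assumes ij: "i < N" "j < N"
  shows "V_mat x $$ (i,j) =
    (if j \<le> i then of_real (\<mu> (i+1)) * poly (laguerre_poly (i - j) (\<alpha> + real (j+1))) (of_real x) else 0)"
proof -
  have "V_mat x $$ (i,j) = (\<Sum>k<N. basis_mat $$ (i,k) * exp_mat x $$ (k,j))"
    unfolding V_mat_def by (rule index_mult_mat_sum) (use ij in auto)
  also have "\<dots> = (\<Sum>k<N. if j \<le> k \<and> k \<le> i then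
      of_real (\<mu> (i+1) * ((\<alpha> + real (i+1)) gchoose (i - k)) * ((- x) ^ (k - j) / fact (k - j))) else 0)"
    using ij by (intro sum.cong) (auto simp: basis_mat_def exp_mat_def exp_coeff_def)
  also have "\<dots> = (\<Sum>k\<in>{j..i}.
      of_real (\<mu> (i+1) * ((\<alpha> + real (i+1)) gchoose (i - k)) * ((- x) ^ (k - j) / fact (k - j))))"
    using ij by (intro sum.mono_neutral_cong_right) auto
  finally have eq: "V_mat x $$ (i,j) = (\<Sum>k\<in>{j..i}.
      of_real (\<mu> (i+1) * ((\<alpha> + real (i+1)) gchoose (i - k)) * ((- x) ^ (k - j) / fact (k - j))))" .
  show ?thesis
  proof (cases "j \<le> i")
    case True
    have "{j..i} = (\<lambda>l. l + j) ` {..i - j}"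
      using True by (auto simp: image_iff) (metis add.commute atMost_iff diff_le_mono le_add_diff_inverse)
    then have "V_mat x $$ (i,j) = (\<Sum>l\<le>i - j.
      of_real (\<mu> (i+1) * ((\<alpha> + real (i+1)) gchoose (i - (l + j))) * ((- x) ^ l / fact l)))"
      unfolding eq by (simp add: sum.reindex)
    also have "\<dots> = of_real (\<mu> (i+1)) * of_real (laguerre (i - j) (\<alpha> + real (j+1)) x)"
      unfolding laguerre_explicit of_real_mult[symmetric] of_real_sum[symmetric] sum_distrib_left
      using True by (intro arg_cong[where f=of_real] sum.cong refl)
        (auto simp: of_nat_diff power_minus[of x] algebra_simps)
    finally show ?thesis using True by (simp add: poly_laguerre_poly)
  qed (simp add: eq)
qed

lemma L_mat_mult_mu: "L_mat N \<mu> \<alpha> x * mu_mat = V_mat x"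
proof (rule eq_matI_carrier[of _ N N])
  fix i j assume ij: "i < N" "j < N"
  show "(L_mat N \<mu> \<alpha> x * mu_mat) $$ (i,j) = V_mat x $$ (i,j)"
    unfolding mu_mat_def V_mat_index[OF ij] mult_tridiag_index[OF carriers(6) ij] poly_laguerre_poly
    using ij by (auto simp: L_mat_def)
qed (auto intro!: mult_carrier_mat[of _ N N])

lemma mat_adjoint_mu: "mat_adjoint mu_mat = mu_mat"
  by (rule eq_matI) (auto simp: mu_mat_def mat_adjoint_def mat_of_rows_def)

lemma T_mat_eq: "T_mat N \<delta> \<nu>' x = mu_mat * weight_mat \<nu>' x * mu_mat"
proof (rule eq_matI)
  fix i j assume "i < dim_row (mu_mat * weight_mat \<nu>' x * mu_mat)" "j < dim_col (mu_mat * weight_mat \<nu>' x * mu_mat)"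
  then have ij: "i < N" "j < N" by (auto simp: mu_mat_def)
  have 1: "mu_mat * weight_mat \<nu>' x \<in> carrier_mat N N" by (rule mult_carrier_mat[of _ _ N]) auto
  have 2: "(mu_mat * weight_mat \<nu>' x * mu_mat) $$ (i,j) = (mu_mat * weight_mat \<nu>' x) $$ (i,j) * of_real (\<mu> (j+1))"
    by (subst (2) mu_mat_def, subst mult_tridiag_index[OF 1 ij]) simp
  have 3: "(mu_mat * weight_mat \<nu>' x) $$ (i,j) = mu_mat $$ (i,j) * of_real (diag_weight \<nu>' j x)"
    unfolding weight_mat_def by (subst mult_tridiag_index[OF carriers(1) ij]) simp
  show "T_mat N \<delta> \<nu>' x $$ (i,j) = (mu_mat * weight_mat \<nu>' x * mu_mat) $$ (i,j)"
    unfolding 2 3 using ij mu_Suc_nonzero[OF ij(2)] unfolding T_mat_def mat_diag_eq_tridiag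
    by (auto simp: mu_mat_def diag_weight_def power2_eq_square simp flip: of_real_mult of_real_divide)
qed (auto simp: T_mat_def mat_diag_def mu_mat_def)

lemma W_mat_eq: "W_mat N \<mu> \<delta> \<alpha> \<nu>' x = V_mat x * weight_mat \<nu>' x * mat_adjoint (V_mat x)"
proof -
  have "mat_adjoint (V_mat x) = mu_mat * mat_adjoint (L_mat N \<mu> \<alpha> x)"
    unfolding L_mat_mult_mu[symmetric] by (simp add: mat_adjoint_mult[of _ N] mat_adjoint_mu)
  then show ?thesis
    unfolding W_mat_def T_mat_eq L_mat_mult_mu[symmetric]
    by (simp add: assoc_mult_mat[of _ N N _ N _ N] mult_carrier_mat[of _ N N _ N])
qed
end

lemma has_mat_deriv_const:
  "C \<in> carrier_mat n n \<Longrightarrow> has_mat_deriv n (\<lambda>_. C) (0\<^sub>m n n) x"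
  by (simp add: has_mat_deriv_def)

lemma det_mat_adjoint_nonzero:
  fixes A :: "complex mat"
  assumes "A \<in> carrier_mat n n" "det A \<noteq> 0"
  shows "det (mat_adjoint A) \<noteq> 0"
proof -
  have "mat_adjoint (1\<^sub>m n :: complex mat) = 1\<^sub>m n"
    by (rule eq_matI_carrier[of _ n n]) auto
  then have "mat_adjoint (minv A) * mat_adjoint A = 1\<^sub>m n"
    using mat_adjoint_mult[OF assms(1) minv_nonsingular(1)[OF assms]] minv_nonsingular(2)[OF assms] by simp
  then have "det (mat_adjoint (minv A)) * det (mat_adjoint A) = 1"
    using det_mult[of "mat_adjoint (minv A)" n "mat_adjoint A"] assms minv_nonsingular(1)[OF assms] by simp
  then show ?thesis by auto
qed

context laguerre_weight begin

lemma diag_weight_next: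
  assumes "x > 0" "j < N"
  shows "diag_weight (\<nu> + 1) j x = x * (d * (real j + 1) + c) * diag_weight \<nu> j x"
proof -
  have "x powr (1 + (\<nu> + real (j + 1))) = x * x powr (\<nu> + real (j + 1))"
    unfolding powr_add[of x 1] using assms by simp
  then show ?thesis
    using delta_next[of "j + 1"] assms unfolding diag_weight_def by (simp add: algebra_simps)
qed

text \<open>The condition on mu enters here. The exponents \<open>\<nu>\<close> + 1 + j and
  \<open>\<nu>\<close> + (j + 1) coincide, so the ratio is free of x and becomes the raising
  coefficient.\<close>

lemma diag_weight_prev:
  assumes "x > 0" "0 < j" "j < N"
  shows "diag_weight (\<nu> + 1) (j - 1) x = d * real j * (real N - real j) * diag_weight \<nu> j x"
proof -
  have j: "j \<in> {1..N-1}" "j - 1 + 1 = j" using assms by auto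
  have "x powr (\<nu> + 1 + real j) = x powr (\<nu> + real (j + 1))"
    by (simp add: algebra_simps)
  moreover have "diag_weight (\<nu> + 1) (j - 1) x = exp (- x) * x powr (\<nu> + 1 + real j) * (\<delta> (\<nu> + 1) j / (\<mu> j)\<^sup>2)"
    unfolding diag_weight_def j(2) by simp
  ultimately show ?thesis
    unfolding delta_ratio[OF j(1)] by (simp add: diag_weight_def)
qed

lemma diag_weight_pos: "x > 0 \<Longrightarrow> j < N \<Longrightarrow> diag_weight \<nu> j x > 0"
  using delta_pos[of "j + 1"] by (simp add: diag_weight_def)

lemma diag_weight_next_deriv:
  assumes "x > 0" "j < N"
  shows "(diag_weight (\<nu> + 1) j has_real_derivative
    (d * (real j + 1) + c) * (real j + 2 + \<nu> - x) * diag_weight \<nu> j x) (at x)"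
proof -
  let ?b = "\<nu> + 1 + real (j + 1)" and ?K = "\<delta> (\<nu> + 1) (j+1) / (\<mu> (j+1))\<^sup>2"
  have b: "?b - 1 = \<nu> + real (j + 1)" "real j + 2 + \<nu> = ?b" by simp_all
  have deriv: "(diag_weight (\<nu> + 1) j has_real_derivative
    (exp (- x) * (?b * x powr (?b - 1)) - exp (- x) * x powr ?b) * ?K) (at x)"
    using DERIV_cmult_right[OF has_real_derivative_exp_powr[OF assms(1), of ?b], of ?K]
    by (simp add: diag_weight_def[abs_def])
  have "x powr (1 + (?b - 1)) = x * x powr (?b - 1)"
    unfolding powr_add[of x 1] using assms by simp
  then have "(exp (- x) * (?b * x powr (?b - 1)) - exp (- x) * x powr ?b) * ?K
      = (?b - x) * (exp (- x) * x powr (?b - 1) * ?K)"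
    by (simp add: left_diff_distrib right_diff_distrib)
  moreover have "exp (- x) * x powr (?b - 1) * ?K = (d * (real j + 1) + c) * diag_weight \<nu> j x"
    unfolding b using delta_next[of "j + 1"] assms unfolding diag_weight_def by simp
  ultimately have "(exp (- x) * (?b * x powr (?b - 1)) - exp (- x) * x powr ?b) * ?K
      = (?b - x) * ((d * (real j + 1) + c) * diag_weight \<nu> j x)"
    by (simp only:)
  also have "\<dots> = (d * (real j + 1) + c) * (real j + 2 + \<nu> - x) * diag_weight \<nu> j x"
    unfolding b(2) by (simp only: mult.assoc mult.left_commute)
  finally show ?thesis
    using deriv by (simp only:)
qed

definition shift_mat :: "complex mat" where
  "shift_mat = tridiag N (\<lambda>_. - 1) (\<lambda>_. 0) (\<lambda>_. 0)"

definition weight_deriv :: "real \<Rightarrow> complex mat" where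
  "weight_deriv x = tridiag N (\<lambda>_. 0)
     (\<lambda>j. of_real ((d * (real j + 1) + c) * (real j + 2 + \<nu> - x) * diag_weight \<nu> j x)) (\<lambda>_. 0)"

text \<open>The middle factor when the derivative of the weight with parameter \<open>\<nu>\<close>
  + 1 is written as V times a matrix times the adjoint of V.\<close>

definition pearson_mat :: "real \<Rightarrow> complex mat" where
  "pearson_mat x = tridiag N (\<lambda>j. of_real (- diag_weight (\<nu> + 1) j x))
     (\<lambda>j. of_real ((d * (real j + 1) + c) * (real j + 2 + \<nu> - x) * diag_weight \<nu> j x))
     (\<lambda>j. of_real (- d * real j * (real N - real j) * diag_weight \<nu> j x))"

text \<open>With E the exponential, E J E^(-1) = J + x S, so conjugating x (d J + c) gives this
  matrix; it is the conjugate by \<open>basis_mat\<close> of the adjoint of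
  \<open>Phi\<close>.\<close>

definition F2_mat :: "real \<Rightarrow> complex mat" where
  "F2_mat x = tridiag N (\<lambda>j. of_real (d * x * x)) (\<lambda>j. of_real (x * (d * (real j + 1) + c))) (\<lambda>_. 0)"

text \<open>The analogue for \<open>Psi\<close>: E M E^(-1) with M the quotient of
  \<open>pearson_mat\<close> by the diagonal weight at \<open>\<nu>\<close>. Its entries have degree
  at most one in x.\<close>

definition F1_mat :: "real \<Rightarrow> complex mat" where
  "F1_mat x = tridiag N (\<lambda>j. of_real (x * d * (real j + 3 + \<nu>)))
     (\<lambda>j. of_real (x * (d * (real j - real N) - c) + (d * (real j + 1) + c) * (real j + 2 + \<nu>)))
     (\<lambda>j. of_real (- d * real j * (real N - real j)))"

lemma carriers' [simp]:
  "shift_mat \<in> carrier_mat N N" "weight_deriv x \<in> carrier_mat N N" "pearson_mat x \<in> carrier_mat N N"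
  "F2_mat x \<in> carrier_mat N N" "F1_mat x \<in> carrier_mat N N"
  by (auto simp: shift_mat_def weight_deriv_def pearson_mat_def F2_mat_def F1_mat_def)

lemma has_mat_deriv_exp_mat: "has_mat_deriv N exp_mat (exp_mat x * shift_mat) x"
  unfolding has_mat_deriv_def
proof (intro conjI allI impI)
  fix i j assume ij: "i < N" "j < N"
  have "(exp_mat x * shift_mat) $$ (i,j) = of_real (- exp_coeff x i (Suc j))"
    unfolding shift_mat_def mult_tridiag_index[OF carriers(3) ij] using ij
    by (auto simp: exp_mat_def exp_coeff_def)
  moreover have "(\<lambda>t. exp_mat t $$ (i,j)) = (\<lambda>t. of_real (exp_coeff t i j))"
    using ij by (simp add: exp_mat_def)
  ultimately show "((\<lambda>t. exp_mat t $$ (i,j)) has_vector_derivative (exp_mat x * shift_mat) $$ (i,j)) (at x)"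
    by (simp only:) (rule has_vector_derivative_of_real[OF exp_coeff_deriv])
qed (auto intro!: mult_carrier_mat[of _ N N])

lemma has_mat_deriv_V: "has_mat_deriv N V_mat (V_mat x * shift_mat) x"
proof -
  have "has_mat_deriv N V_mat (0\<^sub>m N N * exp_mat x + basis_mat * (exp_mat x * shift_mat)) x"
    unfolding V_mat_def[abs_def]
    by (rule has_mat_deriv_mult[OF has_mat_deriv_const has_mat_deriv_exp_mat]) simp
  moreover have "0\<^sub>m N N * exp_mat x + basis_mat * (exp_mat x * shift_mat) = V_mat x * shift_mat"
    unfolding V_mat_def by (simp add: assoc_mult_mat[of _ N N _ N _ N] mult_carrier_mat[of _ N N _ N]
        left_mult_zero_mat[of _ N N] left_add_zero_mat[of _ N N])
  ultimately show ?thesis by simp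
qed

lemma has_mat_deriv_weight:
  assumes "x > 0"
  shows "has_mat_deriv N (weight_mat (\<nu> + 1)) (weight_deriv x) x"
  unfolding has_mat_deriv_def
proof (intro conjI allI impI)
  fix i j assume ij: "i < N" "j < N"
  show "((\<lambda>t. weight_mat (\<nu> + 1) t $$ (i,j)) has_vector_derivative weight_deriv x $$ (i,j)) (at x)"
    using has_vector_derivative_of_real[OF diag_weight_next_deriv[OF assms ij(2)], where 'a=complex] ij
    by (auto simp: weight_mat_def weight_deriv_def)
qed auto

lemma pearson_mat_eq:
  assumes "x > 0"
  shows "pearson_mat x = shift_mat * weight_mat (\<nu> + 1) x + weight_deriv x
     + weight_mat (\<nu> + 1) x * mat_adjoint shift_mat"
proof (rule eq_matI_carrier[of _ N N])
  fix i j assume ij: "i < N" "j < N"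
  have 1: "(shift_mat * weight_mat (\<nu> + 1) x) $$ (i,j) = shift_mat $$ (i,j) * of_real (diag_weight (\<nu> + 1) j x)"
    unfolding weight_mat_def by (subst mult_tridiag_index[OF carriers'(1) ij]) simp
  have 2: "(weight_mat (\<nu> + 1) x * mat_adjoint shift_mat) $$ (i,j)
      = of_real (diag_weight (\<nu> + 1) i x) * cnj (shift_mat $$ (j,i))"
    unfolding weight_mat_def
    by (subst tridiag_mult_index[OF mat_adjoint_carrier[OF carriers'(1)] ij]) (use ij in \<open>simp add: mat_adjoint_index[of _ N]\<close>)
  show "pearson_mat x $$ (i,j) = (shift_mat * weight_mat (\<nu> + 1) x + weight_deriv x
     + weight_mat (\<nu> + 1) x * mat_adjoint shift_mat) $$ (i,j)"
  proof -
    have "(shift_mat * weight_mat (\<nu> + 1) x + weight_deriv x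
       + weight_mat (\<nu> + 1) x * mat_adjoint shift_mat) $$ (i,j) =
       (shift_mat * weight_mat (\<nu> + 1) x) $$ (i,j) + weight_deriv x $$ (i,j) + (weight_mat (\<nu> + 1) x * mat_adjoint shift_mat) $$ (i,j)"
      using ij by (simp add: weight_deriv_def shift_mat_def weight_mat_def)
    also have "\<dots> = pearson_mat x $$ (i,j)"
      \<comment> \<open>The superdiagonal comes from the adjoint of the shift and carries the weight
        at \<open>\<nu>\<close> + 1 and index j - 1; it is rewritten at \<open>\<nu>\<close> and
        index j, so that column j acquires a common factor.\<close>
      unfolding 1 2 using ij diag_weight_prev[OF assms, of j]
      by (auto simp: pearson_mat_def weight_deriv_def shift_mat_def)
    finally show ?thesis ..
  qed
qed (auto intro!: mult_carrier_mat[of _ N N] add_carrier_mat)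

lemma has_mat_deriv_W_next:
  assumes "x > 0"
  shows "has_mat_deriv N (W_mat N \<mu> \<delta> \<alpha> (\<nu> + 1)) (V_mat x * pearson_mat x * mat_adjoint (V_mat x)) x"
proof -
  let ?V = "V_mat x" and ?T = "weight_mat (\<nu> + 1) x" and ?A = shift_mat and ?D = "weight_deriv x"
  let ?Vs = "mat_adjoint ?V" and ?As = "mat_adjoint ?A"
  note mc = mult_carrier_mat[of _ N N _ N]
  have "has_mat_deriv N (W_mat N \<mu> \<delta> \<alpha> (\<nu> + 1))
      ((?V * ?A * ?T + ?V * ?D) * ?Vs + ?V * ?T * mat_adjoint (?V * ?A)) x"
    unfolding W_mat_eq[abs_def]
    by (rule has_mat_deriv_mult[OF has_mat_deriv_mult[OF has_mat_deriv_V has_mat_deriv_weight[OF assms]]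
          has_mat_deriv_adjoint[OF has_mat_deriv_V]])
  moreover have "(?V * ?A * ?T + ?V * ?D) * ?Vs + ?V * ?T * mat_adjoint (?V * ?A)
      = ?V * pearson_mat x * ?Vs"
    unfolding pearson_mat_eq[OF assms] mat_adjoint_mult[OF carriers(4) carriers'(1)]
    by (simp add: assoc_mult_mat[of _ N N _ N _ N] mc add_mult_distrib_mat[of _ N N _ _ N]
        mult_add_distrib_mat[of _ N N _ N])
  ultimately show ?thesis by simp
qed

text \<open>Diagonal right factors scale columns, so the scalar weight of column j cancels and the
  relation J E - E J = -x S E remains.\<close>

lemma F2_exp_weight:
  assumes "x > 0"
  shows "F2_mat x * exp_mat x * weight_mat \<nu> x = exp_mat x * weight_mat (\<nu> + 1) x"
proof (rule eq_matI_carrier[of _ N N])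
  fix i j assume ij: "i < N" "j < N"
  have c: "F2_mat x * exp_mat x \<in> carrier_mat N N" by (rule mult_carrier_mat[of _ _ N]) auto
  have 1: "(F2_mat x * exp_mat x * weight_mat \<nu> x) $$ (i,j) = (F2_mat x * exp_mat x) $$ (i,j) * of_real (diag_weight \<nu> j x)"
    unfolding weight_mat_def by (subst mult_tridiag_index[OF c ij]) simp
  have 2: "(F2_mat x * exp_mat x) $$ (i,j) = of_real (x * (d * (real i + 1) + c) * exp_coeff x i j +
      (if 0 < i then d * x * x * exp_coeff x (i-1) j else 0))"
    unfolding F2_mat_def by (subst tridiag_mult_index[OF carriers(3) ij]) (use ij in \<open>auto simp: exp_mat_def\<close>)
  have 3: "(exp_mat x * weight_mat (\<nu> + 1) x) $$ (i,j) = of_real (exp_coeff x i j * (x * (d * (real j + 1) + c) * diag_weight \<nu> j x))"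
    unfolding weight_mat_def by (subst mult_tridiag_index[OF carriers(3) ij])
      (use ij diag_weight_next[OF assms ij(2)] in \<open>auto simp: exp_mat_def\<close>)
  have 4: "x * (d * (real i + 1) + c) * exp_coeff x i j + (if 0 < i then d * x * x * exp_coeff x (i-1) j else 0)
      = exp_coeff x i j * (x * (d * (real j + 1) + c))"
  proof -
    have "(if 0 < i then d * x * x * exp_coeff x (i-1) j else 0) = - d * x * ((real i - real j) * exp_coeff x i j)"
      unfolding exp_coeff_diff_row by simp
    then show ?thesis by (simp only:) (simp add: algebra_simps)
  qed
  show "(F2_mat x * exp_mat x * weight_mat \<nu> x) $$ (i,j) = (exp_mat x * weight_mat (\<nu> + 1) x) $$ (i,j)"
    unfolding 1 2 3 4 by simp
qed (auto intro!: mult_carrier_mat[of _ N N])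

text \<open>Once the common weight of column j is taken out, the entries are those of
  \<open>exp_coeff_sl2\<close>; the work lies in the two edges of the matrix.\<close>

lemma F1_exp_weight:
  assumes "x > 0"
  shows "F1_mat x * exp_mat x * weight_mat \<nu> x = exp_mat x * pearson_mat x"
proof (rule eq_matI_carrier[of _ N N])
  fix i j assume ij: "i < N" "j < N"
  let ?g = "exp_coeff x" and ?t = "diag_weight \<nu> j x"
  have c: "F1_mat x * exp_mat x \<in> carrier_mat N N" by (rule mult_carrier_mat[of _ _ N]) auto
  have 1: "(F1_mat x * exp_mat x * weight_mat \<nu> x) $$ (i,j) = (F1_mat x * exp_mat x) $$ (i,j) * of_real ?t"
    unfolding weight_mat_def by (subst mult_tridiag_index[OF c ij]) simp
  have 2: "(F1_mat x * exp_mat x) $$ (i,j) = of_real (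
      (x * (d * (real i - real N) - c) + (d * (real i + 1) + c) * (real i + 2 + \<nu>)) * ?g i j
    + (if 0 < i then x * d * (real i + 2 + \<nu>) * ?g (i-1) j else 0)
    - d * (real i + 1) * (real N - real i - 1) * ?g (Suc i) j)"
  proof -
    have u: "(if i + 1 < N then of_real (- d * real (i+1) * (real N - real (i+1))) * exp_mat x $$ (i+1,j) else 0)
        = complex_of_real (- (d * (real i + 1) * (real N - real i - 1) * ?g (Suc i) j))"
    proof (cases "i + 1 < N")
      case True
      then show ?thesis using ij by (simp add: exp_mat_def diff_diff_eq add.commute)
    next
      case False
      \<comment> \<open>In the last row the raising coefficient contains N - i - 1 = 0, which
        accounts for the missing neighbour.\<close>
      then have "real N = real i + 1" using ij by linarith
      then show ?thesis using False by simp
    qed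
    have l: "(if 0 < i then of_real (x * d * (real (i-1) + 3 + \<nu>)) * exp_mat x $$ (i-1,j) else 0)
        = complex_of_real (if 0 < i then x * d * (real i + 2 + \<nu>) * ?g (i-1) j else 0)"
      using ij by (cases i) (simp_all add: exp_mat_def add.commute)
    show ?thesis
      unfolding F1_mat_def tridiag_mult_index[OF carriers(3) ij] u l
      using ij by (simp add: exp_mat_def)
  qed
  have 3: "(exp_mat x * pearson_mat x) $$ (i,j) = of_real ((?g i j * ((real j + 2 + \<nu> - x) * (d * (real j + 1) + c))
    - ?g i (Suc j) * (x * (d * (real j + 1) + c))
    - (if 0 < j then ?g i (j-1) * (d * real j * (real N - real j)) else 0)) * ?t)"
  proof -
    \<comment> \<open>In the last column the missing term is zero because
      \<open>exp_coeff x i N\<close> vanishes for i < N.\<close>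
    have l: "(if j + 1 < N then exp_mat x $$ (i,j+1) * of_real (- diag_weight (\<nu> + 1) j x) else 0)
        = complex_of_real (- (?g i (Suc j) * (x * (d * (real j + 1) + c)) * ?t))"
      using ij by (auto simp: exp_mat_def exp_coeff_def diag_weight_next[OF assms ij(2)])
    have u: "(if 0 < j then exp_mat x $$ (i,j-1) * of_real (- d * real j * (real N - real j) * ?t) else 0)
        = complex_of_real (- (if 0 < j then ?g i (j-1) * (d * real j * (real N - real j)) else 0) * ?t)"
      using ij by (auto simp: exp_mat_def)
    show ?thesis
      unfolding pearson_mat_def mult_tridiag_index[OF carriers(3) ij] u l
      using ij by (simp add: exp_mat_def algebra_simps)
  qed
  show "(F1_mat x * exp_mat x * weight_mat \<nu> x) $$ (i,j) = (exp_mat x * pearson_mat x) $$ (i,j)"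
    unfolding 1 2 3 exp_coeff_sl2 by simp
qed (auto intro!: mult_carrier_mat[of _ N N])


section \<open>Nonsingularity and the coefficients Phi and Psi\<close>

lemma det_basis: "det basis_mat \<noteq> 0"
  by (subst det_lower_triangular_prod[of _ N]) (auto simp: basis_mat_def)

lemma det_exp_mat: "det (exp_mat x) \<noteq> 0"
  by (subst det_lower_triangular_prod[of _ N]) (auto simp: exp_mat_def exp_coeff_def)

lemma det_V: "det (V_mat x) \<noteq> 0"
  unfolding V_mat_def using det_basis det_exp_mat by (simp add: det_mult[of _ N])

lemma det_weight: "x > 0 \<Longrightarrow> det (weight_mat \<nu> x) \<noteq> 0"
  by (subst det_lower_triangular_prod[of _ N]) (auto simp: weight_mat_def less_imp_neq[OF diag_weight_pos, THEN not_sym])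

lemma W_carrier [simp]: "W_mat N \<mu> \<delta> \<alpha> \<nu>' x \<in> carrier_mat N N"
  unfolding W_mat_eq by (auto intro!: mult_carrier_mat[of _ N N])

lemma det_W: "x > 0 \<Longrightarrow> det (W_mat N \<mu> \<delta> \<alpha> \<nu> x) \<noteq> 0"
  unfolding W_mat_eq using det_V det_weight det_mat_adjoint_nonzero[OF carriers(4) det_V]
  by (simp add: det_mult[of _ N] mult_carrier_mat[of _ N N _ N])

lemma W_hermitian: "mat_adjoint (W_mat N \<mu> \<delta> \<alpha> \<nu>' x) = W_mat N \<mu> \<delta> \<alpha> \<nu>' x"
proof -
  have "mat_adjoint (weight_mat \<nu>' x) = weight_mat \<nu>' x"
    by (rule eq_matI_carrier[of _ N N]) (auto simp: mat_adjoint_index[of _ N], auto simp: weight_mat_def)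
  then show ?thesis
    unfolding W_mat_eq by (simp add: mat_adjoint_mult[of _ N] mult_carrier_mat[of _ N N _ N] assoc_mult_mat[of _ N N _ N _ N]
        mat_adjoint_adjoint[of _ N])
qed


abbreviation "W \<equiv> W_mat N \<mu> \<delta> \<alpha> \<nu>"
abbreviation "W_next \<equiv> W_mat N \<mu> \<delta> \<alpha> (\<nu> + 1)"
abbreviation "Phi \<equiv> Phi_mat N \<mu> \<delta> \<alpha> \<nu>"
abbreviation "Psi \<equiv> Psi_mat N \<mu> \<delta> \<alpha> \<nu>"

lemma mat_deriv_W_next:
  assumes "x > 0"
  shows "mat_deriv W_next x = V_mat x * pearson_mat x * mat_adjoint (V_mat x)"
  by (rule has_mat_deriv_imp_mat_deriv[OF has_mat_deriv_W_next[OF assms]])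

lemma has_mat_deriv_W_next': "x > 0 \<Longrightarrow> has_mat_deriv N W_next (mat_deriv W_next x) x"
  by (simp only: has_mat_deriv_W_next mat_deriv_W_next)

lemma mat_deriv_W_next_hermitian:
  assumes "x > 0"
  shows "mat_adjoint (mat_deriv W_next x) = mat_deriv W_next x"
  using has_mat_deriv_imp_mat_deriv[OF has_mat_deriv_adjoint[OF has_mat_deriv_W_next'[OF assms]], symmetric]
  unfolding W_hermitian .

lemma mat_deriv_W_next_carrier [simp]: "x > 0 \<Longrightarrow> mat_deriv W_next x \<in> carrier_mat N N"
  using has_mat_deriv_W_next' by (simp add: has_mat_deriv_def)

lemma Phi_Psi_carrier [simp]:
  assumes "x > 0"
  shows "Phi x \<in> carrier_mat N N" "Psi x \<in> carrier_mat N N"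
  unfolding Phi_mat_def Psi_mat_def
  by (rule mult_carrier_mat[OF minv_nonsingular(1)[OF W_carrier det_W[OF assms]]], simp add: assms)+

text \<open>The adjoint of W Phi = W_next. Both weights are Hermitian, which moves the coefficient
  to the left of W, the side needed for operators acting from the right.\<close>

lemma Phi_adjoint_W:
  assumes "x > 0"
  shows "mat_adjoint (Phi x) * W x = W_next x"
proof -
  have "W x * Phi x = W_next x"
    unfolding Phi_mat_def by (rule mult_minv_cancel[OF W_carrier det_W[OF assms] W_carrier])
  then have "mat_adjoint (W x * Phi x) = mat_adjoint (W_next x)" by simp
  then show ?thesis using assms by (simp add: mat_adjoint_mult[of _ N] W_hermitian)
qed

lemma Psi_adjoint_W:
  assumes "x > 0"
  shows "mat_adjoint (Psi x) * W x = mat_deriv W_next x"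
proof -
  have "W x * Psi x = mat_deriv W_next x"
    unfolding Psi_mat_def by (rule mult_minv_cancel[OF W_carrier det_W[OF assms] mat_deriv_W_next_carrier[OF assms]])
  then have "mat_adjoint (W x * Psi x) = mat_adjoint (mat_deriv W_next x)" by simp
  then show ?thesis using assms by (simp add: mat_adjoint_mult[of _ N] W_hermitian mat_deriv_W_next_hermitian)
qed


text \<open>Since W = \<open>basis_mat\<close> E T V^*, with T the diagonal weight, both sides
  multiplied by the invertible E T V^* equal X W; cancelling that factor identifies X without
  computing an inverse.\<close>

lemma adjoint_basis_cancel:
  assumes x: "x > 0" and X: "X \<in> carrier_mat N N" and F: "F \<in> carrier_mat N N" and Z: "Z \<in> carrier_mat N N"
    and XW: "X * W x = V_mat x * Z * mat_adjoint (V_mat x)"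
    and FZ: "F * exp_mat x * weight_mat \<nu> x = exp_mat x * Z"
  shows "X * basis_mat = basis_mat * F"
proof -
  note mc = mult_carrier_mat[of _ N N _ N]
  let ?R = "exp_mat x * weight_mat \<nu> x * mat_adjoint (V_mat x)"
  have "det ?R \<noteq> 0"
    using det_exp_mat det_weight[OF x] det_mat_adjoint_nonzero[OF carriers(4) det_V]
    by (simp add: det_mult[of _ N] mc)
  moreover have "(X * basis_mat) * ?R = (basis_mat * F) * ?R"
  proof -
    have "(X * basis_mat) * ?R = X * W x"
      unfolding W_mat_eq V_mat_def using X by (simp add: assoc_mult_mat[of _ N N _ N _ N] mc)
    moreover have "(basis_mat * F) * ?R = basis_mat * (F * exp_mat x * weight_mat \<nu> x) * mat_adjoint (V_mat x)"
      using F by (simp add: assoc_mult_mat[of _ N N _ N _ N] mc)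
    moreover have "\<dots> = X * W x"
      unfolding FZ XW V_mat_def using Z by (simp add: assoc_mult_mat[of _ N N _ N _ N] mc)
    ultimately show ?thesis by (simp only:)
  qed
  ultimately show ?thesis
    using X F by (intro mult_right_cancel_mat[of "X * basis_mat" N "basis_mat * F" ?R] mc) simp_all
qed

lemma Phi_adjoint_basis: "x > 0 \<Longrightarrow> mat_adjoint (Phi x) * basis_mat = basis_mat * F2_mat x"
  by (rule adjoint_basis_cancel[OF _ _ _ _ _ F2_exp_weight]) (simp_all add: Phi_adjoint_W[unfolded W_mat_eq[of "\<nu> + 1"]])

lemma Psi_adjoint_basis: "x > 0 \<Longrightarrow> mat_adjoint (Psi x) * basis_mat = basis_mat * F1_mat x"
  by (rule adjoint_basis_cancel[OF _ _ _ _ _ F1_exp_weight]) (simp_all add: Psi_adjoint_W mat_deriv_W_next)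

end

section \<open>Conjugation of the coefficients\<close>

lemma index_add_mat_carrier:
  "A \<in> carrier_mat n m \<Longrightarrow> B \<in> carrier_mat n m \<Longrightarrow> i < n \<Longrightarrow> j < m \<Longrightarrow>
    (A + B) $$ (i,j) = A $$ (i,j) + B $$ (i,j)"
  by simp

lemma J_mat_eq: "J_mat n = tridiag n (\<lambda>_. 0) (\<lambda>j. of_nat j + 1) (\<lambda>_. 0)"
  unfolding J_mat_def mat_diag_eq_tridiag by (simp add: add.commute)

lemma A_mat_eq: "A_mat n \<mu> = tridiag n (\<lambda>j. of_real (- \<mu> (j+2) / \<mu> (j+1))) (\<lambda>_. 0) (\<lambda>_. 0)"
  by (rule eq_matI) (auto simp: A_mat_def)

lemma one_mat_eq: "1\<^sub>m n = tridiag n (\<lambda>_. 0) (\<lambda>_. 1) (\<lambda>_. 0)"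
  by (rule eq_matI) auto

lemma tridiag_add:
  "tridiag n l a u + tridiag n l' a' u' = tridiag n (\<lambda>j. l j + l' j) (\<lambda>j. a j + a' j) (\<lambda>j. u j + u' j)"
  by (rule eq_matI) auto

lemma tridiag_minus:
  fixes a :: "nat \<Rightarrow> 'a::ring_1"
  shows "tridiag n l a u - tridiag n l' a' u' = tridiag n (\<lambda>j. l j - l' j) (\<lambda>j. a j - a' j) (\<lambda>j. u j - u' j)"
  by (rule eq_matI) auto

lemma tridiag_smult:
  fixes a :: "nat \<Rightarrow> 'a::ring_1"
  shows "s \<cdot>\<^sub>m tridiag n l a u = tridiag n (\<lambda>j. s * l j) (\<lambda>j. s * a j) (\<lambda>j. s * u j)"
  by (rule eq_matI) auto

lemma diag_mult_tridiag:
  fixes a :: "nat \<Rightarrow> 'a::ring_1"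
  shows "tridiag n (\<lambda>_. 0) b (\<lambda>_. 0) * tridiag n l a (\<lambda>_. 0)
    = tridiag n (\<lambda>j. b (j+1) * l j) (\<lambda>j. b j * a j) (\<lambda>_. 0)"
proof (rule eq_matI_carrier[of _ n n])
  fix i j assume ij: "i < n" "j < n"
  show "(tridiag n (\<lambda>_. 0) b (\<lambda>_. 0) * tridiag n l a (\<lambda>_. 0)) $$ (i,j)
      = tridiag n (\<lambda>j. b (j+1) * l j) (\<lambda>j. b j * a j) (\<lambda>_. 0) $$ (i,j)"
    unfolding tridiag_mult_index[OF tridiag_carrier ij] using ij by simp
qed (auto intro!: mult_carrier_mat[of _ n n])

context laguerre_weight begin

lemma basis_mat_index:
  "i < N \<Longrightarrow> j < N \<Longrightarrow> basis_mat $$ (i,j) =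
     (if j \<le> i then of_real (\<mu> (i+1) * ((\<alpha> + real (i+1)) gchoose (i - j))) else 0)"
  by (simp add: basis_mat_def)

lemma A_plus_one_eq: "A_mat N \<mu> + 1\<^sub>m N = tridiag N (\<lambda>j. of_real (- \<mu> (j+2) / \<mu> (j+1))) (\<lambda>_. 1) (\<lambda>_. 0)"
  unfolding A_mat_eq one_mat_eq tridiag_add by simp

text \<open>Pascal's rule used twice: adding the next column raises the upper index of the binomial
  by one, and subtracting the rescaled previous row lowers it again. Hence the inverse of A + 1
  becomes 1 + S.\<close>

lemma A_plus_one_basis:
  "(A_mat N \<mu> + 1\<^sub>m N) * (basis_mat * tridiag N (\<lambda>_. 1) (\<lambda>_. 1) (\<lambda>_. 0)) = basis_mat"
proof (rule eq_matI_carrier[of _ N N])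
  fix i j assume ij: "i < N" "j < N"
  let ?R = "tridiag N (\<lambda>_. 1) (\<lambda>_. 1) (\<lambda>_. 0) :: complex mat"
  have Y: "(basis_mat * ?R) $$ (i,j) =
     (if j \<le> i then of_real (\<mu> (i+1) * ((\<alpha> + real (i+2)) gchoose (i - j))) else 0)" if "i < N" for i
  proof (cases "j < i")
    case True
    then obtain k where k: "i = Suc (j + k)" by (metis less_imp_Suc_add)
    have "(\<alpha> + real (i+2)) gchoose (i - j) = ((\<alpha> + real (i+1)) gchoose k) + ((\<alpha> + real (i+1)) gchoose (Suc k))"
      using gbinomial_Suc_Suc[of "\<alpha> + real (i+1)" k] by (simp add: k add_ac Suc_diff_le)
    then show ?thesis
      unfolding mult_tridiag_index[OF carriers(2) that ij(2)]
      using True that by (simp add: basis_mat_index k Suc_diff_le algebra_simps)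
  next
    case False
    then show ?thesis
      unfolding mult_tridiag_index[OF carriers(2) that ij(2)]
      using that ij by (auto simp: basis_mat_index)
  qed
  have c: "basis_mat * ?R \<in> carrier_mat N N" by (rule mult_carrier_mat[of _ _ N]) auto
  show "((A_mat N \<mu> + 1\<^sub>m N) * (basis_mat * ?R)) $$ (i,j) = basis_mat $$ (i,j)"
  proof (cases "j < i")
    case True
    then obtain k where k: "i = Suc (j + k)" by (metis less_imp_Suc_add)
    have "(\<alpha> + real (i+2)) gchoose (Suc k) = ((\<alpha> + real (i+1)) gchoose k) + ((\<alpha> + real (i+1)) gchoose (Suc k))"
      using gbinomial_Suc_Suc[of "\<alpha> + real (i+1)" k] by (simp add: k add_ac)
    then have eq: "\<mu> (i+1) * ((\<alpha> + real (i+2)) gchoose Suc k) - \<mu> (i+1) * ((\<alpha> + real (i+1)) gchoose k)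
        = \<mu> (i+1) * ((\<alpha> + real (i+1)) gchoose (Suc k))"
      by (simp add: algebra_simps)
    have nz: "\<mu> i \<noteq> 0" using ij mu_Suc_nonzero[of "i - 1"] True by simp
    have Yi: "(basis_mat * ?R) $$ (i,j) = of_real (\<mu> (i+1) * ((\<alpha> + real (i+2)) gchoose Suc k))"
      using Y[OF ij(1)] by (simp add: k)
    have Yp: "(basis_mat * ?R) $$ (i-1,j) = of_real (\<mu> i * ((\<alpha> + real (i+1)) gchoose k))"
      using Y[of "i-1"] ij by (simp add: k add_ac)
    have Bi: "basis_mat $$ (i,j) = of_real (\<mu> (i+1) * ((\<alpha> + real (i+1)) gchoose (Suc k)))"
      using ij by (simp add: basis_mat_index k)
    have "i - 1 + 2 = i + 1" "i - 1 + 1 = i" using True by simp_all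
    then have "((A_mat N \<mu> + 1\<^sub>m N) * (basis_mat * ?R)) $$ (i,j)
        = of_real (\<mu> (i+1) * ((\<alpha> + real (i+2)) gchoose Suc k) - \<mu> (i+1) * ((\<alpha> + real (i+1)) gchoose k))"
      unfolding A_plus_one_eq tridiag_mult_index[OF c ij] Yi Yp
      using nz True by simp
    then show ?thesis unfolding Bi eq .
  next
    case False
    then show ?thesis
      unfolding A_plus_one_eq tridiag_mult_index[OF c ij]
      using ij by (auto simp: Y basis_mat_index)
  qed
qed (auto intro!: mult_carrier_mat[of _ N N] simp: A_plus_one_eq)

lemma minv_basis:
  "minv (A_mat N \<mu> + 1\<^sub>m N) \<in> carrier_mat N N"
  "minv (A_mat N \<mu> + 1\<^sub>m N) * basis_mat = basis_mat * tridiag N (\<lambda>_. 1) (\<lambda>_. 1) (\<lambda>_. 0)"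
proof -
  have c: "A_mat N \<mu> + 1\<^sub>m N \<in> carrier_mat N N" by (simp add: A_plus_one_eq)
  have det: "det (A_mat N \<mu> + 1\<^sub>m N) \<noteq> 0"
    by (subst det_lower_triangular_prod[OF c]) (auto simp: A_plus_one_eq)
  show "minv (A_mat N \<mu> + 1\<^sub>m N) \<in> carrier_mat N N" by (rule minv_nonsingular(1)[OF c det])
  let ?Y = "basis_mat * tridiag N (\<lambda>_. 1) (\<lambda>_. 1) (\<lambda>_. 0)"
  have cY: "?Y \<in> carrier_mat N N" by (rule mult_carrier_mat[of _ _ N]) auto
  have "minv (A_mat N \<mu> + 1\<^sub>m N) * ((A_mat N \<mu> + 1\<^sub>m N) * ?Y) = (minv (A_mat N \<mu> + 1\<^sub>m N) * (A_mat N \<mu> + 1\<^sub>m N)) * ?Y"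
    by (rule assoc_mult_mat[symmetric, OF minv_nonsingular(1)[OF c det] c cY])
  then show "minv (A_mat N \<mu> + 1\<^sub>m N) * basis_mat = ?Y"
    unfolding A_plus_one_basis minv_nonsingular(3)[OF c det] left_mult_one_mat[OF cY] .
qed

text \<open>From (k+1) (a choose k+1) = (a-k) (a choose k) with a = \<open>\<alpha>\<close> + i + 1
  and k = i - j - 1: here a - k = \<open>\<alpha>\<close> + j + 2 depends on the column
  only.\<close>

lemma J_basis:
  "J_mat N * basis_mat = basis_mat * tridiag N (\<lambda>j. of_real (\<alpha> + real j + 2)) (\<lambda>j. of_nat j + 1) (\<lambda>_. 0)"
proof (rule eq_matI_carrier[of _ N N])
  fix i j assume ij: "i < N" "j < N"
  let ?R = "tridiag N (\<lambda>j. of_real (\<alpha> + real j + 2)) (\<lambda>j. of_nat j + 1) (\<lambda>_. 0) :: complex mat"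
  show "(J_mat N * basis_mat) $$ (i,j) = (basis_mat * ?R) $$ (i,j)"
  proof (cases "j < i")
    case True
    then obtain k where k: "i = Suc (j + k)" by (metis less_imp_Suc_add)
    let ?a = "\<alpha> + real (i+1)"
    have "(real i - real j) * (?a gchoose Suc k) = (\<alpha> + real j + 2) * (?a gchoose k)"
      using gbinomial_mult_1[of ?a k] by (simp add: k algebra_simps)
    then have "\<mu> (i+1) * ((real i - real j) * (?a gchoose Suc k)) = \<mu> (i+1) * ((\<alpha> + real j + 2) * (?a gchoose k))"
      by (simp only:)
    then have "(real i + 1) * (\<mu> (i+1) * (?a gchoose Suc k)) = \<mu> (i+1) * (?a gchoose Suc k) * (real j + 1)
       + \<mu> (i+1) * (?a gchoose k) * (\<alpha> + real j + 2)"
      by (simp only: algebra_simps)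
    then have "complex_of_real ((real i + 1) * (\<mu> (i+1) * (?a gchoose Suc k))) = complex_of_real (\<mu> (i+1) * (?a gchoose Suc k) * (real j + 1)
       + \<mu> (i+1) * (?a gchoose k) * (\<alpha> + real j + 2))" by simp
    then show ?thesis
      unfolding J_mat_eq tridiag_mult_index[OF carriers(2) ij] mult_tridiag_index[OF carriers(2) ij]
      using ij True by (simp add: basis_mat_index k Suc_diff_le)
  next
    case False
    then show ?thesis
      unfolding J_mat_eq tridiag_mult_index[OF carriers(2) ij] mult_tridiag_index[OF carriers(2) ij]
      using ij by (auto simp: basis_mat_index)
  qed
qed (auto intro!: mult_carrier_mat[of _ N N] simp: J_mat_eq)

text \<open>The left factor is \<open>\<nu>\<close> + J + 1 + (\<open>\<alpha>\<close> + J) A, and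
  L(0) diag(mu) diagonalises it. The reason is absorption, (k+1) (a choose k+1) = a (a-1 choose k),
  with a = \<open>\<alpha>\<close> + i + 1.\<close>

lemma drift_basis:
  "tridiag N (\<lambda>j. of_real ((\<alpha> + real j + 2) * (- \<mu> (j+2) / \<mu> (j+1)))) (\<lambda>j. of_real (\<nu> + real j + 2)) (\<lambda>_. 0) * basis_mat
   = basis_mat * tridiag N (\<lambda>_. 0) (\<lambda>j. of_real (\<nu> + real j + 2)) (\<lambda>_. 0)"
proof (rule eq_matI_carrier[of _ N N])
  fix i j assume ij: "i < N" "j < N"
  let ?l = "tridiag N (\<lambda>j. of_real ((\<alpha> + real j + 2) * (- \<mu> (j+2) / \<mu> (j+1)))) (\<lambda>j. of_real (\<nu> + real j + 2)) (\<lambda>_. 0) * basis_mat"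
  let ?r = "basis_mat * tridiag N (\<lambda>_. 0) (\<lambda>j. of_real (\<nu> + real j + 2)) (\<lambda>_. 0)"
  show "?l $$ (i,j) = ?r $$ (i,j)"
  proof (cases "j < i")
    case True
    then obtain k where k: "i = Suc (j + k)" by (metis less_imp_Suc_add)
    let ?a = "\<alpha> + real (i+1)" and ?b = "\<alpha> + real i"
    have "(real i - real j) * (?a gchoose Suc k) = ?a * (?b gchoose k)"
      using gbinomial_absorption[of k ?a] by (simp add: k algebra_simps)
    then have "\<mu> (i+1) * ((real i - real j) * (?a gchoose Suc k)) = \<mu> (i+1) * (?a * (?b gchoose k))"
      by (simp only:)
    then have eq: "(\<nu> + real i + 2) * (\<mu> (i+1) * (?a gchoose Suc k)) - \<mu> (i+1) * (?a * (?b gchoose k))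
       = \<mu> (i+1) * (?a gchoose Suc k) * (\<nu> + real j + 2)"
      by (simp only: algebra_simps)
    have nz: "\<mu> i \<noteq> 0" using ij mu_Suc_nonzero[of "i - 1"] True by simp
    have Bp: "basis_mat $$ (i-1,j) = of_real (\<mu> i * (?b gchoose k))"
      using ij by (simp add: basis_mat_index k add_ac)
    have Bi: "basis_mat $$ (i,j) = of_real (\<mu> (i+1) * (?a gchoose (Suc k)))"
      using ij by (simp add: basis_mat_index k)
    have "real (i - 1) + 2 = real (i + 1)" "i - 1 + 2 = i + 1" "i - 1 + 1 = i" using True by simp_all
    then have "?l $$ (i,j) = of_real ((\<nu> + real i + 2) * (\<mu> (i+1) * (?a gchoose Suc k)) - \<mu> (i+1) * (?a * (?b gchoose k)))"
      unfolding tridiag_mult_index[OF carriers(2) ij] Bi Bp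
      using nz True by (simp add: add.assoc)
    also have "\<dots> = ?r $$ (i,j)"
      unfolding mult_tridiag_index[OF carriers(2) ij] Bi eq by simp
    finally show ?thesis .
  next
    case False
    then show ?thesis
      unfolding tridiag_mult_index[OF carriers(2) ij] mult_tridiag_index[OF carriers(2) ij]
      using ij by (auto simp: basis_mat_index)
  qed
qed (auto intro!: mult_carrier_mat[of _ N N])

definition "D1_mat x = - (of_real x \<cdot>\<^sub>m minv (A_mat N \<mu> + 1\<^sub>m N)) + scalar_mat N \<nu> + J_mat N + 1\<^sub>m N
        + (scalar_mat N \<alpha> + J_mat N) * A_mat N \<mu>"

definition "D0_mat = of_real (\<alpha> - \<nu>) \<cdot>\<^sub>m minv (A_mat N \<mu> + 1\<^sub>m N) - J_mat N"

lemma D1_basis: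
  "D1_mat x * basis_mat = basis_mat * tridiag N (\<lambda>_. - of_real x) (\<lambda>j. of_real (\<nu> + real j + 2 - x)) (\<lambda>_. 0)"
proof -
  let ?I = "minv (A_mat N \<mu> + 1\<^sub>m N)"
  let ?d = "tridiag N (\<lambda>j. of_real ((\<alpha> + real j + 2) * (- \<mu> (j+2) / \<mu> (j+1)))) (\<lambda>j. of_real (\<nu> + real j + 2)) (\<lambda>_. 0) :: complex mat"
  let ?e = "tridiag N (\<lambda>_. 0) (\<lambda>j. of_real (\<nu> + real j + 2)) (\<lambda>_. 0) :: complex mat"
  let ?R = "tridiag N (\<lambda>_. 1) (\<lambda>_. 1) (\<lambda>_. 0) :: complex mat"
  have "D1_mat x = (- of_real x) \<cdot>\<^sub>m ?I + (scalar_mat N \<nu> + J_mat N + 1\<^sub>m N + (scalar_mat N \<alpha> + J_mat N) * A_mat N \<mu>)"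
    unfolding D1_mat_def using minv_basis(1)
    by (intro eq_matI_carrier[of _ N N]) (auto simp: J_mat_eq A_mat_eq intro!: mult_carrier_mat[of _ N N] add_carrier_mat)
  also have "scalar_mat N \<nu> + J_mat N + 1\<^sub>m N + (scalar_mat N \<alpha> + J_mat N) * A_mat N \<mu> = ?d"
  proof -
    have "scalar_mat N \<alpha> + J_mat N = tridiag N (\<lambda>_. 0) (\<lambda>j. of_real (\<alpha> + real j + 1)) (\<lambda>_. 0)"
      by (rule eq_matI) (auto simp: J_mat_eq)
    moreover have "scalar_mat N \<nu> + J_mat N + 1\<^sub>m N = tridiag N (\<lambda>_. 0) (\<lambda>j. of_real (\<nu> + real j + 2)) (\<lambda>_. 0)"
      by (rule eq_matI) (auto simp: J_mat_eq)
    ultimately show ?thesis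
      by (simp only: A_mat_eq diag_mult_tridiag tridiag_add) (rule eq_matI; auto simp: add_ac)
  qed
  finally have "D1_mat x * basis_mat = (- of_real x) \<cdot>\<^sub>m (?I * basis_mat) + ?d * basis_mat"
    using minv_basis(1) by (simp add: add_mult_distrib_mat[of _ N N _ _ N] mult_smult_assoc_mat[of _ N N _ N])
  also have "\<dots> = basis_mat * ((- of_real x) \<cdot>\<^sub>m ?R + ?e)"
    unfolding minv_basis(2) drift_basis
    by (simp add: mult_add_distrib_mat[of _ N N _ N] mult_smult_distrib[of _ N N _ N])
  also have "(- of_real x) \<cdot>\<^sub>m ?R + ?e = tridiag N (\<lambda>_. - of_real x) (\<lambda>j. of_real (\<nu> + real j + 2 - x)) (\<lambda>_. 0)"
    unfolding tridiag_smult tridiag_add by simp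
  finally show ?thesis .
qed

lemma D0_basis:
  "D0_mat * basis_mat = basis_mat * tridiag N (\<lambda>j. - of_real (\<nu> + real j + 2)) (\<lambda>j. of_real (\<alpha> - \<nu> - real j - 1)) (\<lambda>_. 0)"
proof -
  let ?I = "minv (A_mat N \<mu> + 1\<^sub>m N)"
  let ?R = "tridiag N (\<lambda>_. 1) (\<lambda>_. 1) (\<lambda>_. 0) :: complex mat"
  let ?J = "tridiag N (\<lambda>j. of_real (\<alpha> + real j + 2)) (\<lambda>j. of_nat j + 1) (\<lambda>_. 0) :: complex mat"
  have "D0_mat * basis_mat = of_real (\<alpha> - \<nu>) \<cdot>\<^sub>m (?I * basis_mat) - J_mat N * basis_mat"
    unfolding D0_mat_def using minv_basis(1)
    by (simp add: minus_mult_distrib_mat[of _ N N _ _ N] mult_smult_assoc_mat[of _ N N _ N] J_mat_eq)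
  also have "\<dots> = basis_mat * (of_real (\<alpha> - \<nu>) \<cdot>\<^sub>m ?R - ?J)"
    unfolding minv_basis(2) J_basis
    by (simp add: mult_minus_distrib_mat[of _ N N _ N] mult_smult_distrib[of _ N N _ N])
  \<comment> \<open>Below the diagonal (\<open>\<alpha>\<close> - \<open>\<nu>\<close>) -
    (\<open>\<alpha>\<close> + j + 2) leaves no \<open>\<alpha>\<close>; it survives only as an
    additive constant on the diagonal.\<close>
  also have "of_real (\<alpha> - \<nu>) \<cdot>\<^sub>m ?R - ?J = tridiag N (\<lambda>j. - of_real (\<nu> + real j + 2)) (\<lambda>j. of_real (\<alpha> - \<nu> - real j - 1)) (\<lambda>_. 0)"
    unfolding tridiag_smult tridiag_minus by (rule eq_matI) auto
  finally show ?thesis .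
qed

end

section \<open>Commutation\<close>

abbreviation const_pm :: "complex mat \<Rightarrow> complex poly mat" where
  "const_pm A \<equiv> map_mat (\<lambda>c. [:c:]) A"

lemma eval_const_pm [simp]: "eval_pm (const_pm A) x = A"
  by (rule eq_matI) (auto simp: eval_pm_def)

lemma const_pm_mult:
  assumes "A \<in> carrier_mat n n" "B \<in> carrier_mat n n"
  shows "const_pm (A * B) = const_pm A * const_pm B"
proof (rule eq_matI_carrier[of _ n n])
  fix i j assume ij: "i < n" "j < n"
  have const_sum: "[:\<Sum>l\<in>I. f l:] = (\<Sum>l\<in>I. [:f l:])" for I :: "nat set" and f :: "nat \<Rightarrow> complex"
    by (rule poly_eqI) (simp add: coeff_sum coeff_pCons split: nat.split)
  have "const_pm (A * B) $$ (i,j) = [:(A * B) $$ (i,j):]"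
    using assms ij by simp
  also have "\<dots> = (\<Sum>l<n. const_pm A $$ (i,l) * const_pm B $$ (l,j))"
    unfolding index_mult_mat_sum[OF assms ij] const_sum using assms ij by (simp add: mult.commute)
  also have "\<dots> = (const_pm A * const_pm B) $$ (i,j)"
    using assms ij by (intro index_mult_mat_sum[symmetric, of _ n n _ n]) auto
  finally show "const_pm (A * B) $$ (i,j) = (const_pm A * const_pm B) $$ (i,j)" .
qed (use assms in \<open>auto intro!: mult_carrier_mat[of _ n n]\<close>)

lemma const_pm_one: "const_pm (1\<^sub>m n) = 1\<^sub>m n"
  by (rule eq_matI) (auto simp: pCons_one)

lemma pderiv_mult_const_pm:
  assumes "Q \<in> carrier_mat n n" "A \<in> carrier_mat n n"
  shows "map_mat pderiv (Q * const_pm A) = map_mat pderiv Q * const_pm A"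
proof (rule eq_matI_carrier[of _ n n])
  fix i j assume ij: "i < n" "j < n"
  have A: "const_pm A \<in> carrier_mat n n" using assms by simp
  have "map_mat pderiv (Q * const_pm A) $$ (i,j) = pderiv ((Q * const_pm A) $$ (i,j))"
    using assms ij by simp
  also have "\<dots> = (\<Sum>l<n. map_mat pderiv Q $$ (i,l) * const_pm A $$ (l,j))"
    unfolding index_mult_mat_sum[OF assms(1) A ij] pderiv_sum
    using assms ij by (intro sum.cong refl) (simp add: pderiv_mult pderiv_pCons pderiv_smult)
  also have "\<dots> = (map_mat pderiv Q * const_pm A) $$ (i,j)"
    using assms ij by (intro index_mult_mat_sum[symmetric, of _ n n _ n]) auto
  finally show "map_mat pderiv (Q * const_pm A) $$ (i,j) = (map_mat pderiv Q * const_pm A) $$ (i,j)" .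
qed (use assms in \<open>auto intro!: mult_carrier_mat[of _ n n]\<close>)

lemma D_op_cong:
  assumes "\<And>y. y > 0 \<Longrightarrow> F y = G y" "(x::real) > 0"
  shows "D_op n \<mu> \<alpha> \<nu> F x = D_op n \<mu> \<alpha> \<nu> G x"
proof -
  have "mat_deriv F y = mat_deriv G y" if "y > 0" for y
    using mat_deriv_cong[OF assms(1) that] .
  from this mat_deriv_cong[OF this assms(2)] show ?thesis
    using assms unfolding D_op_def by simp
qed

lemma cal_D_op_cong:
  assumes "\<And>y. y > 0 \<Longrightarrow> F y = G y" "(x::real) > 0"
  shows "cal_D_op n \<mu> \<delta> \<alpha> \<nu> F x = cal_D_op n \<mu> \<delta> \<alpha> \<nu> G x"
proof -
  have "mat_deriv F y = mat_deriv G y" if "y > 0" for y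
    using mat_deriv_cong[OF assms(1) that] .
  from this mat_deriv_cong[OF this assms(2)] show ?thesis
    using assms unfolding cal_D_op_def S_op_def by simp
qed

context laguerre_weight begin

lemma minv_basis_mat [simp]: "minv basis_mat \<in> carrier_mat N N"
  by (rule minv_nonsingular(1)[OF _ det_basis]) simp

text \<open>Row \<open>i\<close> of \<open>Q\<close> in the basis given by \<open>basis_mat\<close>, extended by zero, so that the operators
  acting from the right become operators on sequences of polynomials.\<close>

definition row_coords :: "complex poly mat \<Rightarrow> nat \<Rightarrow> nat \<Rightarrow> complex poly" where
  "row_coords Q i k = (if k < N then (Q * const_pm basis_mat) $$ (i,k) else 0)"

text \<open>The last factor returns from coordinates to the original basis. Only the first N places
  of each image row are kept.\<close>

definition lift_op :: "((nat \<Rightarrow> complex poly) \<Rightarrow> nat \<Rightarrow> complex poly) \<Rightarrow> complex poly mat \<Rightarrow> complex poly mat" where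
  "lift_op f Q = Matrix.mat N N (\<lambda>(i,k). f (row_coords Q i) k) * const_pm (minv basis_mat)"

lemma lift_op_carrier [simp]: "lift_op f Q \<in> carrier_mat N N"
  unfolding lift_op_def by (rule mult_carrier_mat[of _ _ N]) auto

lemma lift_op_basis: "lift_op f Q * const_pm basis_mat = Matrix.mat N N (\<lambda>(i,k). f (row_coords Q i) k)"
proof -
  have "const_pm (minv basis_mat) * const_pm basis_mat = 1\<^sub>m N"
    using const_pm_mult[of "minv basis_mat" N basis_mat] minv_nonsingular[OF carriers(2) det_basis]
    by (simp add: const_pm_one)
  then show ?thesis
    unfolding lift_op_def by (subst assoc_mult_mat[of _ N N _ N _ N]) auto
qed

lemma row_coords_lift_op:
  assumes "i < N" "\<And>k. k \<ge> N \<Longrightarrow> f (row_coords Q i) k = 0"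
  shows "row_coords (lift_op f Q) i = f (row_coords Q i)"
proof
  fix k show "row_coords (lift_op f Q) i k = f (row_coords Q i) k"
    unfolding row_coords_def[of "lift_op f Q"] lift_op_basis using assms by auto
qed

text \<open>The truncation between the two applications loses nothing because \<open>g\<close>
  creates no entries from place N on.\<close>

lemma lift_op_lift_op:
  assumes "\<And>i k. i < N \<Longrightarrow> k \<ge> N \<Longrightarrow> g (row_coords Q i) k = 0"
  shows "lift_op f (lift_op g Q) = lift_op (f \<circ> g) Q"
proof -
  have "Matrix.mat N N (\<lambda>(i,k). f (row_coords (lift_op g Q) i) k) = Matrix.mat N N (\<lambda>(i,k). (f \<circ> g) (row_coords Q i) k)"
    using assms by (intro cong_mat) (auto simp: row_coords_lift_op)
  then show ?thesis unfolding lift_op_def[of f] lift_op_def[of "f \<circ> g"] by (simp only:)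
qed

lemma eval_lift_op_basis:
  assumes "i < N" "k < N"
  shows "(eval_pm (lift_op f Q) x * basis_mat) $$ (i,k) = poly (f (row_coords Q i) k) (of_real x)"
proof -
  have "eval_pm (lift_op f Q) x * basis_mat = eval_pm (lift_op f Q * const_pm basis_mat) x"
    by (subst eval_pm_mult[of _ N]) auto
  then show ?thesis using assms by (simp add: lift_op_basis)
qed

lemma eval_basis_index:
  assumes "Q \<in> carrier_mat N N" "i < N" "k < N"
  shows "(eval_pm Q x * basis_mat) $$ (i,k) = poly (row_coords Q i k) (of_real x)"
proof -
  have c: "Q * const_pm basis_mat \<in> carrier_mat N N" using assms by (auto intro!: mult_carrier_mat[of _ N N])
  have "eval_pm Q x * basis_mat = eval_pm (Q * const_pm basis_mat) x"
    using assms by (subst eval_pm_mult[of _ N]) auto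
  then show ?thesis using assms carrier_matD[OF c] by (simp add: row_coords_def)
qed

lemma row_coords_pderiv:
  assumes "Q \<in> carrier_mat N N" "i < N"
  shows "row_coords (map_mat pderiv Q) i k = pderiv (row_coords Q i k)"
proof -
  have c: "Q * const_pm basis_mat \<in> carrier_mat N N" using assms by (auto intro!: mult_carrier_mat[of _ N N])
  show ?thesis
    unfolding row_coords_def pderiv_mult_const_pm[OF assms(1) carriers(2), symmetric]
    using carrier_matD[OF c] assms by simp
qed

lemma mult_tridiag_row_coords:
  assumes "Q \<in> carrier_mat N N" "i < N" "k < N"
  shows "(eval_pm Q x * basis_mat * tridiag N l a u) $$ (i,k) =
     poly (row_coords Q i k) (of_real x) * a k + poly (row_coords Q i (Suc k)) (of_real x) * l k
     + (if 0 < k then poly (row_coords Q i (k-1)) (of_real x) * u k else 0)"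
proof -
  have c: "eval_pm Q x * basis_mat \<in> carrier_mat N N" using assms by (auto intro!: mult_carrier_mat[of _ N N])
  have "row_coords Q i (Suc k) = 0" if "\<not> k + 1 < N"
    using that by (simp add: row_coords_def)
  then show ?thesis
    unfolding mult_tridiag_index[OF c assms(2,3)]
    using assms by (cases "k + 1 < N"; cases "0 < k"; simp add: eval_basis_index)
qed

text \<open>The bridge from matrix operators to row operators at one fixed \<open>x\<close>, so
  coefficients known only for positive \<open>x\<close> are covered. \<open>basis_mat\<close> is
  constant and hence commutes with differentiation.\<close>

lemma second_order_op_eval:
  assumes Q: "Q \<in> carrier_mat N N"
    and G: "G2 \<in> carrier_mat N N" "G1 \<in> carrier_mat N N" "G0 \<in> carrier_mat N N"
    and basis: "G2 * basis_mat = basis_mat * tridiag N l2 a2 u2" "G1 * basis_mat = basis_mat * tridiag N l1 a1 u1"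
      "G0 * basis_mat = basis_mat * tridiag N l0 a0 u0"
    and f: "\<And>i k q. i < N \<Longrightarrow> k < N \<Longrightarrow> q = row_coords Q i \<Longrightarrow> poly (f q k) (of_real x) =
        poly (pderiv (pderiv (q k))) (of_real x) * a2 k + poly (pderiv (pderiv (q (Suc k)))) (of_real x) * l2 k
        + (if 0 < k then poly (pderiv (pderiv (q (k-1)))) (of_real x) * u2 k else 0)
        + (poly (pderiv (q k)) (of_real x) * a1 k + poly (pderiv (q (Suc k))) (of_real x) * l1 k
        + (if 0 < k then poly (pderiv (q (k-1))) (of_real x) * u1 k else 0))
        + (poly (q k) (of_real x) * a0 k + poly (q (Suc k)) (of_real x) * l0 k
        + (if 0 < k then poly (q (k-1)) (of_real x) * u0 k else 0))"
  shows "mat_deriv (mat_deriv (eval_pm Q)) x * G2 + mat_deriv (eval_pm Q) x * G1 + eval_pm Q x * G0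
     = eval_pm (lift_op f Q) x" (is "?l = ?r")
proof (rule mult_right_cancel_mat[OF _ _ carriers(2) det_basis])
  let ?Q1 = "map_mat pderiv Q" and ?Q2 = "map_mat pderiv (map_mat pderiv Q)"
  have Q1: "?Q1 \<in> carrier_mat N N" and Q2: "?Q2 \<in> carrier_mat N N" using Q by auto
  note mc = mult_carrier_mat[of _ N N _ N]
  have l: "?l = eval_pm ?Q2 x * G2 + eval_pm ?Q1 x * G1 + eval_pm Q x * G0"
    unfolding mat_deriv_eval_pm[OF Q] mat_deriv_eval_pm[OF Q1] ..
  show lc: "?l \<in> carrier_mat N N"
    unfolding l using Q Q1 Q2 G by (intro add_carrier_mat mc) auto
  show "?r \<in> carrier_mat N N" by simp
  have mult_basis: "eval_pm P x * X * basis_mat = eval_pm P x * basis_mat * R"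
    if "P \<in> carrier_mat N N" "X \<in> carrier_mat N N" "X * basis_mat = basis_mat * R" "R \<in> carrier_mat N N" for P X R
    using that by (simp add: assoc_mult_mat[of _ N N _ N _ N])
  have lb: "?l * basis_mat = eval_pm ?Q2 x * basis_mat * tridiag N l2 a2 u2
      + eval_pm ?Q1 x * basis_mat * tridiag N l1 a1 u1 + eval_pm Q x * basis_mat * tridiag N l0 a0 u0"
  proof -
    have "?l * basis_mat = eval_pm ?Q2 x * G2 * basis_mat + eval_pm ?Q1 x * G1 * basis_mat + eval_pm Q x * G0 * basis_mat"
      unfolding l using Q Q1 Q2 G by (simp add: add_mult_distrib_mat[of _ N N _ _ N] mc)
    then show ?thesis
      unfolding mult_basis[OF Q2 G(1) basis(1) tridiag_carrier] mult_basis[OF Q1 G(2) basis(2) tridiag_carrier]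
        mult_basis[OF Q G(3) basis(3) tridiag_carrier] .
  qed
  show "?l * basis_mat = ?r * basis_mat"
  proof (rule eq_matI_carrier[of _ N N])
    show "?l * basis_mat \<in> carrier_mat N N" using lc by (intro mc) auto
    show "?r * basis_mat \<in> carrier_mat N N" by (intro mc) auto
    fix i k assume ik: "i < N" "k < N"
    have c: "eval_pm P x * basis_mat * tridiag N l a u \<in> carrier_mat N N" if "P \<in> carrier_mat N N" for P l a u
      using that by (intro mc) auto
    have "(?l * basis_mat) $$ (i,k) = (eval_pm ?Q2 x * basis_mat * tridiag N l2 a2 u2) $$ (i,k)
      + (eval_pm ?Q1 x * basis_mat * tridiag N l1 a1 u1) $$ (i,k) + (eval_pm Q x * basis_mat * tridiag N l0 a0 u0) $$ (i,k)"
      unfolding lb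
      by (simp only: index_add_mat_carrier[OF add_carrier_mat[OF c[OF Q1]] c[OF Q] ik]
          index_add_mat_carrier[OF c[OF Q2] c[OF Q1] ik])
    also have "\<dots> = poly (f (row_coords Q i) k) (of_real x)"
      unfolding mult_tridiag_row_coords[OF Q2 ik] mult_tridiag_row_coords[OF Q1 ik] mult_tridiag_row_coords[OF Q ik]
        row_coords_pderiv[OF Q1 ik(1)] row_coords_pderiv[OF Q ik(1)] f[OF ik refl] ..
    finally show "(?l * basis_mat) $$ (i,k) = (?r * basis_mat) $$ (i,k)"
      unfolding eval_lift_op_basis[OF ik] .
  qed
qed

definition "D_row = row_D [:complex_of_real \<alpha>:] [:complex_of_real \<nu>:]"
definition "calD_row = row_calD N [:complex_of_real \<nu>:] [:complex_of_real c:] [:complex_of_real d:]"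

lemma D_op_eval:
  assumes "Q \<in> carrier_mat N N"
  shows "D_op N \<mu> \<alpha> \<nu> (eval_pm Q) x = eval_pm (lift_op D_row Q) x"
proof -
  have sc: "scalar_mat N x * basis_mat = basis_mat * tridiag N (\<lambda>_. 0) (\<lambda>_. of_real x) (\<lambda>_. 0)"
  proof (rule eq_matI_carrier[of _ N N])
    fix i j assume ij: "i < N" "j < N"
    show "(scalar_mat N x * basis_mat) $$ (i,j) = (basis_mat * tridiag N (\<lambda>_. 0) (\<lambda>_. of_real x) (\<lambda>_. 0)) $$ (i,j)"
      unfolding mult_tridiag_index[OF carriers(2) ij] using ij
      by (simp add: mult_smult_assoc_mat[of _ N N _ N] left_mult_one_mat[of _ N N] carrier_matD[OF carriers(2)])
  qed (auto intro!: mult_carrier_mat[of _ N N])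
  have c: "D1_mat x \<in> carrier_mat N N" "D0_mat \<in> carrier_mat N N"
    unfolding D1_mat_def D0_mat_def using minv_basis(1)
    by (auto simp: J_mat_eq A_mat_eq intro!: add_carrier_mat mult_carrier_mat[of _ N N])
  show ?thesis
    unfolding D_op_def D1_mat_def[symmetric] D0_mat_def[symmetric]
    by (rule second_order_op_eval[OF assms _ c sc D1_basis D0_basis])
      (auto simp: D_row_def row_D_def algebra_simps)
qed

lemma calD_op_eval:
  assumes "Q \<in> carrier_mat N N" "x > 0"
  shows "cal_D_op N \<mu> \<delta> \<alpha> \<nu> (eval_pm Q) x = eval_pm (lift_op calD_row Q) x"
proof -
  have Phi: "mat_adjoint (Phi x) \<in> carrier_mat N N" and Psi: "mat_adjoint (Psi x) \<in> carrier_mat N N"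
    using assms(2) by simp_all
  have z: "0\<^sub>m N N * basis_mat = basis_mat * tridiag N (\<lambda>_. 0) (\<lambda>_. 0) (\<lambda>_. 0)"
    by (rule eq_matI_carrier[of _ N N]) (auto simp: mult_tridiag_index[OF carriers(2)] left_mult_zero_mat[of _ N N] intro!: mult_carrier_mat[of _ N N])
  have "mat_deriv (mat_deriv (eval_pm Q)) x * mat_adjoint (Phi x) + mat_deriv (eval_pm Q) x * mat_adjoint (Psi x)
      + eval_pm Q x * 0\<^sub>m N N = eval_pm (lift_op calD_row Q) x"
    by (rule second_order_op_eval[OF assms(1) Phi Psi _ Phi_adjoint_basis[OF assms(2), unfolded F2_mat_def]
          Psi_adjoint_basis[OF assms(2), unfolded F1_mat_def] z])
      (auto simp: calD_row_def row_calD_def algebra_simps)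
  moreover have "mat_deriv (mat_deriv (eval_pm Q)) x * mat_adjoint (Phi x) + mat_deriv (eval_pm Q) x * mat_adjoint (Psi x) \<in> carrier_mat N N"
    using assms(1) Phi Psi by (auto simp: mat_deriv_eval_pm[of _ N] intro!: add_carrier_mat mult_carrier_mat[of _ N N])
  ultimately show ?thesis
    using assms(1) unfolding cal_D_op_def S_op_def
    by (simp add: right_mult_zero_mat[of _ N N] right_add_zero_mat[of _ N N])
qed

lemma D_row_support: "(\<And>k. k \<ge> N \<Longrightarrow> q k = 0) \<Longrightarrow> k \<ge> N \<Longrightarrow> D_row q k = 0"
  by (simp add: D_row_def row_D_def)

text \<open>At place N the one term that could survive comes from \<open>q (N - 1)\<close>, and its
  coefficient contains N - N.\<close>

lemma calD_row_support: "(\<And>k. k \<ge> N \<Longrightarrow> q k = 0) \<Longrightarrow> k \<ge> N \<Longrightarrow> calD_row q k = 0"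
  by (cases "k = N") (simp_all add: calD_row_def row_calD_def)

lemma commute_calD_D: "commute_on_polys N (cal_D_op N \<mu> \<delta> \<alpha> \<nu>) (D_op N \<mu> \<alpha> \<nu>)"
  unfolding commute_on_polys_def acts_on_polys_def
proof (intro conjI ballI allI impI)
  fix Q :: "complex poly mat" and x :: real assume Q: "Q \<in> carrier_mat N N" and x: "x > 0"
  have "D_op N \<mu> \<alpha> \<nu> (cal_D_op N \<mu> \<delta> \<alpha> \<nu> (eval_pm Q)) x = D_op N \<mu> \<alpha> \<nu> (eval_pm (lift_op calD_row Q)) x"
    \<comment> \<open>The inner operator is a polynomial only on the half-line, so the replacement
      goes through \<open>D_op_cong\<close> instead of an equality of functions.\<close>
    using calD_op_eval[OF Q] x by (intro D_op_cong) auto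
  also have "\<dots> = eval_pm (lift_op (D_row \<circ> calD_row) Q) x"
    by (subst D_op_eval, simp, subst lift_op_lift_op) (auto intro!: calD_row_support simp: row_coords_def)
  also have "D_row \<circ> calD_row = calD_row \<circ> D_row"
    by (rule ext) (simp add: D_row_def calD_row_def row_D_calD_commute pderiv_pCons)
  also have "eval_pm (lift_op (calD_row \<circ> D_row) Q) x = cal_D_op N \<mu> \<delta> \<alpha> \<nu> (eval_pm (lift_op D_row Q)) x"
    by (subst calD_op_eval[OF _ x], simp, subst lift_op_lift_op) (auto intro!: D_row_support simp: row_coords_def)
  also have "\<dots> = cal_D_op N \<mu> \<delta> \<alpha> \<nu> (D_op N \<mu> \<alpha> \<nu> (eval_pm Q)) x"
    using D_op_eval[OF Q] x by (intro cal_D_op_cong) auto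
  finally show "D_op N \<mu> \<alpha> \<nu> (cal_D_op N \<mu> \<delta> \<alpha> \<nu> (eval_pm Q)) x = cal_D_op N \<mu> \<delta> \<alpha> \<nu> (D_op N \<mu> \<alpha> \<nu> (eval_pm Q)) x" .
qed (use calD_op_eval D_op_eval lift_op_carrier in blast)+

end

section \<open>Symmetry\<close>

lemma cnj_poly_of_real: "cnj (poly p (of_real x)) = poly (map_poly cnj p) (of_real x)"
  by (subst poly_cnj) simp

lemma set_integral_cnj:
  fixes f :: "real \<Rightarrow> complex"
  shows "set_integrable lborel A f \<Longrightarrow> set_integrable lborel A (\<lambda>x. cnj (f x))"
    "set_lebesgue_integral lborel A (\<lambda>x. cnj (f x)) = cnj (set_lebesgue_integral lborel A f)"
proof -
  have eq: "(\<lambda>x. indicator A x *\<^sub>R cnj (f x)) = (\<lambda>x. cnj (indicator A x *\<^sub>R f x))"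
    by (rule ext) simp
  show "set_integrable lborel A f \<Longrightarrow> set_integrable lborel A (\<lambda>x. cnj (f x))"
    unfolding set_integrable_def eq by (rule integrable_cnj)
  show "set_lebesgue_integral lborel A (\<lambda>x. cnj (f x)) = cnj (set_lebesgue_integral lborel A f)"
    unfolding set_lebesgue_integral_def eq by (rule Bochner_Integration.integral_cnj)
qed

lemma set_integrable_cong_pos:
  "(\<And>x. x > 0 \<Longrightarrow> f x = g x) \<Longrightarrow> set_integrable lborel {0<..} f \<longleftrightarrow> set_integrable lborel {0<..} (g :: real \<Rightarrow> complex)"
  by (rule set_integrable_cong) auto

lemma set_integral_cong_pos:
  "(\<And>x. x > 0 \<Longrightarrow> f x = g x) \<Longrightarrow> set_lebesgue_integral lborel {0<..} f = set_lebesgue_integral lborel {0<..} (g :: real \<Rightarrow> complex)"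
  by (rule set_lebesgue_integral_cong) auto

context laguerre_weight begin

definition V_poly :: "complex poly mat" where
  "V_poly = Matrix.mat N N (\<lambda>(i,j).
     if j \<le> i then [:of_real (\<mu> (i+1)):] * (laguerre_poly (i - j) (\<alpha> + real (j+1))) else 0)"

lemma V_poly_carrier [simp]: "V_poly \<in> carrier_mat N N"
  by (simp add: V_poly_def)

lemma eval_V_poly: "eval_pm V_poly x = V_mat x"
  by (rule eq_matI_carrier[of _ N N]) (auto simp: V_mat_index V_poly_def)

text \<open>In terms of G V and H V the weight is diagonal, so a matrix pairing becomes a sum of N
  scalar weighted pairings of polynomials.\<close>

lemma pairing_index:
  assumes G: "G \<in> carrier_mat N N" and H: "H \<in> carrier_mat N N" and ij: "i < N" "j < N"
  shows "(eval_pm G x * W_mat N \<mu> \<delta> \<alpha> \<nu>' x * mat_adjoint (eval_pm H x)) $$ (i,j) =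
    (\<Sum>l<N. eval_pm (G * V_poly) x $$ (i,l) * of_real (diag_weight \<nu>' l x) * cnj (eval_pm (H * V_poly) x $$ (j,l)))"
proof -
  note mc = mult_carrier_mat[of _ N N _ N]
  have c: "eval_pm (G * V_poly) x \<in> carrier_mat N N" "eval_pm (H * V_poly) x \<in> carrier_mat N N"
    using G H by (auto intro!: mc)
  have "eval_pm G x * W_mat N \<mu> \<delta> \<alpha> \<nu>' x * mat_adjoint (eval_pm H x) =
      eval_pm (G * V_poly) x * weight_mat \<nu>' x * mat_adjoint (eval_pm (H * V_poly) x)"
    unfolding W_mat_eq using G H
    by (simp add: eval_pm_mult[of _ N] eval_V_poly mat_adjoint_mult[of _ N] assoc_mult_mat[of _ N N _ N _ N] mc)
  moreover have "(eval_pm (G * V_poly) x * weight_mat \<nu>' x * mat_adjoint (eval_pm (H * V_poly) x)) $$ (i,j)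
    = (\<Sum>l<N. (eval_pm (G * V_poly) x * weight_mat \<nu>' x) $$ (i,l) * mat_adjoint (eval_pm (H * V_poly) x) $$ (l,j))"
    by (rule index_mult_mat_sum[OF mc[OF c(1)] _ ij]) (simp_all add: mat_adjoint_carrier[OF c(2)])
  moreover have "(eval_pm (G * V_poly) x * weight_mat \<nu>' x) $$ (i,l) = eval_pm (G * V_poly) x $$ (i,l) * of_real (diag_weight \<nu>' l x)"
    if "l < N" for l
    unfolding weight_mat_def mult_tridiag_index[OF c(1) ij(1) that] by simp
  moreover have "mat_adjoint (eval_pm (H * V_poly) x) $$ (l,j) = cnj (eval_pm (H * V_poly) x $$ (j,l))" if "l < N" for l
    unfolding mat_adjoint_index[OF c(2) that ij(2)] by simp
  ultimately show ?thesis by simp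
qed

text \<open>Since x^(\<open>\<nu>\<close> + m + l + 1) is x^\<open>\<nu>\<close> times an integer
  power, the one exponent \<open>\<nu>\<close> serves all entries, for the weight itself (m = 0) and
  for the next one (m = 1).\<close>

lemma pairing_weighted:
  assumes G: "G \<in> carrier_mat N N" and H: "H \<in> carrier_mat N N" and ij: "i < N" "j < N"
  shows "gamma_weighted \<nu> (\<lambda>x. (eval_pm G x * W_mat N \<mu> \<delta> \<alpha> (\<nu> + real m) x * mat_adjoint (eval_pm H x)) $$ (i,j))"
proof -
  have dw: "gamma_weighted \<nu> (\<lambda>x. of_real (diag_weight (\<nu> + real m) l x))" for l
  proof (rule gamma_weightedI[where p="monom (of_real (\<delta> (\<nu> + real m) (l+1) / (\<mu> (l+1))\<^sup>2)) (m + l + 1)"])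
    fix x :: real assume "x > 0"
    moreover have "\<nu> + real m + real (l+1) = \<nu> + real (m + l + 1)" by simp
    ultimately have "x powr (\<nu> + real m + real (l+1)) = x powr \<nu> * x ^ (m + l + 1)"
      by (simp only: powr_add[of x \<nu>] powr_realpow)
    then show "complex_of_real (diag_weight (\<nu> + real m) l x) = complex_of_real (exp (- x) * x powr \<nu>) *
        poly (monom (complex_of_real (\<delta> (\<nu> + real m) (l+1) / (\<mu> (l+1))\<^sup>2)) (m + l + 1)) (complex_of_real x)"
      by (simp add: diag_weight_def poly_monom)
  qed
  note mc = mult_carrier_mat[of _ N N _ N]
  have c: "G * V_poly \<in> carrier_mat N N" "H * V_poly \<in> carrier_mat N N"
    using G H by (auto intro!: mc)
  have "gamma_weighted \<nu> (\<lambda>x. \<Sum>l<N. poly (map_poly cnj ((H * V_poly) $$ (j,l))) (of_real x) *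
      (poly ((G * V_poly) $$ (i,l)) (of_real x) * of_real (diag_weight (\<nu> + real m) l x)))"
    by (intro gamma_weighted_sum gamma_weighted_mult_poly dw)
  then show ?thesis
  proof (rule gamma_weighted_cong)
    fix x :: real
    have "poly (map_poly cnj ((H * V_poly) $$ (j,l))) (of_real x) *
      (poly ((G * V_poly) $$ (i,l)) (of_real x) * of_real (diag_weight (\<nu> + real m) l x))
      = eval_pm (G * V_poly) x $$ (i,l) * of_real (diag_weight (\<nu> + real m) l x) * cnj (eval_pm (H * V_poly) x $$ (j,l))"
      if "l < N" for l
      using that ij carrier_matD[OF c(1)] carrier_matD[OF c(2)] by (simp only: eval_pm_index cnj_poly_of_real) simp
    then show "(\<Sum>l<N. poly (map_poly cnj ((H * V_poly) $$ (j,l))) (of_real x) *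
      (poly ((G * V_poly) $$ (i,l)) (of_real x) * of_real (diag_weight (\<nu> + real m) l x)))
      = (eval_pm G x * W_mat N \<mu> \<delta> \<alpha> (\<nu> + real m) x * mat_adjoint (eval_pm H x)) $$ (i,j)"
      unfolding pairing_index[OF assms] by (intro sum.cong refl) simp
  qed
qed


lemma pairing_adjoint:
  assumes G: "G \<in> carrier_mat N N" and H: "H \<in> carrier_mat N N" and ij: "i < N" "j < N"
  shows "(G * W_mat N \<mu> \<delta> \<alpha> \<nu>' x * mat_adjoint H) $$ (i,j) = cnj ((H * W_mat N \<mu> \<delta> \<alpha> \<nu>' x * mat_adjoint G) $$ (j,i))"
proof -
  note mc = mult_carrier_mat[of _ N N _ N]
  have "mat_adjoint (H * W_mat N \<mu> \<delta> \<alpha> \<nu>' x * mat_adjoint G) = G * W_mat N \<mu> \<delta> \<alpha> \<nu>' x * mat_adjoint H"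
    using G H by (simp add: mat_adjoint_mult[of _ N] mc W_hermitian mat_adjoint_adjoint[of _ N] assoc_mult_mat[of _ N N _ N _ N])
  moreover have "H * W_mat N \<mu> \<delta> \<alpha> \<nu>' x * mat_adjoint G \<in> carrier_mat N N"
    using G H by (intro mc) auto
  ultimately show ?thesis
    using mat_adjoint_index[of "H * W_mat N \<mu> \<delta> \<alpha> \<nu>' x * mat_adjoint G" N i j] ij by simp
qed
text \<open>Here \<open>f\<close> + \<open>g\<close> is the derivative of an entry of G' W_next H^*,
  which integrates to 0. Integrability of \<open>f\<close> is inherited from that derivative and
  from \<open>g\<close>.\<close>

lemma calD_integration_by_parts:
  assumes G: "G \<in> carrier_mat N N" and H: "H \<in> carrier_mat N N" and ij: "i < N" "j < N"
  defines "f \<equiv> \<lambda>x. (cal_D_op N \<mu> \<delta> \<alpha> \<nu> (eval_pm G) x * W x * mat_adjoint (eval_pm H x)) $$ (i,j)"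
    and "g \<equiv> \<lambda>x. (eval_pm (map_mat pderiv G) x * W_next x * mat_adjoint (eval_pm (map_mat pderiv H) x)) $$ (i,j)"
  shows "set_integrable lborel {0<..} f"
    and "set_lebesgue_integral lborel {0<..} f = - set_lebesgue_integral lborel {0<..} g"
proof -
  let ?G1 = "map_mat pderiv G" and ?G2 = "map_mat pderiv (map_mat pderiv G)" and ?H1 = "map_mat pderiv H"
  have c: "?G1 \<in> carrier_mat N N" "?G2 \<in> carrier_mat N N" "?H1 \<in> carrier_mat N N" using G H by auto
  note mc = mult_carrier_mat[of _ N N _ N]
  let ?F = "\<lambda>x. eval_pm ?G1 x * W_next x * mat_adjoint (eval_pm H x)"
  have deriv: "((\<lambda>x. ?F x $$ (i,j)) has_vector_derivative f x + g x) (at x)" if x: "x > 0" for x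
  proof -
    have "has_mat_deriv N ?F ((eval_pm ?G2 x * W_next x + eval_pm ?G1 x * mat_deriv W_next x) * mat_adjoint (eval_pm H x)
        + eval_pm ?G1 x * W_next x * mat_adjoint (eval_pm ?H1 x)) x"
      by (rule has_mat_deriv_mult[OF has_mat_deriv_mult[OF has_mat_deriv_eval_pm[OF c(1)] has_mat_deriv_W_next'[OF x]]
            has_mat_deriv_adjoint[OF has_mat_deriv_eval_pm[OF H]]])
    moreover have "eval_pm ?G2 x * W_next x + eval_pm ?G1 x * mat_deriv W_next x = cal_D_op N \<mu> \<delta> \<alpha> \<nu> (eval_pm G) x * W x"
    proof -
      have "cal_D_op N \<mu> \<delta> \<alpha> \<nu> (eval_pm G) x = eval_pm ?G2 x * mat_adjoint (Phi x) + eval_pm ?G1 x * mat_adjoint (Psi x)"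
        unfolding cal_D_op_def S_op_def mat_deriv_eval_pm[OF G] mat_deriv_eval_pm[OF c(1)] ..
      then show ?thesis
        using c x by (simp add: add_mult_distrib_mat[of _ N N _ _ N] mc assoc_mult_mat[of _ N N _ N _ N] Phi_adjoint_W Psi_adjoint_W)
    qed
    moreover have "cal_D_op N \<mu> \<delta> \<alpha> \<nu> (eval_pm G) x * W x * mat_adjoint (eval_pm H x) \<in> carrier_mat N N"
      unfolding calD_op_eval[OF G x] using H by (intro mc) auto
    moreover have "eval_pm ?G1 x * W_next x * mat_adjoint (eval_pm ?H1 x) \<in> carrier_mat N N"
      using c by (intro mc) auto
    ultimately show ?thesis
      using ij unfolding has_mat_deriv_def f_def g_def by (simp add: index_add_mat_carrier[of _ N N])
  qed
  have F: "gamma_weighted \<nu> (\<lambda>x. ?F x $$ (i,j))"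
    using pairing_weighted[OF c(1) H ij, of 1] by simp
  have g: "set_integrable lborel {0<..} g"
    unfolding g_def using pairing_weighted[OF c(1,3) ij, of 1] nu_pos by (intro gamma_weighted_integrable[of \<nu>]) auto
  note fg = gamma_weighted_integral_deriv[OF F nu_pos deriv]
  show f: "set_integrable lborel {0<..} f"
    using set_integral_diff(1)[OF fg(1) g] by simp
  show "set_lebesgue_integral lborel {0<..} f = - set_lebesgue_integral lborel {0<..} g"
    using fg(2) set_integral_add(2)[OF f g] by (simp add: eq_neg_iff_add_eq_0)
qed


text \<open>Both sides equal minus the Dirichlet form, the integral of G' W_next (H')^*, which turns
  into its adjoint when G and H are exchanged.\<close>

lemma symmetric_calD: "symmetric_op N W (cal_D_op N \<mu> \<delta> \<alpha> \<nu>)"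
proof -
  let ?D = "cal_D_op N \<mu> \<delta> \<alpha> \<nu>"
  have main: "set_integrable lborel {0<..} (\<lambda>x. (?D (eval_pm G) x * W x * mat_adjoint (eval_pm H x)) $$ (i,j))
    \<and> set_integrable lborel {0<..} (\<lambda>x. (eval_pm G x * W x * mat_adjoint (?D (eval_pm H) x)) $$ (i,j))
    \<and> set_lebesgue_integral lborel {0<..} (\<lambda>x. (?D (eval_pm G) x * W x * mat_adjoint (eval_pm H x)) $$ (i,j))
      = set_lebesgue_integral lborel {0<..} (\<lambda>x. (eval_pm G x * W x * mat_adjoint (?D (eval_pm H) x)) $$ (i,j))"
    if G: "G \<in> carrier_mat N N" and H: "H \<in> carrier_mat N N" and ij: "i < N" "j < N" for G H i j
  proof -
    note 1 = calD_integration_by_parts[OF G H ij] and 2 = calD_integration_by_parts[OF H G ij(2,1)]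
    let ?h = "\<lambda>x. (?D (eval_pm H) x * W x * mat_adjoint (eval_pm G x)) $$ (j,i)"
    have adj: "(eval_pm G x * W x * mat_adjoint (?D (eval_pm H) x)) $$ (i,j) = cnj (?h x)" if "x > 0" for x
      using G H ij by (intro pairing_adjoint) (simp_all add: calD_op_eval that)
    have adj1: "(eval_pm (map_mat pderiv G) x * W_next x * mat_adjoint (eval_pm (map_mat pderiv H) x)) $$ (i,j)
        = cnj ((eval_pm (map_mat pderiv H) x * W_next x * mat_adjoint (eval_pm (map_mat pderiv G) x)) $$ (j,i))" for x
      using G H ij by (intro pairing_adjoint) simp_all
    have int: "set_integrable lborel {0<..} (\<lambda>x. (eval_pm G x * W x * mat_adjoint (?D (eval_pm H) x)) $$ (i,j))"
      using set_integral_cnj(1)[OF 2(1)] by (subst set_integrable_cong_pos[OF adj])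
    have "set_lebesgue_integral lborel {0<..} (\<lambda>x. (eval_pm G x * W x * mat_adjoint (?D (eval_pm H) x)) $$ (i,j))
        = set_lebesgue_integral lborel {0<..} (\<lambda>x. cnj (?h x))"
      by (rule set_integral_cong_pos[OF adj])
    also have "\<dots> = - set_lebesgue_integral lborel {0<..} (\<lambda>x. cnj ((eval_pm (map_mat pderiv H) x * W_next x * mat_adjoint (eval_pm (map_mat pderiv G) x)) $$ (j,i)))"
      unfolding set_integral_cnj(2) 2(2) by simp
    also have "\<dots> = - set_lebesgue_integral lborel {0<..} (\<lambda>x. (eval_pm (map_mat pderiv G) x * W_next x * mat_adjoint (eval_pm (map_mat pderiv H) x)) $$ (i,j))"
      unfolding adj1 ..
    finally show ?thesis using 1 int by simp
  qed
  show ?thesis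
    unfolding symmetric_op_def mat_integrable_def mat_integral_def
  proof (intro ballI conjI allI impI)
    fix G H :: "complex poly mat" assume GH: "G \<in> carrier_mat N N" "H \<in> carrier_mat N N"
    show "set_integrable lborel {0<..} (\<lambda>x. (?D (eval_pm G) x * W x * mat_adjoint (eval_pm H x)) $$ (i,j))"
      "set_integrable lborel {0<..} (\<lambda>x. (eval_pm G x * W x * mat_adjoint (?D (eval_pm H) x)) $$ (i,j))"
      if "i < N" "j < N" for i j
      using main[OF GH that] by blast+
    show "Matrix.mat N N (\<lambda>(i,j). set_lebesgue_integral lborel {0<..} (\<lambda>x. (?D (eval_pm G) x * W x * mat_adjoint (eval_pm H x)) $$ (i,j)))
      = Matrix.mat N N (\<lambda>(i,j). set_lebesgue_integral lborel {0<..} (\<lambda>x. (eval_pm G x * W x * mat_adjoint (?D (eval_pm H) x)) $$ (i,j)))"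
      by (rule cong_mat) (simp_all only: case_prod_conv main[OF GH])
  qed
qed

end

section \<open>Eigenvalues\<close>

abbreviation coeff_mat :: "nat \<Rightarrow> complex poly mat \<Rightarrow> complex mat" where
  "coeff_mat l Q \<equiv> map_mat (\<lambda>p. coeff p l) Q"

lemma coeff_mat_mult_const:
  assumes "Q \<in> carrier_mat n n" "A \<in> carrier_mat n n"
  shows "coeff_mat l (Q * const_pm A) = coeff_mat l Q * A"
    and "coeff_mat l (const_pm A * Q) = A * coeff_mat l Q"
proof -
  have c: "const_pm A \<in> carrier_mat n n" "coeff_mat l Q \<in> carrier_mat n n" using assms by auto
  have m: "Q * const_pm A \<in> carrier_mat n n" "const_pm A * Q \<in> carrier_mat n n"
    using mult_carrier_mat[OF assms(1) c(1)] mult_carrier_mat[OF c(1) assms(1)] .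
  show "coeff_mat l (Q * const_pm A) = coeff_mat l Q * A"
  proof (rule eq_matI_carrier[of _ n n])
    fix i j assume ij: "i < n" "j < n"
    show "coeff_mat l (Q * const_pm A) $$ (i,j) = (coeff_mat l Q * A) $$ (i,j)"
      unfolding index_mult_mat_sum[OF c(2) assms(2) ij]
      using ij assms carrier_matD[OF m(1)] index_mult_mat_sum[OF assms(1) c(1) ij]
      by (simp add: coeff_sum mult.commute)
  qed (use assms m c in \<open>auto intro!: mult_carrier_mat[of _ n n]\<close>)
  show "coeff_mat l (const_pm A * Q) = A * coeff_mat l Q"
  proof (rule eq_matI_carrier[of _ n n])
    fix i j assume ij: "i < n" "j < n"
    show "coeff_mat l (const_pm A * Q) $$ (i,j) = (A * coeff_mat l Q) $$ (i,j)"
      unfolding index_mult_mat_sum[OF assms(2) c(2) ij]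
      using ij assms carrier_matD[OF m(2)] index_mult_mat_sum[OF c(1) assms(1) ij]
      by (simp add: coeff_sum)
  qed (use assms m c in \<open>auto intro!: mult_carrier_mat[of _ n n]\<close>)
qed

lemma coeff_mat_monic_zero:
  assumes P: "monic_pm n k P" and "m > k"
  shows "coeff_mat m P = 0\<^sub>m n n"
proof (rule eq_matI_carrier[of _ n n])
  fix i j assume ij: "i < n" "j < n"
  then have "degree (P $$ (i,j)) < m"
    using assms unfolding monic_pm_def by (blast intro: le_less_trans)
  then show "coeff_mat m P $$ (i,j) = 0\<^sub>m n n $$ (i,j)"
    using ij P by (auto simp: coeff_eq_0 monic_pm_def)
qed (use P in \<open>auto simp: monic_pm_def\<close>)

lemma coeff_X_mult: "coeff ([:0,1:] * (p :: complex poly)) l = (if l = 0 then 0 else coeff p (l - 1))"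
  by (simp add: coeff_pCons split: nat.split)

context laguerre_weight begin

lemma V_mat_0: "V_mat 0 = basis_mat"
proof -
  have "exp_mat 0 = 1\<^sub>m N"
    by (rule eq_matI_carrier[of _ N N]) (auto simp: exp_mat_def exp_coeff_def)
  then show ?thesis unfolding V_mat_def by (simp add: right_mult_one_mat[of _ N N])
qed

text \<open>Lambda_n in the coordinates of \<open>basis_mat\<close>, and equally the action on
  coefficients of degree n: below the diagonal, d n (n-1) from the second derivative and d n (j + 3
  + \<open>\<nu>\<close>) from the first add up to d n (j + 2 + \<open>\<nu>\<close> + n).\<close>

definition eigen_row_mat :: "nat \<Rightarrow> complex mat" where
  "eigen_row_mat n = tridiag N (\<lambda>j. of_real (real n * (d * (real j + 2 + \<nu> + real n))))
     (\<lambda>j. of_real (real n * (d * (real j - real N) - c))) (\<lambda>_. 0)"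

lemma eigen_row_mat_carrier [simp]: "eigen_row_mat n \<in> carrier_mat N N"
  by (simp add: eigen_row_mat_def)

lemma Lambda_mat_basis:
  assumes "cf \<nu> = c" "df \<nu> = d"
  shows "Lambda_mat N \<mu> cf df \<alpha> \<nu> n \<in> carrier_mat N N"
    "Lambda_mat N \<mu> cf df \<alpha> \<nu> n * basis_mat = basis_mat * eigen_row_mat n"
proof -
  note mc = mult_carrier_mat[of _ N N _ N]
  let ?L = "L_mat N \<mu> \<alpha> 0"
  define Y where "Y = of_real (df \<nu>) \<cdot>\<^sub>m
        (J_mat N - (J_mat N + scalar_mat N \<nu> + scalar_mat N (real n)) * A_mat N \<mu>
         - scalar_mat N (real N) - 1\<^sub>m N) - scalar_mat N (cf \<nu>)"
  define Z where "Z = (of_nat n \<cdot>\<^sub>m Y :: complex mat)"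
  have b: "basis_mat = ?L * mu_mat"
    by (simp only: L_mat_mult_mu V_mat_0)
  have det: "det ?L \<noteq> 0"
    using det_basis det_mult[of ?L N mu_mat] unfolding b by auto
  have s: "J_mat N + scalar_mat N \<nu> + scalar_mat N (real n) = tridiag N (\<lambda>_. 0) (\<lambda>j. of_real (real j + 1 + \<nu> + real n)) (\<lambda>_. 0)"
    by (rule eq_matI) (auto simp: J_mat_eq)
  have Y_eq: "Y = tridiag N (\<lambda>j. of_real (d * (real j + 2 + \<nu> + real n) * \<mu> (j+2) / \<mu> (j+1)))
      (\<lambda>j. of_real (d * (real j - real N) - c)) (\<lambda>_. 0)"
    unfolding Y_def s A_mat_eq diag_mult_tridiag assms
    by (rule eq_matI) (auto simp: J_mat_eq algebra_simps add_divide_distrib)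
  have Z: "Z \<in> carrier_mat N N" by (simp add: Z_def Y_eq)
  have Z_eq: "Z = tridiag N (\<lambda>j. of_real (real n * (d * (real j + 2 + \<nu> + real n) * \<mu> (j+2) / \<mu> (j+1))))
      (\<lambda>j. of_real (real n * (d * (real j - real N) - c))) (\<lambda>_. 0)"
    unfolding Z_def Y_eq tridiag_smult by (rule eq_matI) auto
  have Lam: "Lambda_mat N \<mu> cf df \<alpha> \<nu> n = ?L * Z * minv ?L"
    unfolding Lambda_mat_def K_mat_def Y_def[symmetric] Z_def
    using minv_nonsingular(1)[OF carriers(6) det]
    by (simp add: Y_eq mult_smult_distrib[of _ N N _ N] mult_smult_assoc_mat[of _ N N _ N] mc)
  show "Lambda_mat N \<mu> cf df \<alpha> \<nu> n \<in> carrier_mat N N"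
    unfolding Lam using minv_nonsingular(1)[OF carriers(6) det] Z by (intro mc) auto
  have Zmu: "Z * mu_mat = mu_mat * eigen_row_mat n"
  proof (rule eq_matI_carrier[of _ N N])
    fix i j assume ij: "i < N" "j < N"
    show "(Z * mu_mat) $$ (i,j) = (mu_mat * eigen_row_mat n) $$ (i,j)"
      unfolding mu_mat_def eigen_row_mat_def
      unfolding mult_tridiag_index[OF Z ij] tridiag_mult_index[OF tridiag_carrier ij]
      using ij by (auto simp: Z_eq)
  qed (use Z in \<open>auto intro!: mc\<close>)
  have "Lambda_mat N \<mu> cf df \<alpha> \<nu> n * basis_mat = ?L * Z * (minv ?L * (?L * mu_mat))"
    unfolding Lam b using minv_nonsingular(1)[OF carriers(6) det] Z by (simp add: assoc_mult_mat[of _ N N _ N _ N] mc)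
  also have "minv ?L * (?L * mu_mat) = mu_mat"
    using minv_nonsingular[OF carriers(6) det] by (subst assoc_mult_mat[of _ N N _ N _ N, symmetric]) (simp_all add: left_mult_one_mat[of _ N N])
  also have "?L * Z * mu_mat = basis_mat * eigen_row_mat n"
    unfolding b using Z by (simp add: assoc_mult_mat[of _ N N _ N _ N] Zmu)
  finally show "Lambda_mat N \<mu> cf df \<alpha> \<nu> n * basis_mat = basis_mat * eigen_row_mat n" .
qed

lemma coeff_calD_row:
  assumes "\<And>k m. m > l \<Longrightarrow> coeff (q k) m = 0"
  shows "coeff (calD_row q k) l = coeff (q k) l * of_real (real l * (d * (real k - real N) - c))
     + coeff (q (Suc k)) l * of_real (real l * (d * (real k + 2 + \<nu> + real l)))"
proof -
  \<comment> \<open>Each power of x is split off as a separate factor so that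
    \<open>coeff_X_mult\<close> applies; terms with fewer factors x than derivatives read
    coefficients beyond degree l, which vanish.\<close>
  have eq: "calD_row q k =
     [:0,1:] * ([:of_real (d * (real k + 1) + c):] * pderiv (pderiv (q k)))
     + [:0,1:] * ([:0,1:] * ([:of_real d:] * pderiv (pderiv (q (Suc k)))))
     + [:0,1:] * ([:of_real (d * (real k - real N) - c):] * pderiv (q k))
     + [:of_real ((d * (real k + 1) + c) * (real k + 2 + \<nu>)):] * pderiv (q k)
     + [:0,1:] * ([:of_real (d * (real k + 3 + \<nu>)):] * pderiv (q (Suc k)))
     - [:of_real (d * real k * (real N - real k)):] * pderiv (q (k - 1))"
    by (rule poly_eq_poly_eq_iff[THEN iffD1], rule ext) (simp add: calD_row_def row_calD_def algebra_simps)
  have "coeff (calD_row q k) l = coeff (q k) l * of_real (real l * (d * (real k - real N) - c))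
     + coeff (q (Suc k)) l * of_real (real l * (real l - 1) * d + real l * (d * (real k + 3 + \<nu>)))"
    unfolding eq coeff_add coeff_diff coeff_X_mult
    by (cases l; cases "l - 1") (simp_all add: coeff_pderiv assms algebra_simps)
  then show ?thesis by (simp add: algebra_simps)
qed

lemma coeff_row_coords:
  assumes "Q \<in> carrier_mat N N" "i < N"
  shows "coeff (row_coords Q i k) l = (if k < N then (coeff_mat l Q * basis_mat) $$ (i,k) else 0)"
proof -
  have c: "Q * const_pm basis_mat \<in> carrier_mat N N" using assms(1) by (auto intro!: mult_carrier_mat[of _ N N])
  then show ?thesis
    unfolding row_coords_def coeff_mat_mult_const(1)[OF assms(1) carriers(2), symmetric]
    using assms carrier_matD[OF c] by auto
qed

lemma coeff_mat_lift_calD: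
  assumes Q: "Q \<in> carrier_mat N N" and deg: "\<And>m. m > l \<Longrightarrow> coeff_mat m Q = 0\<^sub>m N N"
  shows "coeff_mat l (lift_op calD_row Q) * basis_mat = coeff_mat l Q * basis_mat * eigen_row_mat l"
proof (rule eq_matI_carrier[of _ N N])
  note mc = mult_carrier_mat[of _ N N _ N]
  have c: "coeff_mat l Q * basis_mat \<in> carrier_mat N N" using Q by (intro mc) auto
  show "coeff_mat l Q * basis_mat * eigen_row_mat l \<in> carrier_mat N N" by (rule mc[OF c]) simp
  show "coeff_mat l (lift_op calD_row Q) * basis_mat \<in> carrier_mat N N"
    by (intro mc map_carrier_mat[THEN iffD2]) auto
  fix i k assume ik: "i < N" "k < N"
  have z: "coeff (row_coords Q i k) m = 0" if "m > l" for k m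
    unfolding coeff_row_coords[OF Q ik(1)] deg[OF that] using ik(1) by (simp add: left_mult_zero_mat[of _ N N])
  have cr: "coeff (calD_row (row_coords Q i) k) l = coeff (row_coords Q i k) l * of_real (real l * (d * (real k - real N) - c))
     + coeff (row_coords Q i (Suc k)) l * of_real (real l * (d * (real k + 2 + \<nu> + real l)))"
    by (rule coeff_calD_row) (rule z)
  have "(coeff_mat l (lift_op calD_row Q) * basis_mat) $$ (i,k) = coeff (calD_row (row_coords Q i) k) l"
    unfolding coeff_mat_mult_const(1)[OF lift_op_carrier carriers(2), symmetric] lift_op_basis using ik by simp
  also have "\<dots> = (coeff_mat l Q * basis_mat * eigen_row_mat l) $$ (i,k)"
    unfolding cr eigen_row_mat_def mult_tridiag_index[OF c ik] coeff_row_coords[OF Q ik(1)]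
    using ik by simp
  finally show "(coeff_mat l (lift_op calD_row Q) * basis_mat) $$ (i,k) = (coeff_mat l Q * basis_mat * eigen_row_mat l) $$ (i,k)" .
qed

lemma coeff_mat_lift_calD_zero:
  assumes Q: "Q \<in> carrier_mat N N" and deg: "\<And>m. m \<ge> l \<Longrightarrow> coeff_mat m Q = 0\<^sub>m N N"
  shows "coeff_mat l (lift_op calD_row Q) = 0\<^sub>m N N"
proof (rule mult_right_cancel_mat[OF _ _ carriers(2) det_basis])
  show "coeff_mat l (lift_op calD_row Q) * basis_mat = 0\<^sub>m N N * basis_mat"
    using deg by (simp add: coeff_mat_lift_calD[OF Q] left_mult_zero_mat[of _ N N])
  show "coeff_mat l (lift_op calD_row Q) \<in> carrier_mat N N"
    by (intro map_carrier_mat[THEN iffD2]) auto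
qed auto

text \<open>At degree n the leading coefficient is the identity and both sides are Lambda_n; above n
  both vanish.\<close>

lemma coeff_mat_lift_calD_monic:
  assumes P: "monic_pm N n P" and cd: "cf \<nu> = c" "df \<nu> = d" and l: "l \<ge> n"
  shows "coeff_mat l (lift_op calD_row P) = coeff_mat l (const_pm (Lambda_mat N \<mu> cf df \<alpha> \<nu> n) * P)"
proof -
  let ?Lam = "Lambda_mat N \<mu> cf df \<alpha> \<nu> n"
  have Pc: "P \<in> carrier_mat N N" and P1: "coeff_mat n P = 1\<^sub>m N"
    using P by (auto simp: monic_pm_def)
  note P0 = coeff_mat_monic_zero[OF P]
  note Lc = Lambda_mat_basis[where cf=cf and df=df and n=n, OF cd]
  have R: "coeff_mat l (const_pm ?Lam * P) = ?Lam * coeff_mat l P"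
    by (rule coeff_mat_mult_const(2)[OF Pc Lc(1)])
  show ?thesis
  proof (cases "l = n")
    case True
    have "coeff_mat n (lift_op calD_row P) * basis_mat = ?Lam * basis_mat"
      by (subst coeff_mat_lift_calD[OF Pc P0]) (auto simp: P1 Lc(2) left_mult_one_mat[of _ N N])
    then have "coeff_mat n (lift_op calD_row P) = ?Lam"
      by (rule mult_right_cancel_mat[OF _ Lc(1) carriers(2) det_basis, rotated]) (intro map_carrier_mat[THEN iffD2], simp)
    then show ?thesis using R True Lc(1) P1 by (simp add: right_mult_one_mat[of _ N N])
  next
    case False
    then show ?thesis
      unfolding R using l P0 Lc(1) by (subst coeff_mat_lift_calD_zero[OF Pc]) (auto simp: right_mult_zero_mat[of _ N N])
  qed
qed

end

lemma eval_pm_minus: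
  "A \<in> carrier_mat n m \<Longrightarrow> B \<in> carrier_mat n m \<Longrightarrow> eval_pm (A - B) x = eval_pm A x - eval_pm B x"
  by (rule eq_matI) (auto simp: eval_pm_def)

lemma coeff_mat_minus:
  "A \<in> carrier_mat n m \<Longrightarrow> B \<in> carrier_mat n m \<Longrightarrow> coeff_mat l (A - B) = coeff_mat l A - coeff_mat l B"
  by (rule eq_matI) auto

lemma index_minus_mat_carrier:
  "B \<in> carrier_mat n m \<Longrightarrow> i < n \<Longrightarrow> j < m \<Longrightarrow> (A - B) $$ (i,j) = A $$ (i,j) - B $$ (i,j)"
  by simp

text \<open>A nonzero polynomial has finitely many roots, a null set, which would make the unit
  interval null.\<close>

lemma poly_zero_AE_pos:
  fixes p :: "complex poly"
  assumes "AE x in lborel. x > 0 \<longrightarrow> poly p (of_real x) = 0"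
  shows "p = 0"
proof (rule ccontr)
  assume "p \<noteq> 0"
  then have "finite {z. poly p z = 0}" by (rule poly_roots_finite)
  then have "finite ((of_real :: real \<Rightarrow> complex) -` {z. poly p z = 0})"
    by (rule finite_vimageI) (simp add: inj_def)
  then have "AE x in lborel. x \<notin> (of_real :: real \<Rightarrow> complex) -` {z. poly p z = 0}"
    by (intro AE_not_in finite_imp_null_set_lborel)
  with assms have "AE x in lborel. x \<notin> {0<..<1::real}"
    by eventually_elim auto
  then have "emeasure lborel {0<..<1::real} = 0"
    by (subst (asm) AE_iff_measurable[of "{0<..<1}"]) auto
  then show False by simp
qed

context laguerre_weight begin

section \<open>The matrix valued inner product and the eigenvalue equation\<close>

definition inner_mat :: "complex poly mat \<Rightarrow> complex poly mat \<Rightarrow> complex mat" where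
  "inner_mat G H = mat_integral N (\<lambda>x. eval_pm G x * W x * mat_adjoint (eval_pm H x))"

lemma inner_mat_carrier [simp]: "inner_mat G H \<in> carrier_mat N N"
  by (simp add: inner_mat_def mat_integral_def)

lemma inner_mat_index:
  "i < N \<Longrightarrow> j < N \<Longrightarrow> inner_mat G H $$ (i,j) =
     set_lebesgue_integral lborel {0<..} (\<lambda>x. (eval_pm G x * W x * mat_adjoint (eval_pm H x)) $$ (i,j))"
  by (simp add: inner_mat_def mat_integral_def)

lemma pairing_integrable:
  assumes "G \<in> carrier_mat N N" "H \<in> carrier_mat N N" "i < N" "j < N"
  shows "set_integrable lborel {0<..} (\<lambda>x. (eval_pm G x * W x * mat_adjoint (eval_pm H x)) $$ (i,j))"
  using pairing_weighted[OF assms, of 0] nu_pos by (intro gamma_weighted_integrable[of \<nu>]) auto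

lemma inner_mat_adjoint:
  assumes "G \<in> carrier_mat N N" "H \<in> carrier_mat N N"
  shows "inner_mat G H = mat_adjoint (inner_mat H G)"
proof (rule eq_matI_carrier[of _ N N])
  fix i j assume ij: "i < N" "j < N"
  show "inner_mat G H $$ (i,j) = mat_adjoint (inner_mat H G) $$ (i,j)"
    unfolding mat_adjoint_index[OF inner_mat_carrier ij] inner_mat_index[OF ij] inner_mat_index[OF ij(2,1)]
      pairing_adjoint[OF eval_pm_carrier[OF assms(1)] eval_pm_carrier[OF assms(2)] ij] set_integral_cnj(2)
    by simp
qed auto

lemma inner_mat_minus_left:
  assumes "G \<in> carrier_mat N N" "G' \<in> carrier_mat N N" "H \<in> carrier_mat N N"
  shows "inner_mat (G - G') H = inner_mat G H - inner_mat G' H"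
proof (rule eq_matI_carrier[of _ N N])
  fix i j assume ij: "i < N" "j < N"
  note mc = mult_carrier_mat[of _ N N _ N]
  have "(eval_pm (G - G') x * W x * mat_adjoint (eval_pm H x)) $$ (i,j) =
     (eval_pm G x * W x * mat_adjoint (eval_pm H x)) $$ (i,j) - (eval_pm G' x * W x * mat_adjoint (eval_pm H x)) $$ (i,j)" for x
  proof -
    note eval_pm_minus[OF assms(1,2), of x]
    then have "eval_pm (G - G') x * W x * mat_adjoint (eval_pm H x)
      = eval_pm G x * W x * mat_adjoint (eval_pm H x) - eval_pm G' x * W x * mat_adjoint (eval_pm H x)"
      using assms by (simp add: minus_mult_distrib_mat[of _ N N _ _ N] mc)
    moreover have "eval_pm G' x * W x * mat_adjoint (eval_pm H x) \<in> carrier_mat N N"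
      using assms by (intro mc) auto
    ultimately show ?thesis using ij by (simp only: index_minus_mat_carrier)
  qed
  then show "inner_mat (G - G') H $$ (i,j) = (inner_mat G H - inner_mat G' H) $$ (i,j)"
    using ij carrier_matD[OF inner_mat_carrier[of G' H]] pairing_integrable[OF assms(1,3) ij] pairing_integrable[OF assms(2,3) ij]
    by (simp add: inner_mat_index set_integral_diff)
qed (auto intro!: minus_carrier_mat)

lemma inner_mat_const_left:
  assumes C: "C \<in> carrier_mat N N" and G: "G \<in> carrier_mat N N" and H: "H \<in> carrier_mat N N"
  shows "inner_mat (const_pm C * G) H = C * inner_mat G H"
proof (rule eq_matI_carrier[of _ N N])
  fix i j assume ij: "i < N" "j < N"
  note mc = mult_carrier_mat[of _ N N _ N]
  let ?M = "\<lambda>x. eval_pm G x * W x * mat_adjoint (eval_pm H x)"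
  have M: "?M x \<in> carrier_mat N N" for x using G H by (intro mc) auto
  have eq: "(eval_pm (const_pm C * G) x * W x * mat_adjoint (eval_pm H x)) $$ (i,j) = (\<Sum>k<N. C $$ (i,k) * ?M x $$ (k,j))" for x
  proof -
    have "eval_pm (const_pm C * G) x * W x * mat_adjoint (eval_pm H x) = C * ?M x"
      using C G H by (simp add: eval_pm_mult[of _ N] assoc_mult_mat[of _ N N _ N _ N] mc)
    then show ?thesis by (simp only: index_mult_mat_sum[OF C M ij])
  qed
  have "inner_mat (const_pm C * G) H $$ (i,j) = (\<Sum>k<N. C $$ (i,k) * set_lebesgue_integral lborel {0<..} (\<lambda>x. ?M x $$ (k,j)))"
  proof -
    have "integrable lborel (\<lambda>x. indicator {0<..} x *\<^sub>R (C $$ (i,k) * ?M x $$ (k,j)))" if "k < N" for k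
      using set_integrable_mult_right[OF pairing_integrable[OF G H that ij(2)], of "C $$ (i,k)"]
      unfolding set_integrable_def .
    then have "inner_mat (const_pm C * G) H $$ (i,j)
        = (\<Sum>k<N. set_lebesgue_integral lborel {0<..} (\<lambda>x. C $$ (i,k) * ?M x $$ (k,j)))"
      unfolding inner_mat_index[OF ij] eq set_lebesgue_integral_def scaleR_sum_right
      by (intro Bochner_Integration.integral_sum) simp
    then show ?thesis by simp
  qed
  also have "\<dots> = (C * inner_mat G H) $$ (i,j)"
    unfolding index_mult_mat_sum[OF C inner_mat_carrier ij] using ij by (simp add: inner_mat_index)
  finally show "inner_mat (const_pm C * G) H $$ (i,j) = (C * inner_mat G H) $$ (i,j)" .
qed (use C in \<open>auto intro!: mult_carrier_mat[of _ N N]\<close>)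

lemma inner_mat_zero_left:
  assumes "H \<in> carrier_mat N N"
  shows "inner_mat (0\<^sub>m N N) H = 0\<^sub>m N N"
  using inner_mat_minus_left[OF zero_carrier_mat zero_carrier_mat assms] by (auto simp: minus_r_inv_mat[of _ N N])

lemma inner_mat_calD:
  assumes G: "G \<in> carrier_mat N N" and H: "H \<in> carrier_mat N N"
  shows "inner_mat (lift_op calD_row G) H = inner_mat G (lift_op calD_row H)"
proof -
  let ?D = "cal_D_op N \<mu> \<delta> \<alpha> \<nu>"
  have "mat_integral N (\<lambda>x. ?D (eval_pm G) x * W x * mat_adjoint (eval_pm H x)) =
        mat_integral N (\<lambda>x. eval_pm G x * W x * mat_adjoint (?D (eval_pm H) x))"
    using symmetric_calD G H unfolding symmetric_op_def by blast
  moreover have "mat_integral N (\<lambda>x. ?D (eval_pm G) x * W x * mat_adjoint (eval_pm H x)) = inner_mat (lift_op calD_row G) H"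
    unfolding inner_mat_def mat_integral_def
    by (rule cong_mat; simp only: case_prod_conv; rule set_integral_cong_pos) (simp_all only: calD_op_eval[OF G])
  moreover have "mat_integral N (\<lambda>x. eval_pm G x * W x * mat_adjoint (?D (eval_pm H) x)) = inner_mat G (lift_op calD_row H)"
    unfolding inner_mat_def mat_integral_def
    by (rule cong_mat; simp only: case_prod_conv; rule set_integral_cong_pos) (simp_all only: calD_op_eval[OF H])
  ultimately show ?thesis by simp
qed

text \<open>The i-th diagonal entry of the pairing is the sum over l of a positive weight times the
  squared modulus of (R V)(i,l). A zero integral forces these polynomials to vanish, and V is
  invertible at every real \<open>x\<close>.\<close>

lemma inner_mat_definite:
  assumes R: "R \<in> carrier_mat N N" and zero: "inner_mat R R = 0\<^sub>m N N"
  shows "eval_pm R x = 0\<^sub>m N N"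
proof -
  note mc = mult_carrier_mat[of _ N N _ N]
  have RV: "R * V_poly \<in> carrier_mat N N" using R by (intro mc) auto
  have RV0: "(R * V_poly) $$ (i,l) = 0" if il: "i < N" "l < N" for i l
  proof -
    let ?h = "\<lambda>x. \<Sum>l<N. diag_weight \<nu> l x * (cmod (poly ((R * V_poly) $$ (i,l)) (of_real x)))\<^sup>2"
    have term_nonneg: "diag_weight \<nu> l x * (cmod (poly ((R * V_poly) $$ (i,l)) (of_real x)))\<^sup>2 \<ge> 0" if "x > 0" "l < N" for x l
      using diag_weight_pos[OF that] by simp
    have h: "(eval_pm R x * W x * mat_adjoint (eval_pm R x)) $$ (i,i) = of_real (?h x)" for x
      unfolding pairing_index[OF R R il(1) il(1)] of_real_sum
    proof (rule sum.cong[OF refl])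
      fix l assume "l \<in> {..<N}"
      then have "eval_pm (R * V_poly) x $$ (i,l) = poly ((R * V_poly) $$ (i,l)) (of_real x)"
        using carrier_matD[OF RV] il(1) by (intro eval_pm_index) auto
      moreover have "z * of_real a * cnj z = of_real (a * (cmod z)\<^sup>2)" for z :: complex and a
      proof -
        have "z * of_real a * cnj z = of_real a * (z * cnj z)" by (simp only: ac_simps)
        also have "\<dots> = of_real (a * (cmod z)\<^sup>2)" by (simp only: complex_norm_square[symmetric] of_real_mult)
        finally show ?thesis .
      qed
      ultimately show "eval_pm (R * V_poly) x $$ (i,l) * of_real (diag_weight \<nu> l x) * cnj (eval_pm (R * V_poly) x $$ (i,l))
         = of_real (diag_weight \<nu> l x * (cmod (poly ((R * V_poly) $$ (i,l)) (of_real x)))\<^sup>2)" by (simp only:)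
    qed
    have int: "set_integrable lborel {0<..} (\<lambda>x. complex_of_real (?h x))"
      using pairing_integrable[OF R R il(1) il(1)] unfolding h .
    have intr: "integrable lborel (\<lambda>x. indicator {0<..} x * ?h x)"
      using integrable_Re[OF int[unfolded set_integrable_def]] by simp
    have "set_lebesgue_integral lborel {0<..} (\<lambda>x. complex_of_real (?h x)) = 0"
      using inner_mat_index[OF il(1) il(1), of R R] zero il unfolding h by simp
    then have "(LINT x|lborel. indicator {0<..} x * ?h x) = 0"
      using integral_Re[OF int[unfolded set_integrable_def]] unfolding set_lebesgue_integral_def by simp
    moreover have "0 \<le> indicator {0<..} x * ?h x" for x :: real
      using term_nonneg by (auto simp: indicator_def intro!: sum_nonneg)
    ultimately have "AE x in lborel. indicator {0<..} x * ?h x = 0"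
      using integral_nonneg_eq_0_iff_AE[OF intr] by simp
    then have "AE x in lborel. x > 0 \<longrightarrow> poly ((R * V_poly) $$ (i,l)) (of_real x) = 0"
    proof eventually_elim
      fix x :: real assume hx: "indicator {0<..} x * ?h x = 0"
      show "x > 0 \<longrightarrow> poly ((R * V_poly) $$ (i,l)) (of_real x) = 0"
      proof
        assume x: "x > 0"
        with hx have "?h x = 0" by simp
        then have "diag_weight \<nu> l x * (cmod (poly ((R * V_poly) $$ (i,l)) (of_real x)))\<^sup>2 = 0"
          by (subst (asm) sum_nonneg_eq_0_iff) (use term_nonneg[OF x] il in auto)
        then show "poly ((R * V_poly) $$ (i,l)) (of_real x) = 0"
          using diag_weight_pos[OF x il(2)] by simp
      qed
    qed
    then show ?thesis by (rule poly_zero_AE_pos)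
  qed
  have "R * V_poly = 0\<^sub>m N N"
    by (rule eq_matI_carrier[OF RV]) (simp_all add: RV0)
  then have "eval_pm R x * V_mat x = eval_pm (0\<^sub>m N N) x"
    using eval_pm_mult[OF R V_poly_carrier, of x] by (simp add: eval_V_poly)
  also have "eval_pm (0\<^sub>m N N) x = 0\<^sub>m N N * V_mat x"
    unfolding left_mult_zero_mat[OF carriers(4)] by (rule eq_matI) (auto simp: eval_pm_def)
  finally show ?thesis
    by (rule mult_right_cancel_mat[OF eval_pm_carrier[OF R] zero_carrier_mat carriers(4) det_V])
qed

text \<open>Induction on the degree bound: subtracting C P_k, with C the coefficient of degree k,
  lowers the bound, and C P_k is itself orthogonal to P_n because k < n.\<close>

lemma inner_mat_lower_degree:
  assumes orth: "monic_orthogonal N W P" and "k \<le> n" and "Q \<in> carrier_mat N N"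
    and "\<And>l. l \<ge> k \<Longrightarrow> coeff_mat l Q = 0\<^sub>m N N"
  shows "inner_mat Q (P n) = 0\<^sub>m N N"
  using assms(2-)
proof (induction k arbitrary: Q)
  have Pm: "monic_pm N m (P m)" and Pc: "P m \<in> carrier_mat N N" for m
    using orth by (auto simp: monic_orthogonal_def monic_pm_def)
  {
    case 0
    have "Q = 0\<^sub>m N N"
    proof (rule eq_matI_carrier[of _ N N])
      fix i j assume ij: "i < N" "j < N"
      have "coeff (Q $$ (i,j)) l = 0" for l
        using arg_cong[OF 0(3)[of l], of "\<lambda>A. A $$ (i,j)"] ij 0(2) by simp
      then show "Q $$ (i,j) = 0\<^sub>m N N $$ (i,j)"
        using ij by (simp add: poly_eq_iff)
    qed (use 0 in auto)
    then show ?case using inner_mat_zero_left[OF Pc] by simp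
  next
    case (Suc k)
    let ?C = "coeff_mat k Q"
    have C: "?C \<in> carrier_mat N N" using Suc.prems by auto
    have CP: "const_pm ?C * P k \<in> carrier_mat N N" using C Pc by (intro mult_carrier_mat[of _ N N]) auto
    have "inner_mat (Q - const_pm ?C * P k) (P n) = 0\<^sub>m N N"
    proof (rule Suc.IH)
      show "Q - const_pm ?C * P k \<in> carrier_mat N N" using CP by (rule minus_carrier_mat)
      fix l assume l: "k \<le> l"
      have "coeff_mat l (Q - const_pm ?C * P k) = coeff_mat l Q - coeff_mat l (const_pm ?C * P k)"
        by (rule coeff_mat_minus[OF Suc.prems(2) CP])
      also have "\<dots> = coeff_mat l Q - ?C * coeff_mat l (P k)"
        unfolding coeff_mat_mult_const(2)[OF Pc C] ..
      also have "\<dots> = 0\<^sub>m N N"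
      proof (cases "l = k")
        case True
        then show ?thesis using Pm[of k] C by (simp add: monic_pm_def right_mult_one_mat[of _ N N] minus_r_inv_mat[of _ N N])
      next
        case False
        then have "l > k" using l by simp
        then show ?thesis using Suc.prems(3)[of l] coeff_mat_monic_zero[OF Pm] C by (simp add: right_mult_zero_mat[of _ N N] minus_r_inv_mat[of _ N N])
      qed
      finally show "coeff_mat l (Q - const_pm ?C * P k) = 0\<^sub>m N N" .
    qed (use Suc.prems in auto)
    moreover have "inner_mat (const_pm ?C * P k) (P n) = 0\<^sub>m N N"
    proof -
      have "inner_mat (P k) (P n) = 0\<^sub>m N N"
        using orth Suc.prems(1) unfolding monic_orthogonal_def inner_mat_def by auto
      then show ?thesis
        using C by (simp add: inner_mat_const_left[OF C Pc Pc] right_mult_zero_mat[of _ N N])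
    qed
    ultimately have "inner_mat Q (P n) - 0\<^sub>m N N = 0\<^sub>m N N"
      using inner_mat_minus_left[OF Suc.prems(2) CP Pc] by simp
    moreover have "inner_mat Q (P n) - 0\<^sub>m N N = inner_mat Q (P n)"
      by (rule eq_matI_carrier[of _ N N]) auto
    ultimately show ?case by simp
  }
qed

lemma eigen_calD:
  assumes orth: "monic_orthogonal N W P" and cd: "cf \<nu> = c" "df \<nu> = d" and x: "x > 0"
  shows "cal_D_op N \<mu> \<delta> \<alpha> \<nu> (eval_pm (P n)) x = Lambda_mat N \<mu> cf df \<alpha> \<nu> n * eval_pm (P n) x"
proof -
  let ?Lam = "Lambda_mat N \<mu> cf df \<alpha> \<nu> n"
  have Pm: "monic_pm N n (P n)" and Pc: "P n \<in> carrier_mat N N"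
    using orth by (auto simp: monic_orthogonal_def monic_pm_def)
  note Lc = Lambda_mat_basis(1)[where cf=cf and df=df and n=n, OF cd]
  define R where "R = lift_op calD_row (P n) - const_pm ?Lam * P n"
  have LP: "const_pm ?Lam * P n \<in> carrier_mat N N" using Lc Pc by (intro mult_carrier_mat[of _ N N]) auto
  have R: "R \<in> carrier_mat N N" unfolding R_def using LP by (rule minus_carrier_mat)
  have R0: "coeff_mat l R = 0\<^sub>m N N" if "l \<ge> n" for l
  proof -
    have "coeff_mat l R = coeff_mat l (lift_op calD_row (P n)) - coeff_mat l (const_pm ?Lam * P n)"
      unfolding R_def by (rule coeff_mat_minus[OF lift_op_carrier LP])
    also have "\<dots> = 0\<^sub>m N N"
      unfolding coeff_mat_lift_calD_monic[where cf=cf and df=df, OF Pm cd that]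
      using LP by (simp add: minus_r_inv_mat[of _ N N])
    finally show ?thesis .
  qed
  have PQ: "inner_mat (P n) Q = 0\<^sub>m N N" if "Q \<in> carrier_mat N N" "\<And>l. l \<ge> n \<Longrightarrow> coeff_mat l Q = 0\<^sub>m N N" for Q
  proof -
    have "mat_adjoint (0\<^sub>m N N :: complex mat) = 0\<^sub>m N N"
      by (rule eq_matI_carrier[of _ N N]) auto
    then show ?thesis
      using inner_mat_lower_degree[OF orth order.refl that] by (subst inner_mat_adjoint[OF Pc that(1)]) simp
  qed
  have "inner_mat R R = inner_mat (lift_op calD_row (P n)) R - inner_mat (const_pm ?Lam * P n) R"
    using inner_mat_minus_left[OF lift_op_carrier LP R] by (simp only: R_def)
  \<comment> \<open>Symmetry moves the operator onto R, whose image again has degree below n and is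
    thus orthogonal to P_n.\<close>
  also have "inner_mat (lift_op calD_row (P n)) R = 0\<^sub>m N N"
    unfolding inner_mat_calD[OF Pc R] using R R0 by (intro PQ coeff_mat_lift_calD_zero) auto
  also have "inner_mat (const_pm ?Lam * P n) R = 0\<^sub>m N N"
    using Lc by (simp add: inner_mat_const_left[OF Lc Pc R] PQ[OF R R0] right_mult_zero_mat[of _ N N])
  finally have "inner_mat R R = 0\<^sub>m N N" by (simp add: minus_r_inv_mat[of _ N N])
  then have "eval_pm R x = 0\<^sub>m N N" by (rule inner_mat_definite[OF R])
  moreover have "eval_pm R x = eval_pm (lift_op calD_row (P n)) x - ?Lam * eval_pm (P n) x"
  proof -
    have "eval_pm R x = eval_pm (lift_op calD_row (P n)) x - eval_pm (const_pm ?Lam * P n) x"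
      unfolding R_def by (rule eval_pm_minus[OF lift_op_carrier LP])
    then show ?thesis using Lc Pc by (simp add: eval_pm_mult[of _ N])
  qed
  ultimately have "eval_pm (lift_op calD_row (P n)) x - ?Lam * eval_pm (P n) x = 0\<^sub>m N N" by simp
  moreover have "A = B" if "A \<in> carrier_mat N N" "B \<in> carrier_mat N N" "A - B = 0\<^sub>m N N" for A B :: "complex mat"
  proof (rule eq_matI_carrier[OF that(1,2)])
    fix i j assume ij: "i < N" "j < N"
    show "A $$ (i,j) = B $$ (i,j)"
      using arg_cong[OF that(3), of "\<lambda>X. X $$ (i,j)"] that(1,2) ij by simp
  qed
  ultimately show ?thesis
    unfolding calD_op_eval[OF Pc x] using Lc Pc mult_carrier_mat[OF Lc eval_pm_carrier[OF Pc]] by simp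
qed

end

theorem corollary6p3:
  fixes N :: nat and \<mu> :: "nat \<Rightarrow> real" and \<alpha> \<nu>0 \<nu> :: real
    and \<delta> :: "real \<Rightarrow> nat \<Rightarrow> real" and c d :: "real \<Rightarrow> real"
    and P :: "nat \<Rightarrow> complex poly mat"
  assumes "N \<ge> 1"
    and "\<And>k. k \<in> {1..N} \<Longrightarrow> \<mu> k \<noteq> 0"
    and "\<alpha> > 0" and "\<nu>0 > 0"
    and "\<And>\<nu>' k. \<nu>' \<in> {\<nu>0 + real l | l. True} \<Longrightarrow> k \<in> {1..N} \<Longrightarrow> \<delta> \<nu>' k > 0"
    and "\<And>\<nu>' k. \<nu>' \<in> {\<nu>0 + real l | l. True} \<Longrightarrow> k \<in> {1..N} \<Longrightarrow>
           \<delta> (\<nu>' + 1) k = (d \<nu>' * real k + c \<nu>') * \<delta> \<nu>' k"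
    and "\<And>\<nu>' k. \<nu>' \<in> {\<nu>0 + real l | l. True} \<Longrightarrow> k \<in> {1..N-1} \<Longrightarrow>
           (\<mu> (k+1))\<^sup>2 / (\<mu> k)\<^sup>2 =
             d \<nu>' * real k * (real N - real k) * (\<delta> \<nu>' (k+1) / \<delta> (\<nu>' + 1) k)"
    and "\<nu> \<in> {\<nu>0 + real l | l. True}"
    and "monic_orthogonal N (W_mat N \<mu> \<delta> \<alpha> \<nu>) P"
  shows "symmetric_op N (W_mat N \<mu> \<delta> \<alpha> \<nu>) (cal_D_op N \<mu> \<delta> \<alpha> \<nu>) \<and>
         (\<forall>n. \<forall>x>0. cal_D_op N \<mu> \<delta> \<alpha> \<nu> (eval_pm (P n)) x =
                     Lambda_mat N \<mu> c d \<alpha> \<nu> n * eval_pm (P n) x) \<and>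
         commute_on_polys N (cal_D_op N \<mu> \<delta> \<alpha> \<nu>) (D_op N \<mu> \<alpha> \<nu>)"
proof -
  \<comment> \<open>Positivity of \<open>\<delta>\<close> at \<open>\<nu>\<close> + 1 is what
    permits clearing it from the denominator of the condition on mu.\<close>
  have next_in: "\<nu> + 1 \<in> {\<nu>0 + real l | l. True}"
    using assms(8) by (auto intro: exI[of _ "Suc _"])
  have ratio: "\<delta> (\<nu> + 1) k / (\<mu> k)\<^sup>2 = d \<nu> * real k * (real N - real k) * (\<delta> \<nu> (k+1) / (\<mu> (k+1))\<^sup>2)"
    if k: "k \<in> {1..N-1}" for k
  proof -
    have "k \<in> {1..N}" "k + 1 \<in> {1..N}" using k by auto
    then have nz: "\<mu> k \<noteq> 0" "\<mu> (k+1) \<noteq> 0" "\<delta> (\<nu> + 1) k \<noteq> 0"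
      using assms(2) assms(5)[OF next_in, of k] by auto
    have "(\<mu> (k+1))\<^sup>2 * \<delta> (\<nu> + 1) k = d \<nu> * real k * (real N - real k) * \<delta> \<nu> (k+1) * (\<mu> k)\<^sup>2"
      using assms(7)[OF assms(8) k] nz by (simp add: divide_simps ac_simps)
    then show ?thesis using nz by (simp add: divide_simps ac_simps)
  qed
  interpret laguerre_weight N \<mu> \<alpha> \<nu> \<delta> "c \<nu>" "d \<nu>"
    using assms(2) assms(4) assms(5)[OF assms(8)] assms(6)[OF assms(8)] assms(8) ratio
    by unfold_locales auto
  show ?thesis
    using symmetric_calD eigen_calD[where cf=c and df=d, OF assms(9) refl refl] commute_calD_D by blast
qed

end
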